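(* Let $m,p,n$ be positive integers with $p\mid m$ and $m$ even, and let $W=\mu(G(m,p,n))$. The noncommutative coinvariant algebra $\underline S_W=S_{-1}(V)/I_W$ of $W$, viewed as a $\mathbb C W$-module, affords the regular representation of $W$.
   Context: $\mu(G(m,p,n))$ is the group of $n\times n$ monomial complex matrices whose non-zero entries are $m$-th roots of unity and whose determinant is an $\frac mp$-th root of unity. It acts faithfully on the $n$-dimensional complex vector space $V$ with fixed basis $x_1,\dots,x_n$. $S_{-1}(V)$ is the $\mathbb C$-algebra generated by $x_1,\dots,x_n$ subject to $x_ix_j=-x_jx_i$ for $i\neq j$, graded with the $x_i$ in degree $1$; since $m$ is even, $W$ acts on it by graded algebra automorphisms extending the action on $V$. $I_W$ is the two-sided ideal of $S_{-1}(V)$ generated by the homogeneous $W$-invariants of positive degree; it is $W$-stable, so $W$ acts on the quotient $\underline S_W=S_{-1}(V)/I_W$ by algebra automorphisms. *)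

theory Defs
  imports "HOL-Analysis.Determinants" "HOL-Algebra.Module" "HOL-Algebra.QuotRing"
    "HOL-Algebra.Algebraic_Closure_Type"
begin

section \<open>Complex representations of groups\<close>

text \<open>A \<open>\<complex>G\<close>-module is given by a complex vector space \<open>M\<close> together with the action \<open>\<rho>\<close> of the
  elements of \<open>G\<close>. The library's module records extend ring records; in this section only the
  underlying vector space of \<open>M\<close> is used.\<close>

abbreviation complex_ring :: "complex ring"
  where "complex_ring \<equiv> ring_of_type_algebra"

definition linear_maps ::
    "(complex, 'v, 'b) module_scheme \<Rightarrow> (complex, 'w, 'c) module_scheme \<Rightarrow> ('v \<Rightarrow> 'w) set"
  where "linear_maps M N = {f \<in> carrier M \<rightarrow> carrier N.
    (\<forall>x\<in>carrier M. \<forall>y\<in>carrier M. f (x \<oplus>\<^bsub>M\<^esub> y) = f x \<oplus>\<^bsub>N\<^esub> f y) \<and>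
    (\<forall>c. \<forall>x\<in>carrier M. f (c \<odot>\<^bsub>M\<^esub> x) = c \<odot>\<^bsub>N\<^esub> f x)}"

definition representation ::
    "('g, 'a) monoid_scheme \<Rightarrow> (complex, 'v, 'b) module_scheme \<Rightarrow> ('g \<Rightarrow> 'v \<Rightarrow> 'v) \<Rightarrow> bool"
  where "representation G M \<rho> \<longleftrightarrow> group G \<and> Module.module complex_ring M \<and>
    (\<forall>g\<in>carrier G. \<rho> g \<in> linear_maps M M) \<and>
    (\<forall>v\<in>carrier M. \<rho> \<one>\<^bsub>G\<^esub> v = v) \<and>
    (\<forall>g\<in>carrier G. \<forall>h\<in>carrier G. \<forall>v\<in>carrier M. \<rho> (g \<otimes>\<^bsub>G\<^esub> h) v = \<rho> g (\<rho> h v))"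

definition representation_isomorphic ::
    "('g, 'a) monoid_scheme \<Rightarrow>
      (complex, 'v, 'b) module_scheme \<Rightarrow> ('g \<Rightarrow> 'v \<Rightarrow> 'v) \<Rightarrow>
      (complex, 'w, 'c) module_scheme \<Rightarrow> ('g \<Rightarrow> 'w \<Rightarrow> 'w) \<Rightarrow> bool"
  where "representation_isomorphic G M \<rho> N \<sigma> \<longleftrightarrow>
    (\<exists>\<phi>\<in>linear_maps M N. bij_betw \<phi> (carrier M) (carrier N) \<and>
      (\<forall>g\<in>carrier G. \<forall>v\<in>carrier M. \<phi> (\<rho> g v) = \<sigma> g (\<phi> v)))"

definition group_algebra ::
    "('g, 'a) monoid_scheme \<Rightarrow> (complex, 'g \<Rightarrow> complex) module"
  where "group_algebra G = \<lparr>
    carrier = {f. finite {x. f x \<noteq> 0} \<and> {x. f x \<noteq> 0} \<subseteq> carrier G},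
    monoid.mult = (\<lambda>f h x. if x \<in> carrier G
      then \<Sum>y | y \<in> carrier G \<and> f y \<noteq> 0. f y * h (inv\<^bsub>G\<^esub> y \<otimes>\<^bsub>G\<^esub> x) else 0),
    monoid.one = (\<lambda>x. if x = \<one>\<^bsub>G\<^esub> then 1 else 0),
    ring.zero = (\<lambda>x. 0),
    ring.add = (\<lambda>f h x. f x + h x),
    module.smult = (\<lambda>c f x. c * f x)\<rparr>"

definition regular_action ::
    "('g, 'a) monoid_scheme \<Rightarrow> 'g \<Rightarrow> ('g \<Rightarrow> complex) \<Rightarrow> 'g \<Rightarrow> complex"
  where "regular_action G g f = (\<lambda>x. if x = g then 1 else 0) \<otimes>\<^bsub>group_algebra G\<^esub> f"

definition affords_regular_representation ::
    "('g, 'a) monoid_scheme \<Rightarrow> (complex, 'v, 'b) module_scheme \<Rightarrow> ('g \<Rightarrow> 'v \<Rightarrow> 'v) \<Rightarrow> bool"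
  where "affords_regular_representation G M \<rho> \<longleftrightarrow> representation G M \<rho> \<and>
    representation_isomorphic G (group_algebra G) (regular_action G) M \<rho>"


section \<open>Quotients of complex algebras\<close>

text \<open>The ring \<open>A Quot I\<close> of the library, with the induced scalar multiplication.\<close>

definition quotient_algebra ::
    "(complex, 'v, 'b) module_scheme \<Rightarrow> 'v set \<Rightarrow> (complex, 'v set) module"
  where "quotient_algebra A I = ring.extend (A Quot I)
    (module.fields (\<lambda>c B. \<Union>x\<in>B. I +>\<^bsub>A\<^esub> (c \<odot>\<^bsub>A\<^esub> x)))"

text \<open>The map \<open>I + x \<mapsto> I + \<alpha> x\<close> induced by an additive map \<open>\<alpha>\<close> with \<open>\<alpha> ` I \<subseteq> I\<close>; the union
  is then over equal cosets.\<close>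

definition quotient_map ::
    "(complex, 'v, 'b) module_scheme \<Rightarrow> 'v set \<Rightarrow> ('v \<Rightarrow> 'v) \<Rightarrow> 'v set \<Rightarrow> 'v set"
  where "quotient_map A I \<alpha> B = (\<Union>x\<in>B. I +>\<^bsub>A\<^esub> \<alpha> x)"


section \<open>The mystic reflection groups \<open>\<mu>(G(m,p,n))\<close>\<close>

definition monomial_matrix :: "complex^'n^'n \<Rightarrow> bool"
  where "monomial_matrix A \<longleftrightarrow> (\<forall>i. \<exists>!j. A $ i $ j \<noteq> 0) \<and> (\<forall>j. \<exists>!i. A $ i $ j \<noteq> 0)"

text \<open>Here \<open>n\<close> is the cardinality of the index type \<open>'n\<close>.\<close>

definition mystic_group :: "nat \<Rightarrow> nat \<Rightarrow> (complex^'n::finite^'n) monoid"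
  where "mystic_group m p = \<lparr>
    carrier = {A. monomial_matrix A \<and>
      (\<forall>i j. A $ i $ j \<noteq> 0 \<longrightarrow> (A $ i $ j) ^ m = 1) \<and> det A ^ (m div p) = 1},
    monoid.mult = (**),
    monoid.one = mat 1\<rparr>"


section \<open>The skew polynomial algebra \<open>S\<^sub>-\<^sub>1(V)\<close>\<close>

text \<open>The free associative algebra on the variables \<open>x\<^sub>i\<close>, \<open>i :: 'n\<close>: words in the variables are
  lists over \<open>'n\<close>, and an element is the function giving the coefficient of each word.\<close>

definition free_algebra :: "(complex, 'n list \<Rightarrow> complex) module"
  where "free_algebra = \<lparr>
    carrier = {f. finite {w. f w \<noteq> 0}},
    monoid.mult = (\<lambda>f g w. \<Sum>k\<le>length w. f (take k w) * g (drop k w)),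
    monoid.one = (\<lambda>w. if w = [] then 1 else 0),
    ring.zero = (\<lambda>w. 0),
    ring.add = (\<lambda>f g w. f w + g w),
    module.smult = (\<lambda>c f w. c * f w)\<rparr>"

definition free_var :: "'n \<Rightarrow> 'n list \<Rightarrow> complex"
  where "free_var i = (\<lambda>w. if w = [i] then 1 else 0)"

definition skew_ideal :: "('n list \<Rightarrow> complex) set"
  where "skew_ideal = Idl\<^bsub>free_algebra\<^esub>
    {free_var i \<otimes>\<^bsub>free_algebra\<^esub> free_var j \<oplus>\<^bsub>free_algebra\<^esub> free_var j \<otimes>\<^bsub>free_algebra\<^esub> free_var i | i j. i \<noteq> j}"

definition skew_algebra :: "(complex, ('n list \<Rightarrow> complex) set) module"
  where "skew_algebra = quotient_algebra free_algebra skew_ideal"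

definition skew_homogeneous :: "nat \<Rightarrow> ('n list \<Rightarrow> complex) set set"
  where "skew_homogeneous d =
    {skew_ideal +>\<^bsub>free_algebra\<^esub> f | f. f \<in> carrier free_algebra \<and> (\<forall>w. f w \<noteq> 0 \<longrightarrow> length w = d)}"

text \<open>A matrix acts on \<open>V\<close> by \<open>x\<^sub>j \<mapsto> (\<Sum>i. A $ i $ j * x\<^sub>i)\<close>; the extension to an algebra
  endomorphism of the free algebra sends the word \<open>u\<close> to the product of these sums over the
  letters of \<open>u\<close>, so the coefficient of \<open>w\<close> in it is \<open>\<Prod>k. A $ (w ! k) $ (u ! k)\<close>.\<close>

definition free_action :: "complex^'n::finite^'n \<Rightarrow> ('n list \<Rightarrow> complex) \<Rightarrow> 'n list \<Rightarrow> complex"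
  where "free_action A f w =
    (\<Sum>u | length u = length w. (\<Prod>k<length w. A $ (w ! k) $ (u ! k)) * f u)"

text \<open>For monomial matrices the ideal of relations is stable.\<close>

definition skew_action ::
    "complex^'n::finite^'n \<Rightarrow> ('n list \<Rightarrow> complex) set \<Rightarrow> ('n list \<Rightarrow> complex) set"
  where "skew_action A = quotient_map free_algebra skew_ideal (free_action A)"


section \<open>The noncommutative coinvariant algebra\<close>

definition invariant_ideal :: "(complex^'n::finite^'n) monoid \<Rightarrow> ('n list \<Rightarrow> complex) set set"
  where "invariant_ideal W = Idl\<^bsub>skew_algebra\<^esub>
    {s. (\<exists>d>0. s \<in> skew_homogeneous d) \<and> (\<forall>A\<in>carrier W. skew_action A s = s)}"

definition coinvariant_algebra ::
    "(complex^'n::finite^'n) monoid \<Rightarrow> (complex, ('n list \<Rightarrow> complex) set set) module"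
  where "coinvariant_algebra W = quotient_algebra skew_algebra (invariant_ideal W)"

definition coinvariant_action ::
    "(complex^'n::finite^'n) monoid \<Rightarrow> complex^'n^'n \<Rightarrow>
      ('n list \<Rightarrow> complex) set set \<Rightarrow> ('n list \<Rightarrow> complex) set set"
  where "coinvariant_action W A = quotient_map skew_algebra (invariant_ideal W) (skew_action A)"

end

theory Submission
  imports Defs "HOL-Library.Function_Algebras" "HOL-Library.Multiset"
begin

unbundle no fps_syntax

text \<open>Let \<open>n\<close> be the number of variables, \<open>q = m div p\<close>, and let \<open>N\<close> be the ideal of the free algebra whose
quotient is the coinvariant algebra. The proof compares that quotient with a deformation of it.
For a commutative polynomial ring, replacing the relations ``invariant = 0'' by ``invariant = its
value at a generic point'' gives the functions on a free orbit, which visibly carry the regular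
representation. In the skew polynomial algebra there are not enough points, but one linear functional
is a substitute for evaluation at a generic point.

The functional \<open>\<lambda>\<close> (\<open>twisted_eval\<close>) vanishes on the skew relations, and
\<open>\<lambda> (u z v) = c * \<lambda> (u v)\<close> for all words \<open>u\<close>, \<open>v\<close> whenever the letters of \<open>z\<close> all occur with the same
parity; here \<open>c\<close> depends only on \<open>z\<close> and the length of \<open>v\<close>. As \<open>m\<close> is even, the group \<open>W\<close> contains the
diagonal matrices with two entries \<open>-1\<close> and all others \<open>1\<close>, so modulo the skew relations an invariant
is a combination of such words \<open>z\<close> (\<open>balanced_part_exists\<close>). Therefore \<open>\<lambda>\<close> treats invariants like
scalars. The equivariant map \<open>\<Phi>\<close> that sends a word \<open>w\<close> to the function \<open>g \<mapsto> \<lambda> (g\<^sup>-\<^sup>1 w)\<close> on \<open>W\<close>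
(\<open>orbit_fun\<close>) then sends \<open>u f v\<close>, for \<open>f\<close> invariant and homogeneous of positive degree, to a multiple
of \<open>\<Phi> (u v)\<close>, which comes from a shorter word. It is onto the functions on \<open>W\<close> (\<open>delta_in_span\<close>):
inserting \<open>x\<^sub>i\<^sup>m\<close> multiplies \<open>\<Phi> w\<close> by a function that sees the permutation part of \<open>g\<close>, and for a
fixed permutation inserting a letter multiplies, up to a constant, by a matrix entry of \<open>g\<^sup>-\<^sup>1\<close>.

Passing from the deformation back to the graded quotient is Maschke's theorem: \<open>\<Phi> w\<close> is corrected
by its equivariant projection to the span of the \<open>\<Phi> w'\<close> with \<open>w'\<close> shorter. The corrected map
(\<open>graded_map\<close>) is still equivariant and onto, and it kills \<open>N\<close>.

It remains to bound the dimension of the quotient by the order of \<open>W\<close>, which is at least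
\<open>n! * q * m\<^sup>n\<^sup>-\<^sup>1\<close> (\<open>card_mystic_group\<close>). Among the invariants are the elementary symmetric polynomials
in the central elements \<open>y\<^sub>i = x\<^sub>i\<^sup>m\<close> and \<open>\<theta> = (x\<^sub>1 \<cdots> x\<^sub>n)\<^sup>q\<close>, since a monomial matrix acts on
\<open>x\<^sub>1 \<cdots> x\<^sub>n\<close> by its determinant. Write exponents as \<open>c + m b\<close> with \<open>0 \<le> c\<^sub>i < m\<close>. For fixed \<open>c\<close> the
monomials span a quotient of the commutative ring in the \<open>y\<^sub>i\<close> by \<open>e\<^sub>1, \<dots>, e\<^sub>n\<^sub>-\<^sub>1\<close> and by the product of
the \<open>y\<^sub>i\<close> with \<open>c\<^sub>i < q\<close>, because \<open>\<theta>\<close> divides the monomial as soon as \<open>y\<^sub>i\<close> occurs for those \<open>i\<close>. If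
there are \<open>k\<close> such \<open>i\<close>, peeling off one factor at a time leaves \<open>k\<close> coinvariant rings in \<open>n - 1\<close>
variables, hence dimension at most \<open>k * (n - 1)!\<close> (\<open>coinvariant_span_product\<close>). Summing \<open>k\<close> over all
\<open>c\<close> gives \<open>n * q * m\<^sup>n\<^sup>-\<^sup>1\<close>, and the bound follows (\<open>coinvariant_span_bound\<close>).\<close>

section \<open>Complex algebras and their quotients\<close>

locale complex_algebra = Module.module complex_ring A + ring A
  for A :: "(complex, 'v, 'b) module_scheme" (structure) +
  assumes smult_mult_left: "x \<in> carrier A \<Longrightarrow> y \<in> carrier A \<Longrightarrow> (c \<odot> x) \<otimes> y = c \<odot> (x \<otimes> y)"
    and smult_mult_right: "x \<in> carrier A \<Longrightarrow> y \<in> carrier A \<Longrightarrow> x \<otimes> (c \<odot> y) = c \<odot> (x \<otimes> y)"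

lemma complex_ring_simps [simp]:
  "carrier complex_ring = UNIV" "x \<oplus>\<^bsub>complex_ring\<^esub> y = x + y" "x \<otimes>\<^bsub>complex_ring\<^esub> y = x * y"
  "\<one>\<^bsub>complex_ring\<^esub> = 1" "\<zero>\<^bsub>complex_ring\<^esub> = 0"
  by (simp_all add: ring_of_type_algebra_def)

lemma complex_moduleI:
  fixes M (structure)
  assumes "abelian_group M"
    and "\<And>c x. x \<in> carrier M \<Longrightarrow> c \<odot> x \<in> carrier M"
    and "\<And>c d x. x \<in> carrier M \<Longrightarrow> (c + d) \<odot> x = c \<odot> x \<oplus> d \<odot> x"
    and "\<And>c x y. x \<in> carrier M \<Longrightarrow> y \<in> carrier M \<Longrightarrow> c \<odot> (x \<oplus> y) = c \<odot> x \<oplus> c \<odot> y"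
    and "\<And>c d x. x \<in> carrier M \<Longrightarrow> (c * d) \<odot> x = c \<odot> (d \<odot> x)"
    and "\<And>x. x \<in> carrier M \<Longrightarrow> 1 \<odot> x = x"
  shows "Module.module complex_ring M"
  by (rule moduleI) (use assms cring_from_type_algebra in \<open>auto\<close>)

context complex_algebra
begin

lemma sm_closed [simp]: "x \<in> carrier A \<Longrightarrow> c \<odot> x \<in> carrier A"
  using smult_closed[of c x] by simp

text \<open>Closure under scalars supplies negatives, so an ideal of a complex algebra may be
introduced as a subspace.\<close>

lemma minus_eq_smult:
  assumes "x \<in> carrier A"
  shows "\<ominus> x = (- 1) \<odot> x"
proof (rule minus_equality)
  have "(- 1) \<odot> x \<oplus> x = (- 1) \<odot> x \<oplus> 1 \<odot> x"
    using assms smult_one[of x] by simp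
  also have "\<dots> = (- 1 + 1) \<odot> x"
    using smult_l_distr[of "- 1" 1 x] assms by simp
  also have "\<dots> = \<zero>" using smult_l_null[of x] assms by simp
  finally show "(- 1) \<odot> x \<oplus> x = \<zero>" .
qed (use assms in auto)

lemma subspace_idealI:
  assumes "I \<subseteq> carrier A" "\<zero> \<in> I" "\<And>x y. x \<in> I \<Longrightarrow> y \<in> I \<Longrightarrow> x \<oplus> y \<in> I"
    and smult: "\<And>c x. x \<in> I \<Longrightarrow> c \<odot> x \<in> I"
    and "\<And>x a. x \<in> I \<Longrightarrow> a \<in> carrier A \<Longrightarrow> a \<otimes> x \<in> I" "\<And>x a. x \<in> I \<Longrightarrow> a \<in> carrier A \<Longrightarrow> x \<otimes> a \<in> I"
  shows "ideal I A"
proof (rule idealI[OF ring_axioms])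
  have inv: "inv\<^bsub>add_monoid A\<^esub> x \<in> I" if "x \<in> I" for x
  proof -
    have "\<ominus> x \<in> I" using minus_eq_smult[of x] smult[OF that, of "- 1"] assms(1) that by auto
    then show ?thesis by (simp add: a_inv_def)
  qed
  show "subgroup I (add_monoid A)"
    by (rule subgroup.intro) (use assms inv in auto)
qed (use assms in auto)

lemma ideal_smult_closed:
  assumes "ideal I A" "x \<in> I"
  shows "c \<odot> x \<in> I"
proof -
  interpret I: ideal I A by fact
  have "(c \<odot> \<one>) \<otimes> x \<in> I"
    by (rule I.I_l_closed) (use assms in auto)
  moreover have "(c \<odot> \<one>) \<otimes> x = c \<odot> x"
    using assms I.Icarr by (simp add: smult_mult_left)
  ultimately show ?thesis by simp
qed

text \<open>Both the induced action of a group element and the scalar multiplication of a quotient are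
  unions of this shape.\<close>

lemma quotient_map_coset:
  assumes I: "ideal I A" and x: "x \<in> carrier A"
    and clos: "\<And>x. x \<in> carrier A \<Longrightarrow> \<alpha> x \<in> carrier A"
    and add: "\<And>x y. x \<in> carrier A \<Longrightarrow> y \<in> carrier A \<Longrightarrow> \<alpha> (x \<oplus> y) = \<alpha> x \<oplus> \<alpha> y"
    and stable: "\<And>x. x \<in> I \<Longrightarrow> \<alpha> x \<in> I"
  shows "quotient_map A I \<alpha> (I +> x) = I +> \<alpha> x"
proof -
  interpret I: ideal I A by fact
  have "I +> \<alpha> z = I +> \<alpha> x" if "z \<in> I +> x" for z
  proof -
    obtain h where h: "h \<in> I" "z = h \<oplus> x"
      using \<open>z \<in> I +> x\<close> by (auto simp: a_r_coset_def r_coset_def)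
    then have "\<alpha> z = \<alpha> h \<oplus> \<alpha> x" using add x I.Icarr by simp
    then have "\<alpha> z \<ominus> \<alpha> x = \<alpha> h"
      using h(1) x clos I.Icarr by (simp add: a_assoc minus_eq r_neg)
    then show ?thesis
      using quotient_eq_iff_same_a_r_cos[OF I, of "\<alpha> z" "\<alpha> x"] stable h clos x I.Icarr by simp
  qed
  moreover have "x \<in> I +> x" using x I.a_rcos_self by simp
  ultimately show ?thesis unfolding quotient_map_def by blast
qed

context
  fixes I assumes I: "ideal I A"
begin

interpretation I: ideal I A by (rule I)

lemma quotient_algebra_carrier: "carrier (quotient_algebra A I) = (\<lambda>x. I +> x) ` carrier A"
  by (auto simp: quotient_algebra_def ring.defs FactRing_simps)

lemma quotient_algebra_add:
  "x \<in> carrier A \<Longrightarrow> y \<in> carrier A \<Longrightarrow>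
    (I +> x) \<oplus>\<^bsub>quotient_algebra A I\<^esub> (I +> y) = I +> (x \<oplus> y)"
  by (simp add: quotient_algebra_def ring.defs FactRing_simps I.a_rcos_sum)

lemma quotient_algebra_mult:
  "x \<in> carrier A \<Longrightarrow> y \<in> carrier A \<Longrightarrow>
    (I +> x) \<otimes>\<^bsub>quotient_algebra A I\<^esub> (I +> y) = I +> (x \<otimes> y)"
  by (simp add: quotient_algebra_def ring.defs FactRing_simps I.rcoset_mult_add)

lemma quotient_algebra_smult:
  assumes "x \<in> carrier A"
  shows "c \<odot>\<^bsub>quotient_algebra A I\<^esub> (I +> x) = I +> (c \<odot> x)"
proof -
  have "c \<odot>\<^bsub>quotient_algebra A I\<^esub> (I +> x) = quotient_map A I (\<lambda>x. c \<odot> x) (I +> x)"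
    by (simp add: quotient_algebra_def ring.defs module.defs quotient_map_def)
  also have "\<dots> = I +> (c \<odot> x)"
    by (rule quotient_map_coset)
      (use I assms ideal_smult_closed smult_r_distr in auto)
  finally show ?thesis .
qed

lemma quotient_algebra_ring: "ring (quotient_algebra A I)"
proof -
  have *: "abelian_group (A Quot I)" "Group.monoid (A Quot I)"
    using I.quotient_is_ring by (auto dest: ring.axioms ring.is_monoid intro: ring.is_abelian_group)
  interpret Q: ring "A Quot I" by (rule I.quotient_is_ring)
  show ?thesis
  proof (rule ringI)
    show "abelian_group (quotient_algebra A I)"
      by (rule abelian_groupI)
        (use Q.a_assoc Q.a_comm Q.l_neg in \<open>force simp: quotient_algebra_def ring.defs\<close>)+
    show "Group.monoid (quotient_algebra A I)"
      by (rule monoidI) (use Q.m_assoc in \<open>auto simp: quotient_algebra_def ring.defs\<close>)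
  qed (use Q.l_distr Q.r_distr in \<open>auto simp: quotient_algebra_def ring.defs\<close>)
qed

lemma complex_algebra_quotient: "complex_algebra (quotient_algebra A I)"
proof (intro complex_algebra.intro complex_algebra_axioms.intro complex_moduleI)
  note [simp] = quotient_algebra_add quotient_algebra_mult quotient_algebra_smult
    quotient_algebra_carrier
  show "ring (quotient_algebra A I)" by (rule quotient_algebra_ring)
  then show "abelian_group (quotient_algebra A I)" by (rule ring.is_abelian_group)
qed (auto simp: quotient_algebra_add quotient_algebra_mult quotient_algebra_smult
    quotient_algebra_carrier smult_mult_left smult_mult_right
    smult_l_distr[of _ _ , simplified] smult_r_distr[simplified] smult_assoc1[simplified]
    smult_one[simplified])

end

lemma coset_eq_iff:
  "ideal I A \<Longrightarrow> x \<in> carrier A \<Longrightarrow> y \<in> carrier A \<Longrightarrow> I +> x = I +> y \<longleftrightarrow> x \<ominus> y \<in> I"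
  using quotient_eq_iff_same_a_r_cos by simp

end

section \<open>The free algebra\<close>

text \<open>Elements of the free algebra and functions on the group are both complex-valued functions; all
linear algebra is done with the pointwise operations on them.\<close>

definition scale :: "complex \<Rightarrow> ('a \<Rightarrow> complex) \<Rightarrow> 'a \<Rightarrow> complex"
  where "scale c f = (\<lambda>x. c * f x)"

lemma scale_apply [simp]: "scale c f x = c * f x"
  by (simp add: scale_def)

global_interpretation funs: vector_space scale
  by standard (auto simp: scale_def fun_eq_iff algebra_simps)

lemma minus_fun_apply [simp]: "(f - g) x = f x - (g x :: complex)"
  by (simp add: fun_diff_def)

lemma uminus_fun_apply [simp]: "(- g) x = - (g x :: complex)"
  by (simp add: fun_Compl_def)

lemma sum_fun_apply [simp]: "(sum f S) x = (\<Sum>s\<in>S. (f s x :: complex))"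
  by (induction S rule: infinite_finite_induct) auto

definition word :: "'n list \<Rightarrow> 'n list \<Rightarrow> complex"
  where "word w = (\<lambda>v. if v = w then 1 else 0)"

abbreviation free_mult (infixl \<open>\<star>\<close> 70)
  where "f \<star> g \<equiv> f \<otimes>\<^bsub>free_algebra\<^esub> g"

abbreviation F :: "('n list \<Rightarrow> complex) set"
  where "F \<equiv> carrier free_algebra"

lemma free_algebra_simps [simp]:
  "f \<in> F \<longleftrightarrow> finite {w. f w \<noteq> 0}"
  "f \<oplus>\<^bsub>free_algebra\<^esub> g = f + g" "\<zero>\<^bsub>free_algebra\<^esub> = 0" "c \<odot>\<^bsub>free_algebra\<^esub> f = scale c f"
  "\<one>\<^bsub>free_algebra\<^esub> = word []"
  by (simp_all add: free_algebra_def fun_eq_iff word_def)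

lemma free_mult_apply: "(f \<star> g) w = (\<Sum>k\<le>length w. f (take k w) * g (drop k w))"
  by (simp add: free_algebra_def)

lemma free_mult_linear:
  "(f + f') \<star> g = f \<star> g + f' \<star> g" "f \<star> (g + g') = f \<star> g + f \<star> g'"
  "scale c f \<star> g = scale c (f \<star> g)" "f \<star> scale c g = scale c (f \<star> g)"
  "0 \<star> g = 0" "f \<star> 0 = 0"
  by (auto simp: fun_eq_iff free_mult_apply algebra_simps sum.distrib sum_distrib_left)

lemma free_mult_diff:
  "(f - f') \<star> g = f \<star> g - f' \<star> g" "f \<star> (g - g') = f \<star> g - f \<star> g'"
  by (auto simp: fun_eq_iff free_mult_apply algebra_simps sum_subtractf)

lemma free_mult_sum: "sum f S \<star> g = (\<Sum>s\<in>S. f s \<star> g)" "g \<star> sum f S = (\<Sum>s\<in>S. g \<star> f s)"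
  by (induction S rule: infinite_finite_induct) (auto simp: free_mult_linear)

lemma word_mult: "word u \<star> word v = word (u @ v)"
proof
  fix w
  have "(word u \<star> word v) w = (\<Sum>k\<le>length w. if k = length u \<and> w = u @ v then 1 else 0)"
    unfolding free_mult_apply word_def
    by (rule sum.cong) (auto simp: append_eq_conv_conj)
  also have "\<dots> = word (u @ v) w"
    by (auto simp: word_def)
  finally show "(word u \<star> word v) w = word (u @ v) w" .
qed

lemma word_apply: "word w v = (if v = w then 1 else 0)"
  by (simp add: word_def)

lemma finite_support_word [simp]: "finite {v. word w v \<noteq> 0}"
  by (simp add: word_def)

lemma finite_support_add: "finite {w. f w \<noteq> 0} \<Longrightarrow> finite {w. g w \<noteq> 0} \<Longrightarrow> finite {w. f w + g w \<noteq> (0::complex)}"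
  by (rule finite_subset[of _ "{w. f w \<noteq> 0} \<union> {w. g w \<noteq> 0}"]) auto

lemma subspace_free: "funs.subspace (F)"
  by (auto simp: funs.subspace_def intro: finite_support_add)

lemma free_expand:
  assumes "f \<in> F"
  shows "f = (\<Sum>w | f w \<noteq> 0. scale (f w) (word w))"
proof
  fix v
  have "(\<Sum>w | f w \<noteq> 0. scale (f w) (word w)) v = (\<Sum>w | f w \<noteq> 0. if v = w then f w else 0)"
    unfolding sum_fun_apply by (rule sum.cong) (auto simp: word_def)
  also have "\<dots> = f v"
    using assms by (simp add: sum.delta)
  finally show "f v = (\<Sum>w | f w \<noteq> 0. scale (f w) (word w)) v" ..
qed

text \<open>An identity between linear maps on the free algebra only has to be checked on words.\<close>

lemma free_induct:
  assumes f: "f \<in> F" and zero: "P 0"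
    and add: "\<And>c w f. f \<in> F \<Longrightarrow> P f \<Longrightarrow> P (scale c (word w) + f)"
  shows "P f"
proof -
  have "(\<Sum>w\<in>S. scale (f w) (word w)) \<in> F \<and> P (\<Sum>w\<in>S. scale (f w) (word w))"
    if "finite S" for S
    using that
  proof induction
    case empty
    show ?case using zero by (simp add: zero_fun_def)
  next
    case (insert w S)
    show ?case
      unfolding sum.insert[OF insert.hyps]
    proof
      let ?s = "\<Sum>w\<in>S. scale (f w) (word w)"
      have w: "word w \<in> F" by simp
      show "scale (f w) (word w) + ?s \<in> F"
        by (rule funs.subspace_add[OF subspace_free funs.subspace_scale[OF subspace_free w]])
          (use insert.IH in blast)
      show "P (scale (f w) (word w) + ?s)"
        by (rule add) (use insert.IH in blast)+
    qed
  qed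
  then have "P (\<Sum>w | f w \<noteq> 0. scale (f w) (word w))" using f by simp
  then show ?thesis by (subst free_expand[OF f])
qed

lemma free_mult_closed:
  assumes "f \<in> F" "g \<in> F"
  shows "f \<star> g \<in> F"
proof (rule ccontr)
  have "{w. (f \<star> g) w \<noteq> 0} \<subseteq> (\<lambda>(u, v). u @ v) ` ({w. f w \<noteq> 0} \<times> {w. g w \<noteq> 0})"
  proof
    fix w assume "w \<in> {w. (f \<star> g) w \<noteq> 0}"
    then obtain k where "f (take k w) * g (drop k w) \<noteq> 0"
      unfolding free_mult_apply by (metis (mono_tags, lifting) mem_Collect_eq sum.neutral)
    then show "w \<in> (\<lambda>(u, v). u @ v) ` ({w. f w \<noteq> 0} \<times> {w. g w \<noteq> 0})"
      by (intro rev_image_eqI[of "(take k w, drop k w)"]) auto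
  qed
  moreover assume "f \<star> g \<notin> F"
  ultimately show False
    using assms by (auto dest: finite_subset)
qed

lemma free_mult_assoc:
  assumes f: "f \<in> F" and g: "g \<in> F"
    and h: "h \<in> F"
  shows "(f \<star> g) \<star> h = f \<star> (g \<star> h)"
proof -
  have *: "(word u \<star> word v) \<star> h = word u \<star> (word v \<star> h)" for u v
    by (rule free_induct[OF h]) (simp_all only: free_mult_linear word_mult append_assoc)
  have **: "(word u \<star> g) \<star> h = word u \<star> (g \<star> h)" for u
    by (rule free_induct[OF g]) (simp_all only: free_mult_linear *)
  show ?thesis
    by (rule free_induct[OF f]) (simp_all only: free_mult_linear **)
qed

lemma free_mult_one:
  assumes f: "f \<in> F"
  shows "word [] \<star> f = f" "f \<star> word [] = f"
  by (rule free_induct[OF f]; simp only: free_mult_linear word_mult append_Nil append_Nil2)+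

lemma complex_algebra_free:
  "complex_algebra (free_algebra :: (complex, 'n list \<Rightarrow> complex) module)"
proof -
  let ?F = "free_algebra :: (complex, 'n list \<Rightarrow> complex) module"
  have ag: "abelian_group ?F"
  proof (rule abelian_groupI)
    fix f :: "'n list \<Rightarrow> complex" assume "f \<in> carrier ?F"
    then show "\<exists>g\<in>carrier ?F. g \<oplus>\<^bsub>?F\<^esub> f = \<zero>\<^bsub>?F\<^esub>"
      by (intro bexI[of _ "- f"]) auto
  qed (auto simp: algebra_simps intro: finite_support_add)
  show "complex_algebra ?F"
  proof (intro complex_algebra.intro complex_algebra_axioms.intro complex_moduleI)
    show "ring ?F"
    proof (rule ringI)
      show "Group.monoid ?F"
        by (rule monoidI)
          (use free_mult_closed free_mult_assoc free_mult_one in \<open>simp_all\<close>)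
    qed (use ag in \<open>auto simp: free_mult_linear\<close>)
  qed (use ag in \<open>auto simp: free_mult_linear fun_eq_iff algebra_simps\<close>)
qed

interpretation free: complex_algebra "free_algebra :: (complex, 'n list \<Rightarrow> complex) module"
  by (rule complex_algebra_free)

lemma free_minus:
  assumes "f \<in> F" "g \<in> F"
  shows "f \<ominus>\<^bsub>free_algebra\<^esub> g = f - g"
proof -
  have "\<ominus>\<^bsub>free_algebra\<^esub> g = - g"
    by (rule free.minus_equality) (use assms in auto)
  then show ?thesis by (simp add: a_minus_def)
qed

lemma ideal_free_subspace:
  assumes "ideal I (free_algebra :: (complex, 'n list \<Rightarrow> complex) module)"
  shows "funs.subspace I"
proof -
  interpret I: ideal I free_algebra by fact
  show ?thesis
    unfolding funs.subspace_def
    using I.zero_closed I.a_closed free.ideal_smult_closed[OF assms] by auto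
qed

text \<open>Every element is a combination of words, so stability under words suffices.\<close>

lemma ideal_freeI:
  fixes I :: "('n list \<Rightarrow> complex) set"
  assumes sub: "I \<subseteq> F" and I: "funs.subspace I"
    and l: "\<And>f u. f \<in> I \<Longrightarrow> word u \<star> f \<in> I" and r: "\<And>f u. f \<in> I \<Longrightarrow> f \<star> word u \<in> I"
  shows "ideal I free_algebra"
proof (rule free.subspace_idealI[OF sub])
  fix a x assume a: "a \<in> I" and x: "x \<in> carrier (free_algebra :: (complex, 'n list \<Rightarrow> complex) module)"
  show "x \<star> a \<in> I"
    by (rule free_induct[where P = "\<lambda>x. x \<star> a \<in> I", OF x])
      (use a l in \<open>auto simp: free_mult_linear intro!: funs.subspace_0[OF I] funs.subspace_add[OF I] funs.subspace_scale[OF I]\<close>)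
  show "a \<star> x \<in> I"
    by (rule free_induct[where P = "\<lambda>x. a \<star> x \<in> I", OF x])
      (use a r in \<open>auto simp: free_mult_linear intro!: funs.subspace_0[OF I] funs.subspace_add[OF I] funs.subspace_scale[OF I]\<close>)
qed (use I in \<open>simp_all only: funs.subspace_def free_algebra_simps\<close>)

text \<open>This is linear in \<open>f\<close> on finitely supported functions only: for others the sum is \<open>0\<close> by
convention.\<close>

definition lift_words :: "('n list \<Rightarrow> complex) \<Rightarrow> ('n list \<Rightarrow> complex) \<Rightarrow> complex"
  where "lift_words \<phi> f = (\<Sum>w | f w \<noteq> 0. f w * \<phi> w)"

lemma lift_words_superset:
  "finite S \<Longrightarrow> {w. f w \<noteq> 0} \<subseteq> S \<Longrightarrow> lift_words \<phi> f = (\<Sum>w\<in>S. f w * \<phi> w)"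
  unfolding lift_words_def by (rule sum.mono_neutral_left) auto

lemma lift_words_word [simp]: "lift_words \<phi> (word w) = \<phi> w"
  by (subst lift_words_superset[of "{w}"]) (auto simp: word_def)

lemma lift_words_zero [simp]: "lift_words \<phi> 0 = 0"
  by (simp add: lift_words_def)

lemma lift_words_add:
  assumes "f \<in> F" "g \<in> F"
  shows "lift_words \<phi> (f + g) = lift_words \<phi> f + lift_words \<phi> g"
proof -
  let ?S = "{w. f w \<noteq> 0} \<union> {w. g w \<noteq> 0}"
  have "finite ?S" using assms by simp
  then show ?thesis
    by (subst (1 2 3) lift_words_superset[of ?S]) (auto simp: algebra_simps sum.distrib)
qed

lemma lift_words_scale: "lift_words \<phi> (scale c f) = c * lift_words \<phi> f"
  by (cases "c = 0") (auto simp: lift_words_def sum_distrib_left algebra_simps)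

section \<open>Monomial matrices\<close>

definition mono_mat :: "('n \<Rightarrow> 'n) \<Rightarrow> ('n \<Rightarrow> complex) \<Rightarrow> complex^'n::finite^'n"
  where "mono_mat \<sigma> c = (\<chi> i j. if i = \<sigma> j then c j else 0)"

lemma mono_mat_nth [simp]: "mono_mat \<sigma> c $ i $ j = (if i = \<sigma> j then c j else 0)"
  by (simp add: mono_mat_def)

lemma mono_mat_mult: "mono_mat \<sigma> c ** mono_mat \<tau> d = mono_mat (\<sigma> \<circ> \<tau>) (\<lambda>j. c (\<tau> j) * d j)"
proof -
  have "(\<Sum>k\<in>UNIV. (if i = \<sigma> k then c k else 0) * (if k = \<tau> j then d j else 0)) =
      (if i = \<sigma> (\<tau> j) then c (\<tau> j) * d j else 0)" for i j
  proof -
    have "(\<Sum>k\<in>UNIV. (if i = \<sigma> k then c k else 0) * (if k = \<tau> j then d j else 0)) =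
        (\<Sum>k\<in>UNIV. if k = \<tau> j then (if i = \<sigma> k then c k else 0) * d j else 0)"
      by (rule sum.cong) auto
    then show ?thesis by simp
  qed
  then show ?thesis
    by (simp add: matrix_matrix_mult_def vec_eq_iff)
qed

lemma mono_mat_id: "mat 1 = mono_mat id (\<lambda>_. 1)"
  by (simp add: mat_def vec_eq_iff)

lemma det_mono_mat:
  assumes "bij \<sigma>"
  shows "det (mono_mat \<sigma> c) = of_int (sign \<sigma>) * prod c UNIV"
proof -
  have perm: "inv_into UNIV \<sigma> permutes UNIV" "\<sigma> permutes UNIV"
    using assms by (auto intro!: bij_imp_permutes simp: bij_imp_bij_inv)
  have "det (mono_mat \<sigma> c) = (\<Sum>q | q permutes UNIV. of_int (sign q) * (\<Prod>i\<in>UNIV. mono_mat \<sigma> c $ i $ q i))"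
    by (simp add: det_def)
  also have "\<dots> = (\<Sum>q | q permutes UNIV. if q = inv_into UNIV \<sigma> then of_int (sign q) * (\<Prod>i\<in>UNIV. c (q i)) else 0)"
  proof (rule sum.cong, rule refl)
    fix q :: "'a \<Rightarrow> 'a" assume q: "q \<in> {q. q permutes UNIV}"
    show "of_int (sign q) * (\<Prod>i\<in>UNIV. mono_mat \<sigma> c $ i $ q i) =
        (if q = inv_into UNIV \<sigma> then of_int (sign q) * (\<Prod>i\<in>UNIV. c (q i)) else 0)"
    proof (cases "q = inv_into UNIV \<sigma>")
      case True
      then have "\<sigma> (q i) = i" for i
        using assms by (simp add: bij_is_surj surj_f_inv_f)
      then show ?thesis using True by simp
    next
      case False
      then obtain i where "q i \<noteq> inv_into UNIV \<sigma> i" by auto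
      then have "i \<noteq> \<sigma> (q i)"
        using assms by (metis bij_is_inj inv_f_f)
      then have "(\<Prod>i\<in>UNIV. mono_mat \<sigma> c $ i $ q i) = 0"
        by (intro prod_zero) auto
      then show ?thesis using False by simp
    qed
  qed
  also have "\<dots> = of_int (sign (inv_into UNIV \<sigma>)) * (\<Prod>i\<in>UNIV. c (inv_into UNIV \<sigma> i))"
    using perm by (simp add: finite_permutations sum.delta)
  also have "sign (inv_into UNIV \<sigma>) = sign \<sigma>"
    using perm by (simp add: sign_inverse permutation_permutes exI[of _ UNIV])
  also have "(\<Prod>i\<in>UNIV. c (inv_into UNIV \<sigma> i)) = prod c UNIV"
    using assms by (intro prod.reindex_bij_betw) (simp add: bij_imp_bij_inv)
  finally show ?thesis .
qed

text \<open>Products, inverses, determinants and the action on words are all computed from this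
parametrisation by a permutation and the non-zero entry of each column.\<close>

lemma monomial_matrix_iff:
  "monomial_matrix A \<longleftrightarrow> (\<exists>\<sigma> c. A = mono_mat \<sigma> c \<and> bij \<sigma> \<and> (\<forall>j. c j \<noteq> 0))"
proof
  assume A: "monomial_matrix A"
  define \<sigma> where "\<sigma> j = (THE i. A $ i $ j \<noteq> 0)" for j
  have \<sigma>: "A $ i $ j \<noteq> 0 \<longleftrightarrow> i = \<sigma> j" for i j
  proof -
    have "\<exists>!i. A $ i $ j \<noteq> 0" using A by (simp add: monomial_matrix_def)
    from theI_unique[OF this] show ?thesis unfolding \<sigma>_def .
  qed
  have "\<exists>!j. i = \<sigma> j" for i
    using A \<sigma> unfolding monomial_matrix_def by simp
  then have "bij \<sigma>" unfolding bij_iff by (simp add: eq_commute[of "\<sigma> _"])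
  moreover have "A = mono_mat \<sigma> (\<lambda>j. A $ \<sigma> j $ j)"
    using \<sigma> by (auto simp: vec_eq_iff)
  moreover have "A $ \<sigma> j $ j \<noteq> 0" for j
    using \<sigma> by blast
  ultimately show "\<exists>\<sigma> c. A = mono_mat \<sigma> c \<and> bij \<sigma> \<and> (\<forall>j. c j \<noteq> 0)" by blast
next
  assume "\<exists>\<sigma> c. A = mono_mat \<sigma> c \<and> bij \<sigma> \<and> (\<forall>j. c j \<noteq> 0)"
  then obtain \<sigma> c where *: "A = mono_mat \<sigma> c" "bij \<sigma>" "\<And>j. c j \<noteq> 0" by blast
  then have "A $ i $ j \<noteq> 0 \<longleftrightarrow> \<sigma> j = i" for i j by auto
  moreover have "\<exists>!j. \<sigma> j = i" for i using *(2) by (simp add: bij_iff)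
  ultimately show "monomial_matrix A"
    unfolding monomial_matrix_def by simp
qed

lemma mystic_group_iff:
  assumes "m > 0"
  shows "A \<in> carrier (mystic_group m p) \<longleftrightarrow>
    (\<exists>\<sigma> c. A = mono_mat \<sigma> c \<and> bij \<sigma> \<and> (\<forall>j. c j ^ m = 1) \<and>
      (of_int (sign \<sigma>) * prod c UNIV) ^ (m div p) = 1)"
proof -
  have "c j \<noteq> 0" if "\<forall>j. c j ^ m = 1" for c :: "'a \<Rightarrow> complex" and j
    using that assms by (metis power_0_left zero_neq_one not_gr0)
  then show ?thesis
    unfolding mystic_group_def monomial_matrix_iff
    by (auto simp: det_mono_mat) (metis det_mono_mat)+
qed

lemma mystic_group_mult [simp]: "A \<otimes>\<^bsub>mystic_group m p\<^esub> B = A ** B"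
  and mystic_group_one [simp]: "\<one>\<^bsub>mystic_group m p\<^esub> = mat 1"
  by (simp_all add: mystic_group_def)

lemma group_mystic_group:
  assumes "m > 0"
  shows "group (mystic_group m p :: (complex^'n::finite^'n) monoid)"
proof (rule groupI)
  let ?W = "mystic_group m p :: (complex^'n^'n) monoid"
  note W = mystic_group_iff[OF assms]
  show "\<one>\<^bsub>?W\<^esub> \<in> carrier ?W"
    unfolding mystic_group_one W mono_mat_id
    by (intro exI[of _ id] exI[of _ "\<lambda>_. 1"]) simp
  fix A B assume A: "A \<in> carrier ?W" and B: "B \<in> carrier ?W"
  obtain \<sigma> c where \<sigma>: "A = mono_mat \<sigma> c" "bij \<sigma>" "\<forall>j. c j ^ m = 1"
    using A W by blast
  obtain \<tau> d where \<tau>: "B = mono_mat \<tau> d" "bij \<tau>" "\<forall>j. d j ^ m = 1"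
    using B W by blast
  have dets: "det A ^ (m div p) = 1" "det B ^ (m div p) = 1"
    using A B by (auto simp: mystic_group_def)
  have bij: "bij (\<sigma> \<circ> \<tau>)" using \<sigma> \<tau> by (simp add: bij_comp)
  have AB: "A ** B = mono_mat (\<sigma> \<circ> \<tau>) (\<lambda>j. c (\<tau> j) * d j)"
    using \<sigma> \<tau> by (simp add: mono_mat_mult)
  have "det (A ** B) ^ (m div p) = 1"
    using dets by (simp add: det_mul power_mult_distrib)
  then have "(of_int (sign (\<sigma> \<circ> \<tau>)) * (\<Prod>j\<in>UNIV. c (\<tau> j) * d j)) ^ (m div p) = 1"
    unfolding AB det_mono_mat[OF bij] .
  moreover have "\<forall>j. (c (\<tau> j) * d j) ^ m = 1" using \<sigma> \<tau> by (simp add: power_mult_distrib)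
  ultimately show "A \<otimes>\<^bsub>?W\<^esub> B \<in> carrier ?W"
    unfolding mystic_group_mult W using AB bij by blast
next
  let ?W = "mystic_group m p :: (complex^'n^'n) monoid"
  note W = mystic_group_iff[OF assms]
  fix A assume A: "A \<in> carrier ?W"
  then obtain \<sigma> c where \<sigma>: "A = mono_mat \<sigma> c" "bij \<sigma>" "\<forall>j. c j ^ m = 1"
    using W by blast
  define B where "B = mono_mat (inv_into UNIV \<sigma>) (\<lambda>j. inverse (c (inv_into UNIV \<sigma> j)))"
  have nz: "c j \<noteq> 0" for j
    using \<sigma>(3) assms by (metis power_0_left zero_neq_one not_gr0)
  have bij: "bij (inv_into UNIV \<sigma>)" using \<sigma> by (simp add: bij_imp_bij_inv)
  have "inv_into UNIV \<sigma> \<circ> \<sigma> = id" "inv_into UNIV \<sigma> (\<sigma> j) = j" for j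
    using \<sigma>(2) by (auto simp: bij_is_inj)
  then have BA: "B ** A = mat 1"
    unfolding B_def \<sigma>(1) mono_mat_mult using nz by (simp add: mono_mat_id)
  then have "det B * det A = 1" by (metis det_mul det_I)
  then have "det B ^ (m div p) * det A ^ (m div p) = 1"
    by (simp flip: power_mult_distrib)
  moreover have "det A ^ (m div p) = 1" using A by (simp add: mystic_group_def)
  ultimately have "det B ^ (m div p) = 1" by simp
  then have "(of_int (sign (inv_into UNIV \<sigma>)) * (\<Prod>j\<in>UNIV. inverse (c (inv_into UNIV \<sigma> j)))) ^ (m div p) = 1"
    unfolding B_def det_mono_mat[OF bij] .
  moreover have "\<forall>j. inverse (c (inv_into UNIV \<sigma> j)) ^ m = 1"
    using \<sigma>(3) by (simp add: power_inverse)
  ultimately have "B \<in> carrier ?W"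
    unfolding W using B_def bij by blast
  then show "\<exists>B\<in>carrier ?W. B \<otimes>\<^bsub>?W\<^esub> A = \<one>\<^bsub>?W\<^esub>"
    using BA by auto
qed (simp_all add: matrix_mul_assoc)

section \<open>The action on the free algebra\<close>

lemma free_action_linear:
  "free_action A (f + g) = free_action A f + free_action A g"
  "free_action A (scale c f) = scale c (free_action A f)"
  "free_action A 0 = 0"
  by (auto simp: free_action_def fun_eq_iff algebra_simps sum.distrib sum_distrib_left)

lemma prod_list_nth: "prod_list (map c w) = (\<Prod>k<length w. c (w ! k))"
  by (simp add: prod.list_conv_set_nth atLeast0LessThan)

lemma finite_lists_length: "finite {u :: 'n::finite list. length u = k}"
  using finite_lists_length_eq[of "UNIV :: 'n set" k] by simp

lemma free_action_word:
  "free_action (mono_mat \<sigma> c) (word w) = scale (prod_list (map c w)) (word (map \<sigma> w))"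
proof
  fix v
  let ?P = "\<lambda>u. \<Prod>k<length v. mono_mat \<sigma> c $ (v ! k) $ (u ! k)"
  have "free_action (mono_mat \<sigma> c) (word w) v = (\<Sum>u | length u = length v. if u = w then ?P u else 0)"
    unfolding free_action_def word_def by (rule sum.cong) auto
  also have "\<dots> = (if length w = length v then ?P w else 0)"
    by (simp add: finite_lists_length sum.delta)
  also have "\<dots> = scale (prod_list (map c w)) (word (map \<sigma> w)) v"
  proof (cases "v = map \<sigma> w")
    case True
    then show ?thesis by (simp add: prod_list_nth word_def)
  next
    case False
    then have "?P w = 0" if "length w = length v"
      using that by (auto simp: list_eq_iff_nth_eq intro!: prod_zero bexI)
    then show ?thesis using False by (simp add: word_def)
  qed
  finally show "free_action (mono_mat \<sigma> c) (word w) v = scale (prod_list (map c w)) (word (map \<sigma> w)) v" .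
qed

lemma free_action_closed:
  assumes f: "f \<in> F"
  shows "free_action (mono_mat \<sigma> c) f \<in> F"
proof (rule free_induct[where P = "\<lambda>f. free_action (mono_mat \<sigma> c) f \<in> F", OF f])
  fix a w f
  assume IH: "free_action (mono_mat \<sigma> c) f \<in> F"
  show "free_action (mono_mat \<sigma> c) (scale a (word w) + f) \<in> F"
    unfolding free_action_linear free_action_word
    by (intro funs.subspace_add[OF subspace_free] funs.subspace_scale[OF subspace_free] IH) simp
qed (simp add: free_action_linear)

lemma free_action_mult:
  assumes f: "f \<in> F" and g: "g \<in> F"
  shows "free_action (mono_mat \<sigma> c) (f \<star> g) = free_action (mono_mat \<sigma> c) f \<star> free_action (mono_mat \<sigma> c) g"
proof -
  let ?a = "free_action (mono_mat \<sigma> c)"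
  have *: "?a (word u \<star> g) = ?a (word u) \<star> ?a g" for u
    by (rule free_induct[where P = "\<lambda>g. ?a (word u \<star> g) = ?a (word u) \<star> ?a g", OF g])
      (simp_all add: free_action_linear free_mult_linear free_action_word word_mult algebra_simps)
  show ?thesis
    by (rule free_induct[where P = "\<lambda>f. ?a (f \<star> g) = ?a f \<star> ?a g", OF f])
      (simp_all add: free_action_linear free_mult_linear *)
qed

lemma free_action_compose:
  assumes f: "f \<in> F"
  shows "free_action (mono_mat \<sigma> c ** mono_mat \<tau> d) f = free_action (mono_mat \<sigma> c) (free_action (mono_mat \<tau> d) f)"
proof (rule free_induct[where P = "\<lambda>f. free_action (mono_mat \<sigma> c ** mono_mat \<tau> d) f =
    free_action (mono_mat \<sigma> c) (free_action (mono_mat \<tau> d) f)", OF f])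
  have "prod_list (map (\<lambda>j. c (\<tau> j) * d j) w) = prod_list (map d w) * prod_list (map c (map \<tau> w))" for w
    by (induction w) (simp_all add: algebra_simps)
  then have *: "free_action (mono_mat \<sigma> c ** mono_mat \<tau> d) (word w) =
      free_action (mono_mat \<sigma> c) (free_action (mono_mat \<tau> d) (word w))" for w
    by (simp add: mono_mat_mult free_action_word free_action_linear)
  fix a w f
  assume "free_action (mono_mat \<sigma> c ** mono_mat \<tau> d) f = free_action (mono_mat \<sigma> c) (free_action (mono_mat \<tau> d) f)"
  then show "free_action (mono_mat \<sigma> c ** mono_mat \<tau> d) (scale a (word w) + f) =
      free_action (mono_mat \<sigma> c) (free_action (mono_mat \<tau> d) (scale a (word w) + f))"
    by (simp only: free_action_linear *)
qed (simp add: free_action_linear)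

lemma free_action_one:
  assumes f: "f \<in> F"
  shows "free_action (mat 1) f = f"
proof -
  have "free_action (mat 1) (word w) = word w" for w :: "'a list"
  proof -
    have "prod_list (map (\<lambda>_. 1) w) = (1::complex)" by (induction w) auto
    then show ?thesis by (simp add: mono_mat_id free_action_word)
  qed
  then show ?thesis
    by (intro free_induct[where P = "\<lambda>f. free_action (mat 1) f = f", OF f])
      (simp_all only: free_action_linear)
qed

section \<open>The skew relations\<close>

lemma free_var_word: "free_var i = word [i]"
  by (simp add: free_var_def word_def)

lemma skew_ideal_eq:
  "skew_ideal = Idl\<^bsub>free_algebra\<^esub> {word [i, j] + word [j, i] | i j. i \<noteq> j}"
  by (simp add: skew_ideal_def free_var_word word_mult)

lemma skew_relations_closed:
  "{word [i, j] + word [j, i] | i j. i \<noteq> j} \<subseteq> F"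
  using finite_support_add[OF finite_support_word finite_support_word] by auto

lemma ideal_skew_ideal: "ideal skew_ideal free_algebra"
  unfolding skew_ideal_eq by (rule free.genideal_ideal[OF skew_relations_closed])

lemma skew_ideal_minimal:
  assumes "ideal I free_algebra" "\<And>i j. i \<noteq> j \<Longrightarrow> word [i, j] + word [j, i] \<in> I"
  shows "skew_ideal \<subseteq> I"
  unfolding skew_ideal_eq by (rule free.genideal_minimal[OF assms(1)]) (use assms(2) in blast)

lemma skew_relation: "i \<noteq> j \<Longrightarrow> word [i, j] + word [j, i] \<in> skew_ideal"
  unfolding skew_ideal_eq
  by (rule subsetD[OF free.genideal_self[OF skew_relations_closed]]) blast

lemma subspace_skew_ideal: "funs.subspace skew_ideal"
  by (rule ideal_free_subspace[OF ideal_skew_ideal])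

lemma skew_ideal_closed: "f \<in> skew_ideal \<Longrightarrow> f \<in> F"
  using ideal.Icarr[OF ideal_skew_ideal] .

lemma skew_ideal_mult:
  "f \<in> skew_ideal \<Longrightarrow> g \<in> F \<Longrightarrow> f \<star> g \<in> skew_ideal"
  "f \<in> skew_ideal \<Longrightarrow> g \<in> F \<Longrightarrow> g \<star> f \<in> skew_ideal"
  using ideal.I_r_closed[OF ideal_skew_ideal] ideal.I_l_closed[OF ideal_skew_ideal] by blast+

lemma word_closed: "word w \<in> F"
  by simp

lemma free_closed:
  assumes "f \<in> F" "g \<in> F"
  shows "f + g \<in> F" "f - g \<in> F" "scale c f \<in> F"
  using funs.subspace_add[OF subspace_free assms] funs.subspace_diff[OF subspace_free assms]
    funs.subspace_scale[OF subspace_free assms(1)] by auto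

text \<open>A monomial matrix sends \<open>x\<^sub>i x\<^sub>j + x\<^sub>j x\<^sub>i\<close> to a multiple of a relation of the same form.\<close>

lemma skew_ideal_action:
  assumes f: "f \<in> skew_ideal" and \<sigma>: "inj \<sigma>"
  shows "free_action (mono_mat \<sigma> c) f \<in> skew_ideal"
proof -
  let ?a = "free_action (mono_mat \<sigma> c)"
  let ?I = "{f \<in> F. ?a f \<in> skew_ideal}"
  have "ideal ?I free_algebra"
  proof (rule ideal_freeI)
    show "funs.subspace ?I"
      using subspace_skew_ideal subspace_free
      unfolding funs.subspace_def by (simp only: mem_Collect_eq free_action_linear) blast
  next
    fix f u assume f: "f \<in> ?I"
    have "?a (word u) \<star> ?a f \<in> skew_ideal" "?a f \<star> ?a (word u) \<in> skew_ideal"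
      using f skew_ideal_mult free_action_closed[OF word_closed] by blast+
    then show "word u \<star> f \<in> ?I" "f \<star> word u \<in> ?I"
      using f free_mult_closed[OF word_closed[of u], of f] free_mult_closed[OF _ word_closed[of u], of f]
        free_action_mult[OF word_closed, of f \<sigma> c u] free_action_mult[OF _ word_closed, of f \<sigma> c u]
      by (simp_all only: mem_Collect_eq)
  qed auto
  moreover have "word [i, j] + word [j, i] \<in> ?I" if "i \<noteq> j" for i j
  proof -
    have "?a (word [i, j] + word [j, i]) = scale (c i * c j) (word [\<sigma> i, \<sigma> j] + word [\<sigma> j, \<sigma> i])"
      by (simp only: free_action_linear free_action_word funs.scale_right_distrib)
         (simp add: mult.commute)
    moreover have "word [\<sigma> i, \<sigma> j] + word [\<sigma> j, \<sigma> i] \<in> skew_ideal"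
      using \<sigma> that by (intro skew_relation) (auto dest: injD)
    ultimately show ?thesis
      using funs.subspace_scale[OF subspace_skew_ideal] free_closed(1)[OF word_closed word_closed]
      by (simp only: mem_Collect_eq) blast
  qed
  ultimately show ?thesis using skew_ideal_minimal f by blast
qed

lemma lift_words_sandwich:
  assumes f: "f \<in> F"
  shows "lift_words \<phi> (word u \<star> f \<star> word v) = (\<Sum>w | f w \<noteq> 0. f w * \<phi> (u @ w @ v))"
proof -
  have "lift_words \<phi> (word u \<star> f \<star> word v) = lift_words (\<lambda>w. \<phi> (u @ w @ v)) f"
  proof (rule free_induct[where P = "\<lambda>f. lift_words \<phi> (word u \<star> f \<star> word v) = lift_words (\<lambda>w. \<phi> (u @ w @ v)) f", OF f])
    fix c w f
    assume f: "f \<in> F"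
      and IH: "lift_words \<phi> (word u \<star> f \<star> word v) = lift_words (\<lambda>w. \<phi> (u @ w @ v)) f"
    have cl: "word u \<star> f \<star> word v \<in> F"
      by (intro free_mult_closed word_closed f)
    show "lift_words \<phi> (word u \<star> (scale c (word w) + f) \<star> word v) =
        lift_words (\<lambda>w. \<phi> (u @ w @ v)) (scale c (word w) + f)"
      unfolding free_mult_linear word_mult
      by (subst (1 2) lift_words_add)
        (use f cl IH free_closed(3)[OF word_closed word_closed] in \<open>simp_all only: lift_words_scale lift_words_word append_assoc\<close>)
  qed (simp add: free_mult_linear)
  then show ?thesis by (simp add: lift_words_def)
qed

text \<open>The largest two-sided ideal on which a functional vanishes. Proving that a functional kills an
ideal thus reduces to testing generators, with words on both sides.\<close>

lemma ideal_lift_words_kernel: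
  "ideal {f \<in> F. \<forall>u v. lift_words \<phi> (word u \<star> f \<star> word v) = 0} free_algebra"
  (is "ideal ?I _")
proof (rule ideal_freeI)
  have cl: "word u \<star> f \<star> word v \<in> F" if "f \<in> F" for f u v
    by (intro free_mult_closed word_closed that)
  show "funs.subspace ?I"
    unfolding funs.subspace_def
  proof (intro conjI ballI allI)
    fix f g assume fg: "f \<in> ?I" "g \<in> ?I"
    then show "f + g \<in> ?I"
      using free_closed(1)[of f g] lift_words_add[OF cl cl, of f g]
      by (simp only: mem_Collect_eq free_mult_linear) simp
    show "scale c f \<in> ?I" for c
      using fg free_closed(3)[of f f]
      by (simp only: mem_Collect_eq free_mult_linear lift_words_scale) simp
  qed (simp add: free_mult_linear)
next
  fix f x assume f: "f \<in> ?I"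
  then have fc: "f \<in> F" by blast
  have "word u \<star> (word x \<star> f) \<star> word v = word (u @ x) \<star> f \<star> word v"
    "word u \<star> (f \<star> word x) \<star> word v = word u \<star> f \<star> word (x @ v)" for u v
    by (simp_all only: free_mult_assoc[OF word_closed word_closed fc, symmetric] word_mult
      free_mult_assoc[OF word_closed free_mult_closed[OF fc word_closed] word_closed]
      free_mult_assoc[OF fc word_closed word_closed] free_mult_assoc[OF word_closed fc word_closed])
  then show "word x \<star> f \<in> ?I" "f \<star> word x \<in> ?I"
    using f free_mult_closed[OF word_closed fc, of x] free_mult_closed[OF fc word_closed, of x]
    by simp_all
qed auto

section \<open>A functional on the skew polynomial algebra\<close>

definition rank :: "'n::finite \<Rightarrow> nat"
  where "rank = (SOME f. inj f)"

lemma inj_rank: "inj (rank :: 'n::finite \<Rightarrow> nat)"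
proof -
  have "\<exists>f :: 'n \<Rightarrow> nat. inj f"
    using finite_imp_inj_to_nat_seg[of "UNIV :: 'n set"] by auto
  then show ?thesis unfolding rank_def by (rule someI_ex)
qed

definition order_sign :: "'n::finite \<Rightarrow> 'n \<Rightarrow> complex"
  where "order_sign i j = (if rank j < rank i then - 1 else 1)"

text \<open>The order of the letters is arbitrary and only serves to choose signs with
\<open>bichar j i = - bichar i j\<close>. The point of the definition is the diagonal: it makes the product of every
row equal to \<open>1\<close> and gives all columns the same product, which is what lets balanced words pass
through any word.\<close>

definition bichar :: "'n::finite \<Rightarrow> 'n \<Rightarrow> complex"
  where "bichar i j = (if i = j then \<Prod>k\<in>UNIV - {i}. order_sign i k else order_sign i j)"

text \<open>On a word this is the product of weights of its letters and of the signs \<open>bichar\<close> of all ordered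
pairs of positions. The weights, distinct positive integers, play the role of a generic point: their powers
separate the letters.\<close>

primrec twisted_eval :: "'n::finite list \<Rightarrow> complex" where
  "twisted_eval [] = 1"
| "twisted_eval (i # w) = of_nat (Suc (rank i)) * prod_list (map (bichar i) w) * twisted_eval w"

lemma order_sign_square: "order_sign i j * order_sign i j = 1"
  by (simp add: order_sign_def)

lemma order_sign_antisym: "i \<noteq> j \<Longrightarrow> order_sign j i = - order_sign i j"
  using inj_rank[THEN injD, of i j] by (auto simp: order_sign_def)

lemma bichar_square: "bichar i j * bichar i j = 1"
  by (cases "i = j")
    (simp_all only: bichar_def if_True if_False simp_thms order_sign_square prod.distrib[symmetric] prod.neutral_const)

lemma bichar_antisym: "i \<noteq> j \<Longrightarrow> bichar j i = - bichar i j"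
  using order_sign_antisym[of i j] by (simp add: bichar_def)

lemma norm_bichar [simp]: "cmod (bichar i j) = 1"
proof -
  have "cmod (order_sign i j) = 1" for i j :: 'a by (simp add: order_sign_def)
  then show ?thesis by (simp add: bichar_def prod_norm[symmetric])
qed

lemma bichar_row: "(\<Prod>j\<in>UNIV. bichar i j) = 1"
proof -
  have "(\<Prod>j\<in>UNIV. bichar i j) = bichar i i * (\<Prod>j\<in>UNIV - {i}. bichar i j)"
    by (rule prod.remove) auto
  also have "(\<Prod>j\<in>UNIV - {i}. bichar i j) = (\<Prod>j\<in>UNIV - {i}. order_sign i j)"
    by (rule prod.cong) (auto simp: bichar_def)
  also have "\<dots> = bichar i i"
    by (simp add: bichar_def)
  finally show ?thesis by (simp add: bichar_square)
qed

lemma bichar_column: "(\<Prod>j\<in>UNIV. bichar j (i :: 'n::finite)) = (- 1) ^ (CARD('n) - 1)"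
proof -
  have "(\<Prod>j\<in>UNIV. bichar j i) = bichar i i * (\<Prod>j\<in>UNIV - {i}. bichar j i)"
    by (rule prod.remove) auto
  also have "(\<Prod>j\<in>UNIV - {i}. bichar j i) = (\<Prod>j\<in>UNIV - {i}. - 1 * bichar i j)"
    by (rule prod.cong) (auto simp: bichar_antisym[of i])
  also have "\<dots> = (- 1) ^ (CARD('n) - 1) * (\<Prod>j\<in>UNIV - {i}. bichar i j)"
    by (simp only: prod.distrib prod_constant) (simp add: card_Diff_subset)
  also have "bichar i i * \<dots> = (- 1) ^ (CARD('n) - 1) * (\<Prod>j\<in>UNIV. bichar i j)"
    by (subst (2) prod.remove[of _ i]) auto
  finally show ?thesis by (simp add: bichar_row)
qed

text \<open>The factor by which \<open>twisted_eval\<close> fails to be multiplicative.\<close>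

definition cross :: "'n::finite list \<Rightarrow> 'n list \<Rightarrow> complex"
  where "cross u v = prod_list (map (\<lambda>i. prod_list (map (bichar i) v)) u)"

lemma cross_append: "cross u (v @ w) = cross u v * cross u w"
  by (induction u) (simp_all add: cross_def algebra_simps)

lemma cross_alt: "cross u v = prod_list (map (\<lambda>j. prod_list (map (\<lambda>i. bichar i j) u)) v)"
proof (induction v)
  case Nil
  show ?case unfolding cross_def by (induction u) simp_all
next
  case (Cons j v)
  have "cross u (j # v) = cross u [j] * cross u v"
    using cross_append[of u "[j]" v] by simp
  also have "cross u [j] = prod_list (map (\<lambda>i. bichar i j) u)"
    by (simp add: cross_def)
  finally show ?case using Cons by simp
qed

lemma twisted_eval_append: "twisted_eval (u @ v) = twisted_eval u * cross u v * twisted_eval v"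
  by (induction u) (simp_all add: cross_def algebra_simps)

lemma norm_twisted_eval: "cmod (twisted_eval w) = prod_list (map (\<lambda>i. real (Suc (rank i))) w)"
proof -
  have "cmod (prod_list (map (bichar i) w)) = 1" for i and w :: "'a list"
    by (induction w) (simp_all add: norm_mult)
  then show ?thesis by (induction w) (simp_all add: norm_mult del: of_nat_Suc)
qed

lemma twisted_eval_nonzero: "twisted_eval w \<noteq> 0"
proof -
  have "cmod (twisted_eval w) > 0" unfolding norm_twisted_eval by (induction w) simp_all
  then show ?thesis by simp
qed

text \<open>Exchanging two adjacent letters only changes the sign of their own pair.\<close>

lemma twisted_eval_swap:
  assumes "i \<noteq> j"
  shows "twisted_eval (u @ [i, j] @ v) = - twisted_eval (u @ [j, i] @ v)"
proof -
  have "twisted_eval ([i, j] @ v) = - twisted_eval ([j, i] @ v)"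
    using bichar_antisym[OF assms] by (simp add: algebra_simps)
  moreover have "cross u ([i, j] @ v) = cross u ([j, i] @ v)"
    by (simp only: cross_append) (simp add: cross_alt algebra_simps)
  ultimately show ?thesis by (simp only: twisted_eval_append[of u]) simp
qed

lemma lift_twisted_eval_skew_ideal:
  fixes f :: "'n::finite list \<Rightarrow> complex"
  assumes "f \<in> skew_ideal"
  shows "lift_words twisted_eval (word u \<star> f \<star> word v) = 0"
proof -
  let ?I = "{f :: 'n list \<Rightarrow> complex. f \<in> F \<and> (\<forall>u v. lift_words twisted_eval (word u \<star> f \<star> word v) = 0)}"
  have rel: "word [i, j] + word [j, i] \<in> ?I" if "i \<noteq> j" for i j :: 'n
  proof -
    have "lift_words twisted_eval (word u \<star> (word [i, j] + word [j, i]) \<star> word v) = 0" for u v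
      unfolding free_mult_linear word_mult
      by (subst lift_words_add[OF word_closed word_closed])
        (use twisted_eval_swap[OF that, of u v] in simp)
    then show ?thesis using free_closed(1)[OF word_closed word_closed] by blast
  qed
  have "skew_ideal \<subseteq> ?I"
  proof (rule skew_ideal_minimal)
    show "ideal ?I free_algebra" by (rule ideal_lift_words_kernel)
  qed (rule rel)
  then show ?thesis using assms by blast
qed

text \<open>The counts of all letters have the same parity. This is the support of the invariants of the
diagonal matrices with an even number of entries \<open>-1\<close> and all others \<open>1\<close>.\<close>

definition balanced :: "'n list \<Rightarrow> bool"
  where "balanced z \<longleftrightarrow> (\<forall>i j. even (count_list z i) \<longleftrightarrow> even (count_list z j))"

lemma prod_list_count: "prod_list (map h z) = (\<Prod>j\<in>UNIV. h j ^ count_list z (j :: 'n::finite) :: complex)"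
proof (induction z)
  case (Cons i z)
  have "(\<Prod>j\<in>UNIV. h j ^ count_list (i # z) j) = (\<Prod>j\<in>UNIV. (if j = i then h j else 1) * h j ^ count_list z j)"
    by (rule prod.cong) auto
  also have "\<dots> = h i * (\<Prod>j\<in>UNIV. h j ^ count_list z j)"
    by (simp add: prod.distrib)
  finally show ?case using Cons by simp
qed simp

text \<open>Signs only depend on the parity of the exponents, and in a balanced word all exponents have the
same parity; so the product is a power of the product over all letters.\<close>

lemma prod_list_balanced:
  assumes z: "balanced z" and h: "\<And>j :: 'n::finite. h j * h j = (1 :: complex)"
  shows "prod_list (map h z) = (if odd (count_list z undefined) then \<Prod>j\<in>UNIV. h j else 1)"
proof -
  have "h j ^ k = (if odd k then h j else 1)" for j k
    by (induction k) (auto simp: h)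
  then have "prod_list (map h z) = (\<Prod>j\<in>UNIV. if odd (count_list z undefined) then h j else 1)"
    unfolding prod_list_count using z by (simp add: balanced_def cong: if_cong) (metis (mono_tags, lifting))
  then show ?thesis by simp
qed

text \<open>A balanced word commutes with every letter up to this sign, the column product of \<open>bichar\<close> or
\<open>1\<close>. The fixed letter \<open>undefined\<close> may be used since all letters have the same parity.\<close>

definition central_sign :: "'n::finite list \<Rightarrow> complex"
  where "central_sign z = (if odd (count_list z undefined) then (- 1) ^ (CARD('n) - 1) else 1)"

text \<open>The pairs between \<open>u\<close> and \<open>z\<close> contribute row products and the pairs between \<open>z\<close> and \<open>v\<close> column
products.\<close>

lemma twisted_eval_balanced:
  assumes z: "balanced z"
  shows "twisted_eval (u @ z @ v) = twisted_eval z * central_sign z ^ length v * twisted_eval (u @ v)"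
proof -
  have "prod_list (map (bichar i) z) = 1" for i
    unfolding prod_list_balanced[OF z bichar_square] by (simp add: bichar_row)
  then have "cross u z = 1" by (induction u) (simp_all add: cross_def)
  moreover have "cross z v = central_sign z ^ length v"
  proof -
    have "prod_list (map (\<lambda>i. bichar i j) z) = central_sign z" for j
      by (subst prod_list_balanced[OF z]) (auto simp: bichar_square bichar_column central_sign_def)
    then show ?thesis unfolding cross_alt by (induction v) simp_all
  qed
  ultimately show ?thesis
    by (simp add: twisted_eval_append cross_append algebra_simps)
qed

definition sign_flip :: "'n \<Rightarrow> 'n \<Rightarrow> complex^'n::finite^'n"
  where "sign_flip i j = mono_mat id (\<lambda>k. if k = i \<or> k = j then - 1 else 1)"

lemma free_action_diagonal:
  assumes f: "f \<in> F"
  shows "free_action (mono_mat id c) f w = prod_list (map c w) * f w"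
  by (rule free_induct[where P = "\<lambda>f. free_action (mono_mat id c) f w = prod_list (map c w) * f w", OF f])
    (simp_all add: free_action_linear free_action_word word_apply algebra_simps)

lemma prod_list_flip:
  assumes "i \<noteq> j"
  shows "prod_list (map (\<lambda>k. if k = i \<or> k = j then - 1 else 1) w) = ((- 1) ^ (count_list w i + count_list w j) :: complex)"
  using assms by (induction w) auto

text \<open>If \<open>f\<close> is invariant under the involution \<open>t\<close> that negates \<open>x\<^sub>i\<close> and \<open>x\<^sub>j\<close>, then
\<open>f\<close> is congruent to \<open>(f + t f) / 2\<close>, which retains exactly the words in which the counts of \<open>i\<close> and
\<open>j\<close> have the same parity. Doing this for a fixed letter and all others leaves balanced words.\<close>

lemma balanced_part_exists:
  fixes f :: "'n::finite list \<Rightarrow> complex"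
  assumes f: "f \<in> F"
    and inv: "\<And>i j. i \<noteq> j \<Longrightarrow> free_action (sign_flip i j) f - f \<in> skew_ideal"
  shows "\<exists>g\<in>F. f - g \<in> skew_ideal \<and> (\<forall>w. g w \<noteq> 0 \<longrightarrow> balanced w)"
proof -
  note K = funs.subspace_add[OF subspace_skew_ideal] funs.subspace_scale[OF subspace_skew_ideal]
  have "\<exists>g\<in>F. f - g \<in> skew_ideal \<and>
      (\<forall>w. g w \<noteq> 0 \<longrightarrow> (\<forall>j\<in>J. even (count_list w i0 + count_list w j)))" if "i0 \<notin> J" for i0 and J :: "'n set"
    using finite[of J] that
  proof (induction J)
    case empty
    have "f - f \<in> skew_ideal" using funs.subspace_0[OF subspace_skew_ideal] by simp
    then show ?case using f by blast
  next
    case (insert j J)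
    then obtain g where g: "g \<in> F" "f - g \<in> skew_ideal"
      "\<And>w j. g w \<noteq> 0 \<Longrightarrow> j \<in> J \<Longrightarrow> even (count_list w i0 + count_list w j)" by blast
    let ?t = "free_action (sign_flip i0 j)"
    have ij: "i0 \<noteq> j" using insert by auto
    have tw: "?t g w = (- 1) ^ (count_list w i0 + count_list w j) * g w" for w
      unfolding sign_flip_def free_action_diagonal[OF g(1)] prod_list_flip[OF ij] ..
    have tc: "?t g \<in> F"
      unfolding sign_flip_def by (rule free_action_closed[OF g(1)])
    have "?t (g - f) \<in> skew_ideal"
      unfolding sign_flip_def
      by (rule skew_ideal_action) (use funs.subspace_neg[OF subspace_skew_ideal g(2)] in auto)
    moreover have "?t g = ?t (g - f) + ?t f"
      using free_action_linear(1)[of "sign_flip i0 j" "g - f" f] by simp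
    ultimately have "(?t g - ?t f) + (?t f - f) + (f - g) \<in> skew_ideal"
      using inv[OF ij] g(2) by (intro K) simp_all
    then have tg: "?t g - g \<in> skew_ideal" by simp
    let ?g = "scale (1/2) (g + ?t g)"
    show ?case
    proof (intro bexI[of _ ?g] conjI allI impI ballI)
      show "?g \<in> F"
        using free_closed(1)[OF g(1) tc] free_closed(3) by blast
      have "f - ?g = (f - g) + scale (-1/2) (?t g - g)"
        by (auto simp: fun_eq_iff algebra_simps)
      then show "f - ?g \<in> skew_ideal"
        using K(1)[OF g(2) K(2)[OF tg]] by metis
      fix w k assume w: "?g w \<noteq> 0" and k: "k \<in> insert j J"
      have "?g w = (1 + (- 1) ^ (count_list w i0 + count_list w j)) / 2 * g w"
        by (simp add: tw field_simps)
      then have "g w \<noteq> 0" "even (count_list w i0 + count_list w j)"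
        using w by (auto simp: minus_one_power_iff split: if_splits)
      then show "even (count_list w i0 + count_list w k)" using k g(3) by auto
    qed
  qed
  from this[of undefined "UNIV - {undefined}"]
  obtain g where g: "g \<in> F" "f - g \<in> skew_ideal"
    "\<And>w j. g w \<noteq> 0 \<Longrightarrow> j \<noteq> undefined \<Longrightarrow> even (count_list w undefined + count_list w j)" by blast
  have "balanced w" if "g w \<noteq> 0" for w
  proof -
    have "even (count_list w j) \<longleftrightarrow> even (count_list w undefined)" for j
      using g(3)[OF that, of j] by (cases "j = undefined") auto
    then show ?thesis unfolding balanced_def by blast
  qed
  then show ?thesis using g by blast
qed

text \<open>Invariants act like scalars, up to the sign of moving them past \<open>v\<close>.\<close>

lemma twisted_eval_invariant:
  assumes f: "f \<in> F"
    and inv: "\<And>i j. i \<noteq> j \<Longrightarrow> free_action (sign_flip i j) f - f \<in> skew_ideal"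
  shows "\<exists>c. \<forall>u v. lift_words twisted_eval (word u \<star> f \<star> word v) = c (length v) * twisted_eval (u @ v)"
proof -
  obtain g where g: "g \<in> F" "f - g \<in> skew_ideal" "\<And>w. g w \<noteq> 0 \<Longrightarrow> balanced w"
    using balanced_part_exists[OF f inv] by blast
  have "lift_words twisted_eval (word u \<star> f \<star> word v) =
      (\<Sum>w | g w \<noteq> 0. g w * (twisted_eval w * central_sign w ^ length v)) * twisted_eval (u @ v)" for u v
  proof -
    have "word u \<star> f \<star> word v = word u \<star> (f - g) \<star> word v + word u \<star> g \<star> word v"
      by (simp add: free_mult_diff)
    then have "lift_words twisted_eval (word u \<star> f \<star> word v) =
        lift_words twisted_eval (word u \<star> (f - g) \<star> word v) + lift_words twisted_eval (word u \<star> g \<star> word v)"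
      using lift_words_add free_mult_closed word_closed free_closed(2)[OF f g(1)] g(1) by metis
    also have "\<dots> = lift_words twisted_eval (word u \<star> g \<star> word v)"
      by (simp add: lift_twisted_eval_skew_ideal[OF g(2)])
    also have "\<dots> = (\<Sum>w | g w \<noteq> 0. g w * (twisted_eval w * central_sign w ^ length v) * twisted_eval (u @ v))"
      unfolding lift_words_sandwich[OF g(1)]
      by (rule sum.cong) (use g(3) in \<open>auto simp: twisted_eval_balanced\<close>)
    finally show ?thesis by (simp only: sum_distrib_right)
  qed
  then show ?thesis
    by (intro exI[of _ "\<lambda>l. \<Sum>w | g w \<noteq> 0. g w * (twisted_eval w * central_sign w ^ l)"] allI)
qed

section \<open>The dimension of commutative coinvariant rings\<close>

text \<open>Exponent vectors stand for monomials, and adding the indicator of \<open>D\<close> is multiplication by the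
square-free monomial of \<open>D\<close>.\<close>

definition bump :: "'i set \<Rightarrow> ('i \<Rightarrow> nat) \<Rightarrow> 'i \<Rightarrow> nat"
  where "bump D b = (\<lambda>i. b i + (if i \<in> D then 1 else 0))"

lemma bump_empty [simp]: "bump {} b = b"
  by (simp add: bump_def)

lemma bump_bump: "D \<inter> E = {} \<Longrightarrow> bump D (bump E b) = bump (D \<union> E) b"
  by (auto simp: bump_def fun_eq_iff)

context vector_space
begin

text \<open>Here \<open>M b\<close> stands for \<open>y\<^sup>b v\<close>, and \<open>U\<close> contains everything that is regarded as zero. For
\<open>k \<in> K\<close> the multiples of \<open>y\<^sub>k\<close> form a family killed by the product over \<open>K - {k}\<close>; modulo these
multiples the elementary symmetric polynomials of \<open>J\<close> become those of \<open>J - {k}\<close>, so that what is left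
is a coinvariant ring in one variable less.\<close>

lemma coinvariant_span_step:
  fixes M :: "('i \<Rightarrow> nat) \<Rightarrow> 'b"
  assumes J: "finite J" and K: "K \<subseteq> J" and U: "subspace U"
    and IH: "\<And>k M U. k \<in> J \<Longrightarrow> subspace U \<Longrightarrow>
      (\<And>j b. 1 \<le> j \<Longrightarrow> j \<le> card J - 1 \<Longrightarrow> (\<Sum>D | D \<subseteq> J - {k} \<and> card D = j. M (bump D b)) \<in> U) \<Longrightarrow>
      \<exists>G. finite G \<and> G \<subseteq> range M \<and> card G \<le> fact (card J - 1) \<and> (\<forall>b. (\<forall>i. i \<notin> J - {k} \<longrightarrow> b i = 0) \<longrightarrow> M b \<in> span (G \<union> U))"
    and e: "\<And>j b. 1 \<le> j \<Longrightarrow> j < card J \<Longrightarrow> (\<Sum>D | D \<subseteq> J \<and> card D = j. M (bump D b)) \<in> U"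
    and z: "\<And>b. M (bump K b) \<in> U"
  shows "\<exists>G. finite G \<and> G \<subseteq> range M \<and> card G \<le> card K * fact (card J - 1) \<and>
    (\<forall>b. (\<forall>i. i \<notin> J \<longrightarrow> b i = 0) \<longrightarrow> M b \<in> span (G \<union> U))"
  using finite_subset[OF K J] K e z
proof (induction K arbitrary: M)
  case empty
  have "M b \<in> U" for b using empty.prems(3)[of b] by simp
  then show ?case by (intro exI[of _ "{}"]) (auto intro: span_base)
next
  case (insert k K)
  have k: "k \<in> J" using insert.prems by auto
  define M' where "M' b = M (bump {k} b)" for b
  have "bump {k} (bump D b) = bump D (bump {k} b)" for D b
    by (auto simp: bump_def)
  then have "(\<Sum>D | D \<subseteq> J \<and> card D = j. M' (bump D b)) \<in> U" if "1 \<le> j" "j < card J" for j b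
    unfolding M'_def using insert.prems(2)[OF that, of "bump {k} b"] by simp
  moreover have "M' (bump K b) \<in> U" for b
    unfolding M'_def using insert.prems(3)[of b] insert.hyps by (simp add: bump_bump)
  ultimately have "\<exists>G. finite G \<and> G \<subseteq> range M' \<and> card G \<le> card K * fact (card J - 1) \<and>
      (\<forall>b. (\<forall>i. i \<notin> J \<longrightarrow> b i = 0) \<longrightarrow> M' b \<in> span (G \<union> U))"
    using insert.prems(1) by (intro insert.IH) simp_all
  then obtain G1 where G1: "finite G1" "G1 \<subseteq> range M'" "card G1 \<le> card K * fact (card J - 1)"
    "\<And>b. (\<And>i. i \<notin> J \<Longrightarrow> b i = 0) \<Longrightarrow> M' b \<in> span (G1 \<union> U)"
    by (elim exE conjE) simp
  let ?U = "span (G1 \<union> U)"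
  \<comment> \<open>The families are only controlled on exponents supported on \<open>J\<close>, so the others are cut off.\<close>
  define R where "R b = (\<lambda>i. if i \<in> J then b i else 0)" for b :: "'i \<Rightarrow> nat"
  define M2 where "M2 b = M (R b)" for b
  have R: "R (bump D b) = bump D (R b)" if "D \<subseteq> J" for D b
    using that by (auto simp: R_def bump_def fun_eq_iff)
  have "(\<Sum>D | D \<subseteq> J - {k} \<and> card D = j. M2 (bump D b)) \<in> ?U" if j: "1 \<le> j" "j \<le> card J - 1" for j b
  proof -
    let ?A = "{D. D \<subseteq> J \<and> card D = j}" and ?B = "{D. D \<subseteq> J - {k} \<and> card D = j}"
    have fin: "finite ?A" by (rule finite_subset[of _ "Pow J"]) (use J in auto)
    have "card J > 0" using k J card_gt_0_iff by blast
    then have "(\<Sum>D\<in>?A. M (bump D (R b))) \<in> U"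
      using insert.prems(2)[of j "R b"] j by simp
    also have "(\<Sum>D\<in>?A. M (bump D (R b))) = (\<Sum>D\<in>?A - ?B. M (bump D (R b))) + (\<Sum>D\<in>?B. M (bump D (R b)))"
      by (rule sum.subset_diff) (use fin in auto)
    finally have *: "(\<Sum>D\<in>?A - ?B. M (bump D (R b))) + (\<Sum>D\<in>?B. M (bump D (R b))) \<in> ?U"
      by (intro span_base) simp
    have "(\<Sum>D\<in>?A - ?B. M (bump D (R b))) \<in> ?U"
    proof (rule span_sum)
      fix D assume "D \<in> ?A - ?B"
      then have D: "D \<subseteq> J" "k \<in> D" by auto
      have "bump D (R b) = bump {k} (bump (D - {k}) (R b))"
        using D by (subst bump_bump) (auto simp: insert_absorb)
      moreover have "bump (D - {k}) (R b) i = 0" if "i \<notin> J" for i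
        using that D by (auto simp: bump_def R_def)
      ultimately show "M (bump D (R b)) \<in> ?U"
        using G1(4)[of "bump (D - {k}) (R b)"] by (simp add: M'_def)
    qed
    from span_diff[OF * this] have "(\<Sum>D\<in>?B. M (bump D (R b))) \<in> ?U"
      by simp
    moreover have "(\<Sum>D\<in>?B. M2 (bump D b)) = (\<Sum>D\<in>?B. M (bump D (R b)))"
      unfolding M2_def by (rule sum.cong) (auto intro!: arg_cong[of _ _ M] R)
    ultimately show ?thesis by simp
  qed
  then have "\<exists>G. finite G \<and> G \<subseteq> range M2 \<and> card G \<le> fact (card J - 1) \<and>
      (\<forall>b. (\<forall>i. i \<notin> J - {k} \<longrightarrow> b i = 0) \<longrightarrow> M2 b \<in> span (G \<union> ?U))"
    by (rule IH[OF k subspace_span])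
  then obtain G2 where G2: "finite G2" "G2 \<subseteq> range M2" "card G2 \<le> fact (card J - 1)"
    "\<And>b. (\<And>i. i \<notin> J - {k} \<Longrightarrow> b i = 0) \<Longrightarrow> M2 b \<in> span (G2 \<union> ?U)"
    by (elim exE conjE) simp
  have sub: "span (G1 \<union> U) \<subseteq> span ((G1 \<union> G2) \<union> U)"
    by (rule span_mono) auto
  have "span (G2 \<union> ?U) \<subseteq> span ((G1 \<union> G2) \<union> U)"
    by (rule span_minimal) (use sub in \<open>auto intro: span_base\<close>)
  note sub = sub this
  show ?case
  proof (intro exI[of _ "G1 \<union> G2"] conjI allI impI)
    show "finite (G1 \<union> G2)" using G1 G2 by simp
    show "G1 \<union> G2 \<subseteq> range M" using G1(2) G2(2) by (auto simp: M'_def M2_def)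
    have "card (G1 \<union> G2) \<le> card G1 + card G2" by (rule card_Un_le)
    then show "card (G1 \<union> G2) \<le> card (insert k K) * fact (card J - 1)"
      using G1(3) G2(3) insert.hyps by simp
    fix b :: "'i \<Rightarrow> nat" assume b: "\<forall>i. i \<notin> J \<longrightarrow> b i = 0"
    show "M b \<in> span ((G1 \<union> G2) \<union> U)"
    proof (cases "b k = 0")
      case True
      have "R b = b" using b by (auto simp: R_def)
      then show ?thesis using G2(4)[of b] True b sub by (auto simp: M2_def)
    next
      case False
      have "b = bump {k} (b(k := b k - 1))" using False by (auto simp: bump_def)
      then have "M b = M' (b(k := b k - 1))" by (simp add: M'_def)
      moreover have "M' (b(k := b k - 1)) \<in> span (G1 \<union> U)"
        by (rule G1(4)) (use b k in auto)
      ultimately show ?thesis using sub(1) by auto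
    qed
  qed
qed

text \<open>The case \<open>K = J\<close>, in which the product is the last elementary symmetric polynomial, gives
\<open>card J * (card J - 1)!\<close> generators and closes the induction.\<close>

lemma coinvariant_span:
  fixes M :: "('i \<Rightarrow> nat) \<Rightarrow> 'b"
  assumes "finite J" and "subspace U"
    and "\<And>j b. 1 \<le> j \<Longrightarrow> j \<le> card J \<Longrightarrow> (\<Sum>D | D \<subseteq> J \<and> card D = j. M (bump D b)) \<in> U"
  shows "\<exists>G. finite G \<and> G \<subseteq> range M \<and> card G \<le> fact (card J) \<and>
    (\<forall>b. (\<forall>i. i \<notin> J \<longrightarrow> b i = 0) \<longrightarrow> M b \<in> span (G \<union> U))"
  using assms
proof (induction "card J" arbitrary: J M U)
  case 0
  then have "J = {}" by simp
  show ?case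
  proof (intro exI[of _ "{M (\<lambda>_. 0)}"] conjI allI impI)
    fix b :: "'i \<Rightarrow> nat" assume "\<forall>i. i \<notin> J \<longrightarrow> b i = 0"
    then have "b = (\<lambda>_. 0)" using \<open>J = {}\<close> by auto
    then show "M b \<in> span ({M (\<lambda>_. 0)} \<union> U)" by (auto intro: span_base)
  qed auto
next
  case (Suc n)
  have "J \<noteq> {}" using Suc.hyps(2) by auto
  have "\<exists>G. finite G \<and> G \<subseteq> range M \<and> card G \<le> card J * fact (card J - 1) \<and>
    (\<forall>b. (\<forall>i. i \<notin> J \<longrightarrow> b i = 0) \<longrightarrow> M b \<in> span (G \<union> U))"
  proof (rule coinvariant_span_step)
    fix k U and M :: "('i \<Rightarrow> nat) \<Rightarrow> 'b" assume k: "k \<in> J" and U: "subspace U"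
      and e: "\<And>j b. 1 \<le> j \<Longrightarrow> j \<le> card J - 1 \<Longrightarrow> (\<Sum>D | D \<subseteq> J - {k} \<and> card D = j. M (bump D b)) \<in> U"
    have c: "card (J - {k}) = card J - 1" using k Suc.prems(1) by simp
    show "\<exists>G. finite G \<and> G \<subseteq> range M \<and> card G \<le> fact (card J - 1) \<and> (\<forall>b. (\<forall>i. i \<notin> J - {k} \<longrightarrow> b i = 0) \<longrightarrow> M b \<in> span (G \<union> U))"
      using Suc.hyps(1)[of "J - {k}" U M] Suc.hyps(2) Suc.prems(1) U e unfolding c by simp
  next
    show "M (bump J b) \<in> U" for b
    proof -
      have "{D. D \<subseteq> J \<and> card D = card J} = {J}"
        using Suc.prems(1) card_subset_eq by auto
      then show ?thesis using Suc.prems(3)[of "card J" b] Suc.hyps(2) by simp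
    qed
  qed (use Suc.prems in auto)
  then show ?case using Suc.hyps(2) by (metis fact_reduce zero_less_Suc of_nat_id)
qed

lemma coinvariant_span_product:
  fixes M :: "('i \<Rightarrow> nat) \<Rightarrow> 'b"
  assumes "finite J" and "K \<subseteq> J" and "subspace U"
    and "\<And>j b. 1 \<le> j \<Longrightarrow> j < card J \<Longrightarrow> (\<Sum>D | D \<subseteq> J \<and> card D = j. M (bump D b)) \<in> U"
    and "\<And>b. M (bump K b) \<in> U"
  shows "\<exists>G. finite G \<and> G \<subseteq> range M \<and> card G \<le> card K * fact (card J - 1) \<and>
    (\<forall>b. (\<forall>i. i \<notin> J \<longrightarrow> b i = 0) \<longrightarrow> M b \<in> span (G \<union> U))"
proof (rule coinvariant_span_step)
  fix k U and M :: "('i \<Rightarrow> nat) \<Rightarrow> 'b" assume k: "k \<in> J" and U: "subspace U"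
    and e: "\<And>j b. 1 \<le> j \<Longrightarrow> j \<le> card J - 1 \<Longrightarrow> (\<Sum>D | D \<subseteq> J - {k} \<and> card D = j. M (bump D b)) \<in> U"
  have c: "card (J - {k}) = card J - 1" using k assms(1) by simp
  show "\<exists>G. finite G \<and> G \<subseteq> range M \<and> card G \<le> fact (card J - 1) \<and> (\<forall>b. (\<forall>i. i \<notin> J - {k} \<longrightarrow> b i = 0) \<longrightarrow> M b \<in> span (G \<union> U))"
    using coinvariant_span[of "J - {k}" U M] assms(1) U e unfolding c by simp
qed (use assms in auto)

end

section \<open>Reordering words modulo the skew relations\<close>

definition skeq :: "complex \<Rightarrow> 'n list \<Rightarrow> 'n list \<Rightarrow> bool"
  where "skeq s u v \<longleftrightarrow> word u - scale s (word v) \<in> skew_ideal"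

lemma skeq_refl [simp]: "skeq 1 u u"
  using funs.subspace_0[OF subspace_skew_ideal] by (simp add: skeq_def)

lemma skeq_trans:
  assumes "skeq s u v" "skeq t v w"
  shows "skeq (s * t) u w"
proof -
  have "word u - scale (s * t) (word w) =
      (word u - scale s (word v)) + scale s (word v - scale t (word w))"
    by (auto simp: fun_eq_iff algebra_simps)
  then show ?thesis
    using assms funs.subspace_add[OF subspace_skew_ideal] funs.subspace_scale[OF subspace_skew_ideal]
    unfolding skeq_def by metis
qed

lemma skeq_sym:
  assumes "skeq s u v" "s * s = 1"
  shows "skeq s v u"
proof -
  have "word v - scale s (word u) = scale (- s) (word u - scale s (word v))"
    using assms(2) by (auto simp: fun_eq_iff algebra_simps mult.assoc[symmetric])
  then show ?thesis
    using assms(1) funs.subspace_scale[OF subspace_skew_ideal] unfolding skeq_def by metis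
qed

lemma skeq_context:
  assumes "skeq s u v"
  shows "skeq s (x @ u @ y) (x @ v @ y)"
proof -
  have "word x \<star> ((word u - scale s (word v)) \<star> word y) \<in> skew_ideal"
    using assms unfolding skeq_def by (intro skew_ideal_mult word_closed)
  then show ?thesis
    unfolding skeq_def by (simp only: free_mult_diff free_mult_linear word_mult)
qed

lemma skeq_append_left: "skeq s u v \<Longrightarrow> skeq s (x @ u) (x @ v)"
  and skeq_append_right: "skeq s u v \<Longrightarrow> skeq s (u @ y) (v @ y)"
  using skeq_context[of s u v x "[]"] skeq_context[of s u v "[]" y] by simp_all

lemma skeq_mult:
  assumes "skeq s u v" "skeq t u' v'"
  shows "skeq (s * t) (u @ u') (v @ v')"
  using skeq_trans[OF skeq_append_right[OF assms(1)] skeq_append_left[OF assms(2)]] .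

lemma skeq_swap:
  assumes "i \<noteq> j"
  shows "skeq (- 1) [i, j] [j, i]"
  using skew_relation[OF assms] by (simp add: skeq_def)

text \<open>With \<open>S = {1}\<close> this says that products of pairwise commuting words may be rearranged; with
  \<open>S = {1, -1}\<close> it says that every rearrangement of letters costs a sign.\<close>

lemma skeq_concat_perm:
  assumes S: "1 \<in> S" "\<And>s t. s \<in> S \<Longrightarrow> t \<in> S \<Longrightarrow> s * t \<in> S"
    and comm: "\<And>i j. \<exists>s\<in>S. skeq s (B i @ B j) (B j @ B i)"
    and "mset xs = mset ys"
  shows "\<exists>s\<in>S. skeq s (concat (map B xs)) (concat (map B ys))"
proof -
  have move: "\<exists>s\<in>S. skeq s (B x @ concat (map B ys)) (concat (map B ys) @ B x)" for x ys
  proof (induction ys)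
    case Nil
    then show ?case using S(1) by (intro bexI[of _ 1]) simp_all
  next
    case (Cons y ys)
    then obtain s where s: "s \<in> S" "skeq s (B x @ concat (map B ys)) (concat (map B ys) @ B x)" by blast
    obtain t where t: "t \<in> S" "skeq t (B x @ B y) (B y @ B x)" using comm by blast
    have "skeq (t * s) (B x @ B y @ concat (map B ys)) (B y @ concat (map B ys) @ B x)"
      using skeq_trans[OF skeq_append_right[OF t(2), unfolded append_assoc] skeq_append_left[OF s(2)]] .
    then show ?case using S(2)[OF t(1) s(1)] by (intro bexI[of _ "t * s"]) simp_all
  qed
  show ?thesis
    using \<open>mset xs = mset ys\<close>
  proof (induction xs arbitrary: ys)
    case Nil
    then show ?case using S(1) by (intro bexI[of _ 1]) simp_all
  next
    case (Cons x xs)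
    then have "x \<in> set ys" by (metis list.set_intros(1) set_mset_mset)
    then obtain us vs where ys: "ys = us @ x # vs" by (auto simp: in_set_conv_decomp)
    with Cons have "mset xs = mset (us @ vs)" by simp
    with Cons obtain s where s: "s \<in> S" "skeq s (concat (map B xs)) (concat (map B (us @ vs)))" by blast
    obtain t where t: "t \<in> S" "skeq t (B x @ concat (map B us)) (concat (map B us) @ B x)"
      using move by blast
    have "skeq (s * t) (B x @ concat (map B xs)) (concat (map B us) @ B x @ concat (map B vs))"
      using skeq_trans[OF skeq_append_left[OF s(2)]] skeq_append_right[OF t(2), of "concat (map B vs)"]
      by simp
    then show ?case using S(2)[OF s(1) t(1)] ys by (intro bexI[of _ "s * t"]) simp_all
  qed
qed

lemma skeq_perm:
  assumes "mset u = mset v"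
  shows "\<exists>s. s * s = 1 \<and> skeq s u v"
proof -
  have "\<exists>s\<in>{s. s * s = 1}. skeq s (concat (map (\<lambda>i. [i]) u)) (concat (map (\<lambda>i. [i]) v))"
  proof (rule skeq_concat_perm)
    fix i j :: 'a
    show "\<exists>s\<in>{s. s * s = 1}. skeq s ([i] @ [j]) ([j] @ [i])"
    proof (cases "i = j")
      case True
      then show ?thesis by (intro bexI[of _ 1]) simp_all
    next
      case False
      then show ?thesis using skeq_swap[OF False] by (intro bexI[of _ "- 1"]) simp_all
    qed
  next
    fix s t :: complex assume "s \<in> {s. s * s = 1}" "t \<in> {s. s * s = 1}"
    then show "s * t \<in> {s. s * s = 1}" by (simp add: mult_ac)
  qed (use assms in auto)
  then show ?thesis by simp
qed

lemma skeq_letter_word: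
  "i \<notin> set v \<Longrightarrow> skeq ((- 1) ^ length v) (i # v) (v @ [i])"
proof (induction v)
  case (Cons j v)
  have "skeq (- 1) ([] @ [i, j] @ v) ([] @ [j, i] @ v)"
    by (rule skeq_context[OF skeq_swap]) (use Cons in auto)
  moreover have "skeq ((- 1) ^ length v) ([j] @ (i # v) @ []) ([j] @ (v @ [i]) @ [])"
    by (rule skeq_context) (use Cons in auto)
  ultimately show ?case using skeq_trans by fastforce
qed simp

lemma skeq_even_power:
  assumes "even m"
  shows "skeq 1 (replicate m i @ [j]) ([j] @ replicate m i)"
proof (cases "i = j")
  case True
  then show ?thesis by (simp add: replicate_append_same)
next
  case False
  have "skeq ((- 1) ^ m) (j # replicate m i) (replicate m i @ [j])"
    using skeq_letter_word[of j "replicate m i"] False by simp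
  then show ?thesis using assms skeq_sym by fastforce
qed

text \<open>Moving an even power past a letter takes an even number of exchanges.\<close>

lemma skeq_even_power_word:
  assumes "even m"
  shows "skeq 1 (replicate m i @ v) (v @ replicate m i)"
proof (induction v)
  case (Cons j v)
  have "skeq 1 ([] @ (replicate m i @ [j]) @ v) ([] @ ([j] @ replicate m i) @ v)"
    by (rule skeq_context[OF skeq_even_power[OF assms]])
  moreover have "skeq 1 ([j] @ (replicate m i @ v) @ []) ([j] @ (v @ replicate m i) @ [])"
    by (rule skeq_context[OF Cons])
  ultimately show ?case using skeq_trans by fastforce
qed simp

text \<open>If \<open>v\<close> is the word between \<open>a\<close> and \<open>b\<close>, exchanging them takes \<open>2 * length v + 1\<close> sign changes.\<close>

lemma skeq_transpose:
  assumes ys: "distinct ys" "a \<in> set ys" "b \<in> set ys" "a \<noteq> b"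
  shows "skeq (- 1) (map (Transposition.transpose a b) ys) ys"
proof -
  have swap: "skeq (- 1) (u @ [a] @ v @ [b] @ w) (u @ [b] @ v @ [a] @ w)"
    if "a \<notin> set v" "b \<notin> set v" "a \<noteq> b" for a b :: 'a and u v w
  proof -
    let ?s = "(- 1) ^ length v :: complex"
    have ss: "?s * ?s = 1" by (simp flip: power_mult_distrib)
    have 1: "skeq ?s (a # v @ [b]) (v @ [a, b])"
      using skeq_append_right[OF skeq_letter_word[OF that(1)], of "[b]"] by simp
    have 2: "skeq (- 1) (v @ [a, b]) (v @ [b, a])"
      by (rule skeq_append_left[OF skeq_swap]) fact
    have 3: "skeq ?s (v @ [b, a]) (b # v @ [a])"
      using skeq_append_right[OF skeq_sym[OF skeq_letter_word[OF that(2)] ss], of "[a]"] by simp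
    have "skeq (?s * (- 1) * ?s) (a # v @ [b]) (b # v @ [a])"
      by (rule skeq_trans[OF skeq_trans[OF 1 2] 3])
    moreover have "?s * (- 1) * ?s = - 1" using ss by simp
    ultimately show ?thesis using skeq_context[of "- 1" "a # v @ [b]" "b # v @ [a]" u w] by simp
  qed
  have fixed: "map (Transposition.transpose a b) v = v" if "a \<notin> set v" "b \<notin> set v" for v
    using that by (induction v) (auto simp: Transposition.transpose_def)
  obtain us vs where uv: "ys = us @ a # vs" using ys by (auto simp: in_set_conv_decomp)
  show ?thesis
  proof (cases "b \<in> set vs")
    case True
    then obtain vs1 vs2 where "vs = vs1 @ b # vs2" by (auto simp: in_set_conv_decomp)
    then have y: "ys = us @ [a] @ vs1 @ [b] @ vs2" using uv by simp
    then have d: "a \<notin> set us" "a \<notin> set vs1" "a \<notin> set vs2" "b \<notin> set us" "b \<notin> set vs1" "b \<notin> set vs2"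
      using ys(1) by auto
    have "map (Transposition.transpose a b) ys = us @ [b] @ vs1 @ [a] @ vs2"
      unfolding y using d by (simp add: fixed)
    then show ?thesis unfolding y using swap[of b vs1 a us vs2] d ys(4) by simp
  next
    case False
    then have "b \<in> set us" using ys uv by auto
    then obtain us1 us2 where "us = us1 @ b # us2" by (auto simp: in_set_conv_decomp)
    then have y: "ys = us1 @ [b] @ us2 @ [a] @ vs" using uv by simp
    then have d: "a \<notin> set us1" "a \<notin> set us2" "a \<notin> set vs" "b \<notin> set us1" "b \<notin> set us2" "b \<notin> set vs"
      using ys(1) by auto
    have "map (Transposition.transpose a b) ys = us1 @ [a] @ us2 @ [b] @ vs"
      unfolding y using d by (simp add: fixed)
    then show ?thesis unfolding y using swap[of a us2 b us1 vs] d ys(4) by simp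
  qed
qed

text \<open>Each transposition contributes a sign. In the algebra, a permutation matrix thus acts on the product
of all variables by its sign.\<close>

lemma skeq_sign:
  fixes \<sigma> :: "'n::finite \<Rightarrow> 'n"
  assumes "bij \<sigma>" and xs: "distinct xs" "set xs = UNIV"
  shows "skeq (of_int (sign \<sigma>)) (map \<sigma> xs) xs"
proof -
  have "\<sigma> permutes UNIV" using assms(1) by (rule bij_imp_permutes) simp
  from this finite show ?thesis
  proof (induction rule: permutes_induct)
    case id
    then show ?case by simp
  next
    case (swap a b p)
    let ?ys = "map p xs"
    have bij: "bij p" using swap by (auto dest: permutes_bij)
    have "skeq (- 1) (map (Transposition.transpose a b) ?ys) ?ys"
    proof (rule skeq_transpose)
      show "distinct ?ys" using xs bij by (simp add: distinct_map bij_is_inj)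
      show "a \<in> set ?ys" "b \<in> set ?ys" using xs bij by (simp_all add: bij_is_surj)
    qed fact
    from skeq_trans[OF this swap(5)]
    have "skeq (- of_int (sign p)) (map (Transposition.transpose a b \<circ> p) xs) xs" by simp
    moreover have "sign (Transposition.transpose a b \<circ> p) = - sign p"
    proof -
      have "permutation p" using swap by (auto simp: permutation_permutes)
      then show ?thesis using swap
        by (simp add: sign_compose permutation_swap_id sign_swap_id)
    qed
    ultimately show ?case by (simp only: of_int_minus)
  qed
qed

lemma skeq_concat_replicate:
  "skeq s u v \<Longrightarrow> skeq (s ^ q) (concat (replicate q u)) (concat (replicate q v))"
  by (induction q) (simp_all add: skeq_mult)

section \<open>Monomials and invariants\<close>

definition letters :: "'n::finite list"
  where "letters = (SOME xs. distinct xs \<and> set xs = UNIV)"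

lemma letters [simp]: "distinct (letters :: 'n::finite list)" "set (letters :: 'n list) = UNIV"
proof -
  have "\<exists>xs :: 'n list. distinct xs \<and> set xs = UNIV"
    using finite_distinct_list[of "UNIV :: 'n set"] by auto
  from someI_ex[OF this] show "distinct (letters :: 'n list)" "set (letters :: 'n list) = UNIV"
    unfolding letters_def by auto
qed

lemma length_letters: "length (letters :: 'n::finite list) = CARD('n)"
  using distinct_card[of "letters :: 'n list"] by simp

definition sorted_word :: "('n::finite \<Rightarrow> nat) \<Rightarrow> 'n list"
  where "sorted_word a = concat (map (\<lambda>i. replicate (a i) i) letters)"

lemma count_sorted_word: "count (mset (sorted_word a)) j = a j"
proof -
  have "count (mset (concat (map (\<lambda>i. replicate (a i) i) xs))) j = (if j \<in> set xs then a j else 0)"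
    if "distinct xs" for xs
    using that by (induction xs) auto
  then show ?thesis unfolding sorted_word_def by simp
qed

lemma length_sorted_word: "length (sorted_word a) = (\<Sum>i\<in>UNIV. a i)"
proof -
  have "length (sorted_word a) = sum_list (map a letters)"
    unfolding sorted_word_def by (simp add: length_concat comp_def)
  then show ?thesis by (simp add: sum_list_distinct_conv_sum_set)
qed

lemma prod_list_letters: "prod_list (map c letters) = prod c (UNIV :: 'n::finite set)"
  using prod.distinct_set_conv_list[of letters c] by simp

lemma skeq_concat_split:
  assumes "\<And>i v. skeq 1 (B i @ v) (v @ B i)"
  shows "skeq 1 (concat (map (\<lambda>i. A i @ B i) xs)) (concat (map A xs) @ concat (map B xs))"
proof (induction xs)
  case (Cons x xs)
  have "skeq 1 (A x @ B x @ concat (map (\<lambda>i. A i @ B i) xs)) (A x @ B x @ concat (map A xs) @ concat (map B xs))"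
    by (intro skeq_append_left Cons)
  moreover have "skeq 1 (A x @ B x @ concat (map A xs) @ concat (map B xs))
      (A x @ concat (map A xs) @ B x @ concat (map B xs))"
    using skeq_append_left[OF skeq_append_right[OF assms[of x "concat (map A xs)"], of "concat (map B xs)"], of "A x"] by simp
  ultimately show ?case using skeq_trans by fastforce
qed simp

text \<open>The exponents of the square-free monomial of \<open>D\<close> in the \<open>m\<close>-th powers of the variables.\<close>

definition block :: "nat \<Rightarrow> 'n set \<Rightarrow> 'n \<Rightarrow> nat"
  where "block m D i = (if i \<in> D then m else 0)"

lemma skeq_block:
  assumes "even m"
  shows "skeq 1 (replicate (block m D i) j @ v) (v @ replicate (block m D i) j)"
  by (rule skeq_even_power_word) (use assms in \<open>simp add: block_def\<close>)

text \<open>The lifts to the free algebra of the generators of the invariant ideal.\<close>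

definition invariant_generators :: "nat \<Rightarrow> nat \<Rightarrow> ('n::finite list \<Rightarrow> complex) set"
  where "invariant_generators m p = {f \<in> F.
    (\<exists>d>0. \<forall>w. f w \<noteq> 0 \<longrightarrow> length w = d) \<and>
    (\<forall>A\<in>carrier (mystic_group m p). free_action A f - f \<in> skew_ideal)}"

definition elem_sym :: "nat \<Rightarrow> nat \<Rightarrow> 'n::finite list \<Rightarrow> complex"
  where "elem_sym m j = (\<Sum>D | D \<subseteq> UNIV \<and> card D = j. word (sorted_word (block m D)))"

text \<open>The \<open>m\<close>-th powers of the variables are central and are permuted by the group.\<close>

lemma elem_sym_invariant:
  assumes m: "m > 0" "even m" and j: "1 \<le> j"
  shows "elem_sym m j \<in> (invariant_generators m p :: ('n::finite list \<Rightarrow> complex) set)"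
  unfolding invariant_generators_def
proof (intro CollectI conjI ballI)
  let ?D = "{D :: 'n set. D \<subseteq> UNIV \<and> card D = j}"
  show "elem_sym m j \<in> carrier (free_algebra :: (complex, 'n list \<Rightarrow> complex) module)"
    unfolding elem_sym_def by (rule funs.subspace_sum[OF subspace_free word_closed])
  have len: "length (sorted_word (block m D)) = j * m" if "D \<in> ?D" for D
    using that unfolding length_sorted_word block_def by (simp add: sum.If_cases)
  have "length w = j * m" if "(elem_sym m j :: 'n list \<Rightarrow> complex) w \<noteq> 0" for w
  proof -
    have "(\<Sum>D\<in>?D. word (sorted_word (block m D)) w) \<noteq> 0"
      using that unfolding elem_sym_def sum_fun_apply .
    then obtain D where "D \<in> ?D" "word (sorted_word (block m D)) w \<noteq> 0"
      by (meson sum.neutral)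
    then show ?thesis using len[of D] by (auto simp: word_apply split: if_splits)
  qed
  then show "\<exists>d>0. \<forall>w. (elem_sym m j :: 'n list \<Rightarrow> complex) w \<noteq> 0 \<longrightarrow> length w = d"
    using m j by (intro exI[of _ "j * m"]) auto
next
  let ?D = "{D :: 'n set. D \<subseteq> UNIV \<and> card D = j}"
  fix A assume "A \<in> carrier (mystic_group m p :: (complex^'n^'n) monoid)"
  then obtain \<sigma> c where A: "A = mono_mat \<sigma> c" "bij \<sigma>" "\<forall>j. c j ^ m = 1"
    using mystic_group_iff[OF m(1)] by blast
  have act: "free_action A (word (sorted_word (block m D))) = word (map \<sigma> (sorted_word (block m D)))" for D
  proof -
    have "prod_list (map c (concat (map (\<lambda>i. replicate (block m D i) i) xs))) = 1" for xs
      using A(3) by (induction xs) (auto simp: block_def)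
    then show ?thesis unfolding A(1) free_action_word sorted_word_def by simp
  qed
  have perm: "skeq 1 (map \<sigma> (sorted_word (block m D))) (sorted_word (block m (\<sigma> ` D)))" for D
  proof -
    let ?B = "\<lambda>k. replicate (block m (\<sigma> ` D) k) k"
    have "map \<sigma> (sorted_word (block m D)) = concat (map ?B (map \<sigma> letters))"
    proof -
      have "map \<sigma> (replicate (block m D i) i) = ?B (\<sigma> i)" for i
        using A(2) by (auto simp: block_def bij_is_inj inj_image_mem_iff)
      then show ?thesis unfolding sorted_word_def map_concat by (simp add: comp_def)
    qed
    moreover have "mset (map \<sigma> letters) = mset letters"
    proof -
      have "distinct (map \<sigma> letters)" "set (map \<sigma> letters) = set letters"
        using A(2) by (simp_all add: distinct_map bij_is_inj bij_is_surj)
      then show ?thesis using set_eq_iff_mset_eq_distinct letters(1) by blast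
    qed
    then have "\<exists>s\<in>{1}. skeq s (concat (map ?B (map \<sigma> letters))) (concat (map ?B letters))"
      by (intro skeq_concat_perm) (use skeq_block[OF m(2)] in auto)
    ultimately show ?thesis by (simp add: sorted_word_def)
  qed
  have "free_action A (elem_sym m j) = (\<Sum>D\<in>?D. word (map \<sigma> (sorted_word (block m D))))"
  proof -
    have "free_action A (\<Sum>D\<in>S. f D) = (\<Sum>D\<in>S. free_action A (f D))"
      for S :: "'n set set" and f
      by (induction S rule: infinite_finite_induct)
        (simp_all only: sum.infinite sum.empty sum.insert free_action_linear not_False_eq_True)
    then show ?thesis unfolding elem_sym_def by (simp only: act)
  qed
  moreover have "elem_sym m j = (\<Sum>D\<in>?D. word (sorted_word (block m (\<sigma> ` D))))"
    unfolding elem_sym_def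
  proof (rule sum.reindex_bij_betw[symmetric])
    have inj: "inj_on (\<lambda>D. \<sigma> ` D) ?D"
      using inj_image_eq_iff[OF bij_is_inj[OF A(2)]] by (simp add: inj_on_def)
    have "(\<lambda>D. \<sigma> ` D) ` ?D \<subseteq> ?D"
      using card_image[OF inj_on_subset[OF bij_is_inj[OF A(2)] subset_UNIV]] by auto
    moreover have "?D \<subseteq> (\<lambda>D. \<sigma> ` D) ` ?D"
    proof
      fix E assume E: "E \<in> ?D"
      have "E = \<sigma> ` (\<sigma> -` E)" using A(2) by (simp add: bij_is_surj surj_image_vimage_eq)
      moreover have "card (\<sigma> -` E) = j"
        using E A(2) by (simp add: card_vimage_inj bij_is_inj bij_is_surj)
      ultimately show "E \<in> (\<lambda>D. \<sigma> ` D) ` ?D" by blast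
    qed
    ultimately show "bij_betw (\<lambda>D. \<sigma> ` D) ?D ?D" using inj by (simp add: bij_betw_def)
  qed
  ultimately have "free_action A (elem_sym m j) - elem_sym m j =
      (\<Sum>D\<in>?D. word (map \<sigma> (sorted_word (block m D))) - word (sorted_word (block m (\<sigma> ` D))))"
    by (simp only: sum_subtractf)
  also have "\<dots> \<in> skew_ideal"
    by (rule funs.subspace_sum[OF subspace_skew_ideal]) (use perm in \<open>simp add: skeq_def\<close>)
  finally show "free_action A (elem_sym m j) - elem_sym m j \<in> skew_ideal" .
qed

text \<open>A matrix \<open>A\<close> acts on the product of all variables by \<open>det A\<close>, and \<open>det A ^ (m div p) = 1\<close> for
all \<open>A\<close> in the group.\<close>

lemma power_letters_invariant:
  assumes m: "m > 0" and p: "p dvd m"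
  shows "word (concat (replicate (m div p) letters)) \<in> (invariant_generators m p :: ('n::finite list \<Rightarrow> complex) set)"
    (is "word ?\<theta> \<in> _")
  unfolding invariant_generators_def
proof (intro CollectI conjI ballI)
  have q: "m div p > 0"
    using assms dvd_imp_le[OF p m] dvd_pos_nat[OF m p] by (simp add: div_greater_zero_iff)
  have "length ?\<theta> = (m div p) * CARD('n)" by (simp add: length_concat length_letters sum_list_replicate)
  then have "length ?\<theta> > 0" using q by (simp add: card_gt_0_iff)
  then show "\<exists>d>0. \<forall>w. word ?\<theta> w \<noteq> 0 \<longrightarrow> length w = d"
    by (intro exI[of _ "length ?\<theta>"]) (auto simp: word_apply)
next
  fix A assume "A \<in> carrier (mystic_group m p :: (complex^'n^'n) monoid)"
  then obtain \<sigma> c where A: "A = mono_mat \<sigma> c" "bij \<sigma>"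
      "(of_int (sign \<sigma>) * prod c UNIV) ^ (m div p) = 1"
    using mystic_group_iff[OF m] by blast
  let ?C = "prod c UNIV ^ (m div p)" and ?s = "of_int (sign \<sigma>) ^ (m div p) :: complex"
  have "prod_list (map c (concat (replicate k letters))) = prod c UNIV ^ k" for k
    by (induction k) (simp_all add: prod_list_letters)
  moreover have "map \<sigma> (concat (replicate k letters)) = concat (replicate k (map \<sigma> letters))" for k
    by (induction k) simp_all
  ultimately have act: "free_action A (word ?\<theta>) =
      scale ?C (word (concat (replicate (m div p) (map \<sigma> letters))))"
    unfolding A(1) free_action_word by simp
  have "skeq ?s (concat (replicate (m div p) (map \<sigma> letters))) ?\<theta>"
    using A(2) by (intro skeq_concat_replicate skeq_sign letters)
  then have "scale ?C (word (concat (replicate (m div p) (map \<sigma> letters))) - scale ?s (word ?\<theta>)) \<in> skew_ideal"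
    unfolding skeq_def by (rule funs.subspace_scale[OF subspace_skew_ideal])
  also have "scale ?C (word (concat (replicate (m div p) (map \<sigma> letters))) - scale ?s (word ?\<theta>)) =
      free_action A (word ?\<theta>) - word ?\<theta>"
  proof -
    have "?C * ?s = 1" using A(3) by (simp add: power_mult_distrib mult.commute)
    then have "scale ?C (scale ?s (word ?\<theta>)) = word ?\<theta>"
      by (auto simp: fun_eq_iff mult.assoc[symmetric])
    then show ?thesis unfolding act funs.scale_right_diff_distrib by simp
  qed
  finally show "free_action A (word ?\<theta>) - word ?\<theta> \<in> skew_ideal" .
qed simp

section \<open>The coinvariant algebra is not too large\<close>

text \<open>Count the pairs of a vector and an index with small entry: for each index, its own entry has \<open>q\<close>
values and the others have \<open>m\<close>.\<close>

lemma sum_card_small_entries: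
  assumes "q \<le> m"
  shows "(\<Sum>c\<in>UNIV \<rightarrow>\<^sub>E {..<m}. card {i :: 'n::finite. c i < q}) = CARD('n) * (q * m ^ (CARD('n) - 1))"
proof -
  let ?C = "(UNIV :: 'n set) \<rightarrow>\<^sub>E {..<m}"
  have fin: "finite ?C" by (intro finite_PiE) auto
  have "(\<Sum>c\<in>?C. card {i :: 'n. c i < q}) = (\<Sum>c\<in>?C. \<Sum>i\<in>UNIV. if c i < q then 1 else 0)"
    by (simp add: sum.If_cases)
  also have "\<dots> = (\<Sum>i\<in>UNIV. \<Sum>c\<in>?C. if c i < q then 1 else 0)"
    by (rule sum.swap)
  also have "\<dots> = (\<Sum>i\<in>(UNIV :: 'n set). q * m ^ (CARD('n) - 1))"
  proof (rule sum.cong)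
    fix i :: 'n
    have "(\<Sum>c\<in>?C. if c i < q then 1 else 0) = card {c \<in> ?C. c i < q}"
      using fin by (simp add: sum.If_cases Int_def)
    also have "{c \<in> ?C. c i < q} = PiE UNIV (\<lambda>j. if j = i then {..<q} else {..<m})"
      using assms by (auto simp: PiE_iff split: if_splits intro: order_less_le_trans)
    also have "card \<dots> = (\<Prod>j\<in>UNIV. if j = i then q else m)"
      by (subst card_PiE) (auto intro!: prod.cong)
    also have "\<dots> = q * (\<Prod>j\<in>UNIV - {i}. m)"
      by (subst prod.remove[of _ i]) auto
    finally show "(\<Sum>c\<in>?C. if c i < q then 1 else 0) = q * m ^ (CARD('n) - 1)"
      by (simp add: card_Diff_subset)
  qed simp
  finally show ?thesis by simp
qed

text \<open>The monomials with exponents \<open>c + m b\<close> are multiples of \<open>x\<^sup>c\<close> by monomials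
in the central elements \<open>x\<^sub>i\<^sup>m\<close>. Multiplying by \<open>x\<^sub>i\<^sup>m\<close> for all \<open>i\<close> with \<open>c i < m div p\<close> makes every
exponent at least \<open>m div p\<close>, so the result is a multiple of the invariant \<open>(x\<^sub>1 \<cdots> x\<^sub>n)\<^sup>m\<^sup>/\<^sup>p\<close>.\<close>

lemma coinvariant_residue_span:
  fixes N :: "('n::finite list \<Rightarrow> complex) set"
  assumes m: "m > 0" "even m" and p: "p dvd m"
    and N: "ideal N free_algebra" "skew_ideal \<subseteq> N" "invariant_generators m p \<subseteq> N"
  shows "\<exists>G. finite G \<and> G \<subseteq> range word \<and> card G \<le> card {i. c i < m div p} * fact (CARD('n) - 1) \<and>
    (\<forall>b. word (sorted_word (\<lambda>i. c i + m * b i)) \<in> funs.span (G \<union> N))"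
proof -
  let ?q = "m div p"
  let ?M = "\<lambda>b. word (sorted_word (\<lambda>i. c i + m * b i))"
  have sub: "funs.subspace N" by (rule ideal_free_subspace[OF N(1)])
  have mult: "f \<star> g \<in> N" if "g \<in> N" "f \<in> F" for f g
    using ideal.I_l_closed[OF N(1)] that by blast
  have eq: "word v \<in> N" if "skeq s u v" "s * s = 1" "word u \<in> N" for u v s
  proof -
    have "word v - scale s (word u) \<in> N"
      using skeq_sym[OF that(1,2)] N(2) unfolding skeq_def by blast
    from funs.subspace_add[OF sub this funs.subspace_scale[OF sub that(3), of s]] show ?thesis by simp
  qed
  have "\<exists>G. finite G \<and> G \<subseteq> range ?M \<and> card G \<le> card {i. c i < ?q} * fact (card (UNIV :: 'n set) - 1) \<and>
    (\<forall>b. (\<forall>i. i \<notin> UNIV \<longrightarrow> b i = 0) \<longrightarrow> ?M b \<in> funs.span (G \<union> N))"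
  proof (rule funs.coinvariant_span_product)
    fix j :: nat and b :: "'n \<Rightarrow> nat" assume j: "1 \<le> j"
    let ?a = "\<lambda>i. c i + m * b i"
    let ?D = "{D :: 'n set. D \<subseteq> UNIV \<and> card D = j}"
    have bump: "(\<lambda>i. c i + m * bump D b i) = (\<lambda>i. ?a i + block m D i)" for D
      by (auto simp: bump_def block_def algebra_simps)
    have "skeq 1 (sorted_word (\<lambda>i. ?a i + block m D i)) (sorted_word ?a @ sorted_word (block m D))" for D
      unfolding sorted_word_def replicate_add by (rule skeq_concat_split) (rule skeq_block[OF m(2)])
    then have "?M (bump D b) - word (sorted_word ?a) \<star> word (sorted_word (block m D)) \<in> N" for D
      using N(2) unfolding bump skeq_def word_mult by auto
    then have 1: "(\<Sum>D\<in>?D. ?M (bump D b) - word (sorted_word ?a) \<star> word (sorted_word (block m D))) \<in> N"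
      by (intro funs.subspace_sum[OF sub])
    have 2: "word (sorted_word ?a) \<star> elem_sym m j \<in> N"
      using elem_sym_invariant[OF m j] N(3) by (intro mult word_closed) blast
    have "(\<Sum>D\<in>?D. ?M (bump D b)) = (\<Sum>D\<in>?D. ?M (bump D b) - word (sorted_word ?a) \<star> word (sorted_word (block m D))) +
        word (sorted_word ?a) \<star> elem_sym m j"
      unfolding elem_sym_def free_mult_sum sum_subtractf by simp
    then show "(\<Sum>D\<in>?D. ?M (bump D b)) \<in> N"
      using funs.subspace_add[OF sub 1 2] by (simp only:)
  next
    fix b :: "'n \<Rightarrow> nat"
    let ?K = "{i. c i < ?q}"
    let ?a = "\<lambda>i. c i + m * bump ?K b i"
    let ?\<theta> = "concat (replicate ?q (letters :: 'n list))"
    have le: "?q \<le> ?a i" for i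
      by (cases "c i < ?q") (auto simp: bump_def intro: order_trans[OF div_le_dividend] trans_le_add2)
    have "count (mset (concat (replicate k (letters :: 'n list)))) i = k" for k i
    proof -
      have "count (mset (letters :: 'n list)) i = 1"
        using distinct_count_atmost_1[of "letters :: 'n list"] by simp
      then show ?thesis by (induction k) simp_all
    qed
    then have "mset (sorted_word (\<lambda>i. ?a i - ?q) @ ?\<theta>) = mset (sorted_word ?a)"
      using le by (intro multiset_eqI) (simp add: count_sorted_word)
    then obtain s where s: "s * s = 1" "skeq s (sorted_word (\<lambda>i. ?a i - ?q) @ ?\<theta>) (sorted_word ?a)"
      using skeq_perm by blast
    have "word (sorted_word (\<lambda>i. ?a i - ?q)) \<star> word ?\<theta> \<in> N"
      using power_letters_invariant[OF m(1) p] N(3) by (intro mult word_closed) blast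
    then show "?M (bump ?K b) \<in> N"
      using eq[OF s(2,1)] by (simp add: word_mult)
  qed (use sub in auto)
  moreover have "range ?M \<subseteq> range word" by auto
  ultimately show ?thesis by (elim exE) (auto intro!: exI)
qed

lemma coinvariant_span_bound:
  fixes N :: "('n::finite list \<Rightarrow> complex) set"
  assumes m: "m > 0" "even m" and p: "p dvd m"
    and N: "ideal N free_algebra" "skew_ideal \<subseteq> N" "invariant_generators m p \<subseteq> N"
  shows "\<exists>G. finite G \<and> G \<subseteq> range word \<and> card G \<le> fact CARD('n) * ((m div p) * m ^ (CARD('n) - 1)) \<and>
    F \<subseteq> funs.span (G \<union> N)"
proof -
  let ?q = "m div p"
  let ?C = "(UNIV :: 'n set) \<rightarrow>\<^sub>E {..<m}"
  have "\<forall>c. \<exists>G. finite G \<and> G \<subseteq> range word \<and> card G \<le> card {i. c i < ?q} * fact (CARD('n) - 1) \<and>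
      (\<forall>b. word (sorted_word (\<lambda>i. c i + m * b i)) \<in> funs.span (G \<union> N))"
    by (intro allI coinvariant_residue_span[OF assms])
  from choice[OF this] obtain G where
    all: "\<forall>c. finite (G c) \<and> G c \<subseteq> range word \<and> card (G c) \<le> card {i. c i < ?q} * fact (CARD('n) - 1) \<and>
      (\<forall>b. word (sorted_word (\<lambda>i. c i + m * b i)) \<in> funs.span (G c \<union> N))" ..
  then have G: "finite (G c)" "G c \<subseteq> range word" "card (G c) \<le> card {i. c i < ?q} * fact (CARD('n) - 1)"
    "word (sorted_word (\<lambda>i. c i + m * b i)) \<in> funs.span (G c \<union> N)" for c b
    by simp_all
  have fin: "finite ?C" by (intro finite_PiE) auto
  let ?G = "\<Union>c\<in>?C. G c"
  have w: "word w \<in> funs.span (?G \<union> N)" for w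
  proof -
    let ?c = "\<lambda>i. count (mset w) i mod m" and ?b = "\<lambda>i. count (mset w) i div m"
    have c: "?c \<in> ?C" using m by auto
    have "mset w = mset (sorted_word (\<lambda>i. ?c i + m * ?b i))"
      by (intro multiset_eqI) (simp add: count_sorted_word)
    then obtain s where "skeq s w (sorted_word (\<lambda>i. ?c i + m * ?b i))" using skeq_perm by blast
    then have "word w - scale s (word (sorted_word (\<lambda>i. ?c i + m * ?b i))) \<in> funs.span (?G \<union> N)"
      using N(2) unfolding skeq_def by (intro funs.span_base) blast
    moreover have "word (sorted_word (\<lambda>i. ?c i + m * ?b i)) \<in> funs.span (?G \<union> N)"
      by (rule subsetD[OF funs.span_mono G(4)]) (use c in blast)
    ultimately show ?thesis
      using funs.span_add[OF _ funs.span_scale] by (metis (no_types, lifting) diff_add_cancel)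
  qed
  have "F \<subseteq> funs.span (?G \<union> N)"
  proof
    fix f :: "'n list \<Rightarrow> complex" assume f: "f \<in> F"
    show "f \<in> funs.span (?G \<union> N)"
      by (subst free_expand[OF f]) (intro funs.span_sum funs.span_scale w)
  qed
  moreover have "card ?G \<le> fact CARD('n) * (?q * m ^ (CARD('n) - 1))"
  proof -
    have "card ?G \<le> (\<Sum>c\<in>?C. card (G c))" by (rule card_UN_le[OF fin])
    also have "\<dots> \<le> (\<Sum>c\<in>?C. card {i. c i < ?q} * fact (CARD('n) - 1))"
      by (intro sum_mono G(3))
    also have "\<dots> = CARD('n) * (?q * m ^ (CARD('n) - 1)) * fact (CARD('n) - 1)"
      unfolding sum_distrib_right[symmetric] by (subst sum_card_small_entries) auto
    also have "\<dots> = fact CARD('n) * (?q * m ^ (CARD('n) - 1))"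
      by (subst fact_reduce[of "CARD('n)"]) (auto simp: card_gt_0_iff algebra_simps)
    finally show ?thesis .
  qed
  ultimately show ?thesis using fin G(1,2) by (intro exI[of _ ?G] conjI UN_least) auto
qed

section \<open>The order of the group\<close>

lemma mono_mat_eq_iff:
  assumes "\<And>j. c j \<noteq> 0"
  shows "mono_mat \<sigma> c = mono_mat \<tau> d \<longleftrightarrow> \<sigma> = \<tau> \<and> c = d"
proof
  assume eq: "mono_mat \<sigma> c = mono_mat \<tau> d"
  have "\<sigma> j = \<tau> j \<and> c j = d j" for j
    using arg_cong[OF eq, of "\<lambda>A. A $ \<sigma> j $ j"] assms[of j] by (auto split: if_splits)
  then show "\<sigma> = \<tau> \<and> c = d" by auto
qed simp

lemma finite_mystic_group:
  assumes "m > 0"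
  shows "finite (carrier (mystic_group m p :: (complex^'n::finite^'n) monoid))"
proof (rule finite_subset)
  let ?R = "(UNIV :: 'n set) \<rightarrow>\<^sub>E {z :: complex. z ^ m = 1}"
  show "carrier (mystic_group m p) \<subseteq> (\<lambda>(\<sigma>, c). mono_mat \<sigma> c) ` (UNIV \<times> ?R)"
    using mystic_group_iff[OF assms] by (auto simp: image_iff PiE_iff) blast
  have "finite {z :: complex. z ^ m = 1}" using assms by (intro finite_roots_unity) simp
  then show "finite ((\<lambda>(\<sigma>, c). mono_mat \<sigma> c) ` ((UNIV :: ('n \<Rightarrow> 'n) set) \<times> ?R))"
    by (intro finite_imageI finite_cartesian_product finite_PiE) auto
qed

text \<open>The permutation and all entries but one may be chosen freely; the last entry is then determined
by the value of the determinant, which ranges over the \<open>m div p\<close>-th roots of unity. That last entry is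
an \<open>m\<close>-th root of unity because the sign is one, \<open>m\<close> being even.\<close>

lemma card_mystic_group:
  assumes m: "m > 0" "even m" and p: "p dvd m"
  shows "fact CARD('n) * ((m div p) * m ^ (CARD('n) - 1)) \<le>
    card (carrier (mystic_group m p :: (complex^'n::finite^'n) monoid))"
proof -
  let ?q = "m div p"
  let ?S = "{\<sigma> :: 'n \<Rightarrow> 'n. bij \<sigma>}" and ?Z = "{z :: complex. z ^ ?q = 1}"
  let ?R = "{z :: complex. z ^ m = 1}"
  define l0 where "l0 = (undefined :: 'n)"
  let ?P = "(UNIV - {l0}) \<rightarrow>\<^sub>E ?R"
  \<comment> \<open>The entry that makes the determinant equal to \<open>z\<close>.\<close>
  define last where "last \<sigma> c z = z / (of_int (sign \<sigma>) * (\<Prod>i\<in>UNIV - {l0}. c i))"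
    for \<sigma> :: "'n \<Rightarrow> 'n" and c :: "'n \<Rightarrow> complex" and z
  define \<Phi> where "\<Phi> = (\<lambda>(\<sigma>, c, z). mono_mat \<sigma> (c(l0 := last \<sigma> c z)))"
  have q: "?q > 0" "?q dvd m"
    using dvd_imp_le[OF p m(1)] dvd_pos_nat[OF m(1) p] p by (auto simp: div_greater_zero_iff)
  have nz: "z \<noteq> 0" if "z ^ k = 1" "k > 0" for z :: complex and k
    using that by (metis power_0_left zero_neq_one not_gr0)
  have sgn: "of_int (sign \<sigma>) ^ m = (1 :: complex)" "of_int (sign \<sigma>) \<noteq> (0 :: complex)" for \<sigma> :: "'n \<Rightarrow> 'n"
    using m by (auto simp: sign_def)
  have prod: "(\<Prod>i\<in>UNIV - {l0}. c i) ^ m = 1" "(\<Prod>i\<in>UNIV - {l0}. c i) \<noteq> 0" if "c \<in> ?P" for c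
  proof -
    show "(\<Prod>i\<in>UNIV - {l0}. c i) ^ m = 1"
      unfolding prod_power_distrib using that by (intro prod.neutral) (auto simp: PiE_iff)
    then show "(\<Prod>i\<in>UNIV - {l0}. c i) \<noteq> 0" using nz m by blast
  qed
  have last: "last \<sigma> c z ^ m = 1" if "c \<in> ?P" "z \<in> ?Z" for \<sigma> c z
  proof -
    obtain k where k: "m = ?q * k" using q(2) by (rule dvdE)
    have "z ^ (?q * k) = 1" using that(2) by (simp only: power_mult mem_Collect_eq power_one)
    then have "z ^ m = 1" by (simp only: k[symmetric])
    then show ?thesis unfolding last_def using prod(1)[OF that(1)] sgn(1)
      by (simp add: power_divide power_mult_distrib)
  qed
  have upd: "prod (c(l0 := y)) UNIV = y * (\<Prod>i\<in>UNIV - {l0}. c i)" for c :: "'n \<Rightarrow> complex" and y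
  proof -
    have "prod (c(l0 := y)) UNIV = (c(l0 := y)) l0 * prod (c(l0 := y)) (UNIV - {l0})"
      by (rule prod.remove) auto
    also have "prod (c(l0 := y)) (UNIV - {l0}) = (\<Prod>i\<in>UNIV - {l0}. c i)"
      by (rule prod.cong) auto
    finally show ?thesis by simp
  qed
  have "\<Phi> ` (?S \<times> ?P \<times> ?Z) \<subseteq> carrier (mystic_group m p)"
  proof
    fix A assume "A \<in> \<Phi> ` (?S \<times> ?P \<times> ?Z)"
    then obtain \<sigma> c z where A: "A = mono_mat \<sigma> (c(l0 := last \<sigma> c z))"
      and *: "bij \<sigma>" "c \<in> ?P" "z ^ ?q = 1"
      by (auto simp: \<Phi>_def simp del: PiE_iff)
    have "\<forall>j. (c(l0 := last \<sigma> c z)) j ^ m = 1"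
      using last[of c z \<sigma>] * by (auto simp: PiE_iff)
    moreover have "of_int (sign \<sigma>) * prod (c(l0 := last \<sigma> c z)) UNIV = z"
      unfolding upd last_def using prod(2)[OF *(2)] sgn(2)[of \<sigma>] by (simp add: field_simps)
    then have "(of_int (sign \<sigma>) * prod (c(l0 := last \<sigma> c z)) UNIV) ^ ?q = 1"
      using *(3) by (simp only:)
    ultimately show "A \<in> carrier (mystic_group m p)"
      unfolding mystic_group_iff[OF m(1)] using A *(1) by blast
  qed
  moreover have "inj_on \<Phi> (?S \<times> ?P \<times> ?Z)"
  proof (rule inj_onI)
    fix g h assume gh: "g \<in> ?S \<times> ?P \<times> ?Z" "h \<in> ?S \<times> ?P \<times> ?Z" "\<Phi> g = \<Phi> h"
    obtain \<sigma> c z where g: "g = (\<sigma>, c, z)" by (cases g)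
    obtain \<tau> d y where h: "h = (\<tau>, d, y)" by (cases h)
    have *: "c \<in> ?P" "d \<in> ?P" "z ^ ?q = 1" "y ^ ?q = 1" "\<Phi> (\<sigma>, c, z) = \<Phi> (\<tau>, d, y)"
      using gh unfolding g h by blast+
    have ne: "(c(l0 := last \<sigma> c z)) j \<noteq> 0" for j
    proof -
      have "(c(l0 := last \<sigma> c z)) j ^ m = 1"
        using last[of c z \<sigma>] * by (auto simp: PiE_iff)
      then show ?thesis by (rule nz) (rule m(1))
    qed
    from *(5) have "mono_mat \<sigma> (c(l0 := last \<sigma> c z)) = mono_mat \<tau> (d(l0 := last \<tau> d y))"
      by (simp only: \<Phi>_def prod.case)
    then have both: "\<sigma> = \<tau> \<and> c(l0 := last \<sigma> c z) = d(l0 := last \<tau> d y)"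
      by (rule mono_mat_eq_iff[where c = "c(l0 := last \<sigma> c z)", OF ne, THEN iffD1])
    note eq = conjunct1[OF both] conjunct2[OF both]
    have "c i = d i" for i
    proof (cases "i = l0")
      case True
      then show ?thesis using *(1,2) by (auto simp: PiE_def extensional_def)
    next
      case False
      then show ?thesis using fun_cong[OF eq(2), of i] by simp
    qed
    then have cd: "c = d" by (rule ext)
    have "last \<sigma> c z = last \<sigma> c y" using fun_cong[OF eq(2), of l0] eq(1) cd by simp
    then have "z = y" unfolding last_def using prod(2)[OF *(1)] sgn(2)[of \<sigma>] by simp
    then show "g = h" unfolding g h using eq(1) cd by simp
  qed
  ultimately have "card (?S \<times> ?P \<times> ?Z) \<le> card (carrier (mystic_group m p :: (complex^'n^'n) monoid))"
    using card_inj_on_le finite_mystic_group[OF m(1)] by blast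
  moreover have "card (?S \<times> ?P \<times> ?Z) = fact CARD('n) * (?q * m ^ (CARD('n) - 1))"
  proof -
    have "?S = {\<sigma>. \<sigma> permutes UNIV}" by (auto intro: bij_imp_permutes permutes_bij)
    then have "card ?S = fact CARD('n)" by (simp add: card_permutations)
    moreover have "card ?P = m ^ (CARD('n) - 1)"
      using m by (subst card_PiE) (simp_all add: card_roots_unity_eq card_Diff_subset)
    moreover have "card ?Z = ?q" using q by (simp add: card_roots_unity_eq)
    ultimately show ?thesis by (simp add: card_cartesian_product)
  qed
  ultimately show ?thesis by simp
qed

section \<open>Functions on a finite group\<close>

lemma (in group) regular_action_apply:
  assumes "g \<in> carrier G"
  shows "regular_action G g f x = (if x \<in> carrier G then f (inv g \<otimes> x) else 0)"
proof -
  have "{y. y \<in> carrier G \<and> (if y = g then 1 else 0 :: complex) \<noteq> 0} = {g}"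
    using assms by auto
  then show ?thesis
    unfolding regular_action_def group_algebra_def by simp
qed

lemma (in group) regular_action_linear:
  assumes "g \<in> carrier G"
  shows "regular_action G g (f + h) = regular_action G g f + regular_action G g h"
    and "regular_action G g (scale c f) = scale c (regular_action G g f)"
    and "regular_action G g (\<Sum>i\<in>I. H i) = (\<Sum>i\<in>I. regular_action G g (H i))"
  by (auto simp: fun_eq_iff regular_action_apply[OF assms])

lemma (in group) regular_action_compose:
  assumes "g \<in> carrier G" "h \<in> carrier G"
  shows "regular_action G g (regular_action G h f) = regular_action G (g \<otimes> h) f"
  using assms by (auto simp: fun_eq_iff regular_action_apply inv_mult_group m_assoc)

lemma (in group) regular_action_one:
  assumes "\<And>x. x \<notin> carrier G \<Longrightarrow> f x = 0"
  shows "regular_action G \<one> f = f"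
  using assms by (auto simp: fun_eq_iff regular_action_apply)

lemma linear_scale_iff:
  "Vector_Spaces.linear scale scale P \<longleftrightarrow>
    (\<forall>x y. P (x + y) = P x + P y) \<and> (\<forall>c x. P (scale c x) = scale c (P x))"
  by (simp add: Vector_Spaces.linear_iff funs.vector_space_axioms)

lemma projection_exists:
  assumes "funs.subspace U"
  shows "\<exists>P. Vector_Spaces.linear scale scale P \<and> range P \<subseteq> U \<and> (\<forall>h\<in>U. P h = h)"
proof -
  interpret fp: vector_space_pair scale scale ..
  have "Vector_Spaces.linear scale scale (\<lambda>x. x)" unfolding linear_scale_iff by simp
  from fp.linear_exists_left_inverse_on[OF this assms] show ?thesis by (auto simp: inj_on_def)
qed

text \<open>Maschke's theorem: average a linear projection over the group.\<close>

lemma (in group) equivariant_projection_exists: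
  fixes U :: "('a \<Rightarrow> complex) set"
  assumes fin: "finite (carrier G)" and U: "funs.subspace U"
    and supp: "\<And>h x. h \<in> U \<Longrightarrow> x \<notin> carrier G \<Longrightarrow> h x = 0"
    and stable: "\<And>g h. g \<in> carrier G \<Longrightarrow> h \<in> U \<Longrightarrow> regular_action G g h \<in> U"
  shows "\<exists>P. Vector_Spaces.linear scale scale P \<and> range P \<subseteq> U \<and> (\<forall>h\<in>U. P h = h) \<and>
    (\<forall>g\<in>carrier G. \<forall>h. P (regular_action G g h) = regular_action G g (P h))"
proof -
  let ?L = "regular_action G" and ?n = "of_nat (card (carrier G)) :: complex"
  obtain P0 where P0: "Vector_Spaces.linear scale scale P0" "range P0 \<subseteq> U" "\<And>h. h \<in> U \<Longrightarrow> P0 h = h"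
    using projection_exists[OF U] by blast
  have n: "?n \<noteq> 0" using fin by (simp add: card_gt_0_iff) auto
  define P where "P h = scale (1 / ?n) (\<Sum>g\<in>carrier G. ?L g (P0 (?L (inv g) h)))" for h
  have "Vector_Spaces.linear scale scale P"
    using P0(1) unfolding linear_scale_iff P_def
    by (simp add: regular_action_linear sum.distrib funs.scale_right_distrib funs.scale_sum_right mult.commute)
  moreover have "range P \<subseteq> U"
    unfolding P_def using P0(2)
    by (auto intro!: funs.subspace_scale[OF U] funs.subspace_sum[OF U] stable)
  moreover have "P h = h" if h: "h \<in> U" for h
  proof -
    have "?L g (P0 (?L (inv g) h)) = h" if "g \<in> carrier G" for g
      using that h supp[OF h] stable[of "inv g" h]
      by (simp add: P0(3) regular_action_compose regular_action_one)
    then have "P h = scale (1 / ?n) (\<Sum>g\<in>carrier G. h)"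
      unfolding P_def by (simp cong: sum.cong)
    also have "\<dots> = h"
      using n by (auto simp: fun_eq_iff)
    finally show ?thesis .
  qed
  moreover have "P (?L k h) = ?L k (P h)" if k: "k \<in> carrier G" for k h
  proof -
    have "?L k (P h) = scale (1 / ?n) (\<Sum>g\<in>carrier G. ?L (k \<otimes> g) (P0 (?L (inv g) h)))"
      unfolding P_def using k by (simp add: regular_action_linear regular_action_compose cong: sum.cong)
    also have "(\<Sum>g\<in>carrier G. ?L (k \<otimes> g) (P0 (?L (inv g) h))) =
        (\<Sum>g\<in>carrier G. ?L (k \<otimes> g) (P0 (?L (inv (k \<otimes> g)) (?L k h))))"
      using k by (intro sum.cong refl) (simp add: regular_action_compose inv_mult_group m_assoc)
    also have "\<dots> = (\<Sum>g\<in>carrier G. ?L g (P0 (?L (inv g) (?L k h))))"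
    proof (rule sum.reindex_bij_betw)
      show "bij_betw (\<lambda>g. k \<otimes> g) (carrier G) (carrier G)"
        using k by (intro bij_betwI[of _ _ _ "\<lambda>g. inv k \<otimes> g"]) (auto simp: m_assoc[symmetric])
    qed
    finally show ?thesis unfolding P_def by (rule sym)
  qed
  ultimately show ?thesis by blast
qed

text \<open>Lagrange interpolation: multiplication by functions that separate points produces the
  restriction to a fibre.\<close>

lemma restrict_to_fibre:
  fixes V :: "('x \<Rightarrow> complex) set" and y :: "'i \<Rightarrow> 'x \<Rightarrow> complex"
  assumes S: "finite S" and V: "funs.subspace V"
    and mult: "\<And>h i. h \<in> V \<Longrightarrow> (\<lambda>x. y i x * h x) \<in> V"
    and h: "h \<in> V" and supp: "\<And>x. x \<notin> S \<Longrightarrow> h x = 0"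
  shows "(\<lambda>x. if \<forall>i. y i x = y i x0 then h x else 0) \<in> V"
proof -
  have "\<exists>h'\<in>V. (\<forall>x. (\<forall>i. y i x = y i x0) \<longrightarrow> h' x = h x) \<and>
      (\<forall>x\<in>Z. (\<exists>i. y i x \<noteq> y i x0) \<longrightarrow> h' x = 0) \<and> (\<forall>x. x \<notin> S \<longrightarrow> h' x = 0)" if "finite Z" for Z
    using that
  proof (induction Z)
    case empty
    then show ?case using h supp by blast
  next
    case (insert z Z)
    then obtain h' where h': "h' \<in> V" "\<And>x. (\<forall>i. y i x = y i x0) \<Longrightarrow> h' x = h x"
      "\<And>x i. x \<in> Z \<Longrightarrow> y i x \<noteq> y i x0 \<Longrightarrow> h' x = 0" "\<And>x. x \<notin> S \<Longrightarrow> h' x = 0"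
      by blast
    show ?case
    proof (cases "\<forall>i. y i z = y i x0")
      case True
      then show ?thesis using h' by blast
    next
      case False
      then obtain i where i: "y i z \<noteq> y i x0" by blast
      \<comment> \<open>The Lagrange factor \<open>(y i x - y i z) / (y i x0 - y i z)\<close> is \<open>1\<close> on the fibre and \<open>0\<close> at \<open>z\<close>.\<close>
      let ?h = "scale (1 / (y i x0 - y i z)) ((\<lambda>x. y i x * h' x) - scale (y i z) h')"
      have val: "?h x = (y i x - y i z) / (y i x0 - y i z) * h' x" for x
        by (simp add: algebra_simps diff_divide_distrib)
      show ?thesis
      proof (intro bexI[of _ ?h] conjI allI impI ballI)
        show "?h \<in> V"
          by (intro funs.subspace_scale[OF V] funs.subspace_diff[OF V] mult h'(1))
      next
        fix x assume "\<forall>i. y i x = y i x0"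
        then show "?h x = h x" unfolding val using h'(2) i by simp
      next
        fix x assume x: "x \<in> insert z Z" and "\<exists>i. y i x \<noteq> y i x0"
        then obtain j where j: "y j x \<noteq> y j x0" by blast
        show "?h x = 0"
        proof (cases "x = z")
          case True
          then show ?thesis unfolding val by simp
        next
          case False
          then show ?thesis unfolding val using x h'(3)[OF _ j] by simp
        qed
      next
        fix x assume "x \<notin> S"
        then show "?h x = 0" unfolding val using h'(4) by simp
      qed
    qed
  qed
  from this[OF S] obtain h' where h': "h' \<in> V" "\<And>x. (\<forall>i. y i x = y i x0) \<Longrightarrow> h' x = h x"
      "\<And>x i. x \<in> S \<Longrightarrow> y i x \<noteq> y i x0 \<Longrightarrow> h' x = 0" "\<And>x. x \<notin> S \<Longrightarrow> h' x = 0"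
    by blast
  have "(\<lambda>x. if \<forall>i. y i x = y i x0 then h x else 0) = h'"
  proof
    fix x
    show "(if \<forall>i. y i x = y i x0 then h x else 0) = h' x"
      using h'(2)[of x] h'(3)[of x] h'(4)[of x] by (cases "x \<in> S") auto
  qed
  then show ?thesis using h'(1) by simp
qed

definition delta :: "'x \<Rightarrow> 'x \<Rightarrow> complex"
  where "delta x = (\<lambda>y. if y = x then 1 else 0)"

lemma independent_delta: "funs.independent (delta ` S)"
  unfolding funs.dependent_def
proof
  assume "\<exists>a\<in>delta ` S. a \<in> funs.span (delta ` S - {a})"
  then obtain x where x: "delta x \<in> funs.span (delta ` S - {delta x})" by blast
  have "funs.subspace {f :: 'a \<Rightarrow> complex. f x = 0}" by (simp add: funs.subspace_def)
  moreover have "delta ` S - {delta x} \<subseteq> {f. f x = 0}" by (auto simp: delta_def)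
  ultimately have "delta x \<in> {f. f x = 0}" using x funs.span_minimal by blast
  then show False by (simp add: delta_def)
qed

text \<open>The quotient of \<open>E\<close> by \<open>N\<close> has dimension at most \<open>card S\<close> and maps onto a space of dimension at
least \<open>card S\<close>, so the map is injective on it. A non-trivial relation between the images of \<open>G\<close> would
make one generator superfluous and leave too few to span the delta functions.\<close>

lemma kernel_eq_by_dimension:
  fixes T :: "('a \<Rightarrow> complex) \<Rightarrow> 'x \<Rightarrow> complex"
  assumes E: "funs.subspace E"
    and T: "\<And>f g. f \<in> E \<Longrightarrow> g \<in> E \<Longrightarrow> T (f + g) = T f + T g" "\<And>c f. f \<in> E \<Longrightarrow> T (scale c f) = scale c (T f)"
    and N: "funs.subspace N" "N \<subseteq> E" "\<And>f. f \<in> N \<Longrightarrow> T f = 0"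
    and G: "finite G" "G \<subseteq> E" "E \<subseteq> funs.span (G \<union> N)" "card G \<le> card S"
    and S: "finite S" "delta ` S \<subseteq> funs.span (T ` E)"
    and f: "f \<in> E" "T f = 0"
  shows "f \<in> N"
proof -
  have decomp: "\<exists>u n. n \<in> N \<and> h = (\<Sum>g\<in>G. scale (u g) g) + n \<and> T h = (\<Sum>g\<in>G. scale (u g) (T g))"
    if h: "h \<in> E" for h
  proof -
    have spanN: "funs.span N = N" using N(1) by (simp add: funs.span_eq_iff)
    have "h \<in> {x + y |x y. x \<in> funs.span G \<and> y \<in> funs.span N}"
      using h G(3) funs.span_Un by blast
    then obtain u n where un: "n \<in> N" "h = (\<Sum>g\<in>G. scale (u g) g) + n"
      unfolding funs.span_finite[OF G(1)] spanN by blast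
    have sumT: "(\<Sum>g\<in>H. scale (u g) g) \<in> E \<and> T (\<Sum>g\<in>H. scale (u g) g) = (\<Sum>g\<in>H. scale (u g) (T g))"
      if "H \<subseteq> G" for H
      using finite_subset[OF that G(1)] that
    proof (induction H)
      case empty
      show ?case
        unfolding sum.empty using funs.subspace_0[OF E] N(3)[OF funs.subspace_0[OF N(1)]] by (rule conjI)
    next
      case (insert g H)
      then have g: "g \<in> E" using G(2) by blast
      have "H \<subseteq> G" using insert.prems by blast
      note IH = conjunct1[OF insert.IH[OF this]] conjunct2[OF insert.IH[OF this]]
      have sg: "scale (u g) g \<in> E" by (rule funs.subspace_scale[OF E g])
      show ?case unfolding sum.insert[OF insert.hyps]
        by (simp only: T(1)[OF sg IH(1)] T(2)[OF g] IH(2) funs.subspace_add[OF E sg IH(1)])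
    qed
    have "T h = (\<Sum>g\<in>G. scale (u g) (T g))"
      unfolding un(2) using T(1)[OF conjunct1[OF sumT[OF subset_refl]], of n] N(2) N(3)[OF un(1)] un(1)
        conjunct2[OF sumT[OF subset_refl]] by auto
    then show ?thesis using un by blast
  qed
  obtain u n where un: "n \<in> N" "f = (\<Sum>g\<in>G. scale (u g) g) + n" "T f = (\<Sum>g\<in>G. scale (u g) (T g))"
    using decomp[OF f(1)] by blast
  have "u g0 = 0" if g0: "g0 \<in> G" for g0
  proof (rule ccontr)
    assume u0: "u g0 \<noteq> 0"
    let ?G = "T ` (G - {g0})"
    have rest: "(\<Sum>g\<in>G - {g0}. scale (v g) (T g)) \<in> funs.span ?G" for v
      by (intro funs.span_sum funs.span_scale funs.span_base) auto
    have split: "(\<Sum>g\<in>G. scale (v g) (T g)) = scale (v g0) (T g0) + (\<Sum>g\<in>G - {g0}. scale (v g) (T g))" for v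
      by (rule sum.remove[OF G(1) g0])
    have "scale (u g0) (T g0) = - (\<Sum>g\<in>G - {g0}. scale (u g) (T g))"
      using un(3) f(2) unfolding split by (simp add: eq_neg_iff_add_eq_0)
    then have "scale (u g0) (T g0) \<in> funs.span ?G"
      using funs.span_neg[OF rest] by metis
    then have "scale (1 / u g0) (scale (u g0) (T g0)) \<in> funs.span ?G"
      by (rule funs.span_scale)
    then have T0: "T g0 \<in> funs.span ?G" using u0 by simp
    have "T ` E \<subseteq> funs.span ?G"
    proof
      fix k assume "k \<in> T ` E"
      then obtain h where h: "h \<in> E" "k = T h" by blast
      then obtain v where "k = (\<Sum>g\<in>G. scale (v g) (T g))" using decomp by blast
      then show "k \<in> funs.span ?G"
        unfolding split by (simp only:) (intro funs.span_add funs.span_scale T0 rest)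
    qed
    then have "funs.span (T ` E) \<subseteq> funs.span ?G"
      by (rule funs.span_minimal[OF _ funs.subspace_span])
    then have sub: "delta ` S \<subseteq> funs.span ?G" using S(2) by (rule order_trans[rotated])
    have "finite ?G" using G(1) by simp
    from funs.independent_span_bound[OF this independent_delta sub]
    have "card (delta ` S) \<le> card ?G" by (rule conjunct2)
    moreover have "card (delta ` S) = card S"
    proof (rule card_image, rule inj_onI)
      fix x y assume "delta x = (delta y :: 'x \<Rightarrow> complex)"
      from fun_cong[OF this, of x] show "x = y" by (simp add: delta_def split: if_splits)
    qed
    moreover have "card ?G \<le> card (G - {g0})" using G(1) by (intro card_image_le) simp
    moreover have "card (G - {g0}) < card G" using G(1) g0 by (intro psubset_card_mono) auto
    ultimately show False using G(4) by simp
  qed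
  then have "(\<Sum>g\<in>G. scale (u g) g) = 0" by (intro sum.neutral ballI) simp
  then have "f = n" using un(2) by (simp only: add_0_left)
  then show ?thesis using un(1) by (simp only:)
qed

section \<open>From words to functions on the group\<close>

locale mystic =
  fixes m p :: nat and W :: "(complex^'n::finite^'n) monoid" (structure)
  assumes m: "m > 0" "even m" and p: "p dvd m" and W: "W = mystic_group m p"
begin

sublocale group W
  unfolding W by (rule group_mystic_group[OF m(1)])

lemma finite_W: "finite (carrier W)"
  unfolding W by (rule finite_mystic_group[OF m(1)])

lemma W_form: "A \<in> carrier W \<Longrightarrow> \<exists>\<sigma> c. A = mono_mat \<sigma> c \<and> bij \<sigma> \<and> (\<forall>j. c j ^ m = 1)"
  unfolding W mystic_group_iff[OF m(1)] by blast

text \<open>A word \<open>w\<close> will give the function with value \<open>\<lambda> (A\<^sup>-\<^sup>1 w)\<close> at \<open>A\<close>, hence it is the inverse whose permutation and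
entries are recorded.\<close>

definition inv_perm :: "complex^'n^'n \<Rightarrow> 'n \<Rightarrow> 'n"
  where "inv_perm A = (SOME \<sigma>. \<exists>c. inv A = mono_mat \<sigma> c \<and> bij \<sigma> \<and> (\<forall>j. c j ^ m = 1))"

definition inv_coef :: "complex^'n^'n \<Rightarrow> 'n \<Rightarrow> complex"
  where "inv_coef A = (SOME c. inv A = mono_mat (inv_perm A) c \<and> bij (inv_perm A) \<and> (\<forall>j. c j ^ m = 1))"

lemma inv_form:
  assumes "A \<in> carrier W"
  shows "inv A = mono_mat (inv_perm A) (inv_coef A)" "bij (inv_perm A)" "inv_coef A j ^ m = 1"
proof -
  have "\<exists>\<sigma> c. inv A = mono_mat \<sigma> c \<and> bij \<sigma> \<and> (\<forall>j. c j ^ m = 1)"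
    using W_form[of "inv A"] assms by simp
  then have "\<exists>c. inv A = mono_mat (inv_perm A) c \<and> bij (inv_perm A) \<and> (\<forall>j. c j ^ m = 1)"
    unfolding inv_perm_def by (rule someI_ex)
  then have "inv A = mono_mat (inv_perm A) (inv_coef A) \<and> bij (inv_perm A) \<and> (\<forall>j. inv_coef A j ^ m = 1)"
    unfolding inv_coef_def by (rule someI_ex)
  then show "inv A = mono_mat (inv_perm A) (inv_coef A)" "bij (inv_perm A)" "inv_coef A j ^ m = 1" by auto
qed

definition orbit_fun :: "'n list \<Rightarrow> complex^'n^'n \<Rightarrow> complex"
  where "orbit_fun w A = (if A \<in> carrier W then lift_words twisted_eval (free_action (inv A) (word w)) else 0)"

lemma orbit_fun_eq:
  "A \<in> carrier W \<Longrightarrow> orbit_fun w A = prod_list (map (inv_coef A) w) * twisted_eval (map (inv_perm A) w)"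
  by (simp add: orbit_fun_def inv_form(1) free_action_word lift_words_scale)

lemma orbit_fun_outside: "A \<notin> carrier W \<Longrightarrow> orbit_fun w A = 0"
  by (simp add: orbit_fun_def)

lemma orbit_fun_swap:
  assumes "i \<noteq> j"
  shows "orbit_fun (u @ [i, j] @ v) A = - orbit_fun (u @ [j, i] @ v) A"
proof (cases "A \<in> carrier W")
  case True
  have "inv_perm A i \<noteq> inv_perm A j" using inv_form(2)[OF True] assms by (simp add: bij_is_inj inj_eq)
  from twisted_eval_swap[OF this, of "map (inv_perm A) u" "map (inv_perm A) v"] show ?thesis
    using True by (simp add: orbit_fun_eq)
qed (simp add: orbit_fun_outside)

lemma lift_orbit_fun:
  assumes A: "A \<in> carrier W" and f: "f \<in> F"
  shows "lift_words (\<lambda>w. orbit_fun w A) f = lift_words twisted_eval (free_action (inv A) f)"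
proof (rule free_induct[where P = "\<lambda>f. lift_words (\<lambda>w. orbit_fun w A) f = lift_words twisted_eval (free_action (inv A) f)", OF f])
  fix c w f
  assume f: "f \<in> F"
    and IH: "lift_words (\<lambda>w. orbit_fun w A) f = lift_words twisted_eval (free_action (inv A) f)"
  have cl: "free_action (inv A) g \<in> F" if "g \<in> F" for g
    unfolding inv_form(1)[OF A] by (rule free_action_closed[OF that])
  have "orbit_fun w A = lift_words twisted_eval (free_action (inv A) (word w))"
    using A by (simp add: orbit_fun_def)
  then show "lift_words (\<lambda>w. orbit_fun w A) (scale c (word w) + f) =
      lift_words twisted_eval (free_action (inv A) (scale c (word w) + f))"
    by (simp only: free_action_linear lift_words_scale lift_words_word IH
        lift_words_add[OF free_closed(3)[OF word_closed word_closed] f]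
        lift_words_add[OF free_closed(3)[OF cl[OF word_closed] word_closed] cl[OF f]])
qed (simp only: free_action_linear lift_words_zero)

lemma sign_flip_in_W:
  assumes "i \<noteq> j"
  shows "sign_flip i j \<in> carrier W"
proof -
  let ?c = "\<lambda>k. if k = i \<or> k = j then - 1 else 1 :: complex"
  have "prod ?c UNIV = ?c i * (?c j * prod ?c (UNIV - {i} - {j}))"
    using assms by (simp add: prod.remove[of UNIV i] prod.remove[of "UNIV - {i}" j])
  also have "prod ?c (UNIV - {i} - {j}) = 1" by (rule prod.neutral) auto
  finally have "prod ?c UNIV = 1" by simp
  moreover have "\<forall>k. ?c k ^ m = 1" using m(2) by simp
  ultimately show ?thesis
    unfolding W mystic_group_iff[OF m(1)] sign_flip_def
    by (intro exI[of _ id] exI[of _ ?c]) simp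
qed

text \<open>The constant must not depend on \<open>A\<close>: invariance allows \<open>f\<close> to be replaced by its translate, and the
constant of \<open>f\<close> only involves the length of \<open>v\<close>, which the action preserves.\<close>

lemma orbit_fun_invariant:
  assumes f: "f \<in> invariant_generators m p"
  shows "\<exists>c. \<forall>A u v. lift_words (\<lambda>w. orbit_fun w A) (word u \<star> f \<star> word v) = c (length v) * orbit_fun (u @ v) A"
proof -
  have fc: "f \<in> F" using f by (simp add: invariant_generators_def)
  have inv: "free_action A f - f \<in> skew_ideal" if "A \<in> carrier W" for A
    using f that unfolding invariant_generators_def W by blast
  obtain c where c: "\<And>u v. lift_words twisted_eval (word u \<star> f \<star> word v) = c (length v) * twisted_eval (u @ v)"
    using twisted_eval_invariant[OF fc] inv sign_flip_in_W by blast
  have "lift_words (\<lambda>w. orbit_fun w A) (word u \<star> f \<star> word v) = c (length v) * orbit_fun (u @ v) A" for A u v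
  proof (cases "A \<in> carrier W")
    case False
    then show ?thesis by (simp add: orbit_fun_outside lift_words_def)
  next
    case True
    let ?a = "free_action (inv A)"
    let ?u = "map (inv_perm A) u" and ?v = "map (inv_perm A) v"
    note form = inv_form(1)[OF True]
    have k: "?a f - f \<in> skew_ideal" using True by (intro inv) simp
    have af: "?a f \<in> F" unfolding form by (rule free_action_closed[OF fc])
    have "?a (word u \<star> f \<star> word v) = ?a (word u) \<star> ?a f \<star> ?a (word v)"
      unfolding form
      by (simp only: free_action_mult[OF free_mult_closed[OF word_closed fc] word_closed] free_action_mult[OF word_closed fc])
    also have "\<dots> = scale (prod_list (map (inv_coef A) u) * prod_list (map (inv_coef A) v)) (word ?u \<star> ?a f \<star> word ?v)"
      unfolding form free_action_word by (simp only: free_mult_linear funs.scale_scale mult.commute)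
    also have "word ?u \<star> ?a f \<star> word ?v = word ?u \<star> (?a f - f) \<star> word ?v + word ?u \<star> f \<star> word ?v"
      by (simp only: free_mult_diff diff_add_cancel)
    finally have "lift_words twisted_eval (?a (word u \<star> f \<star> word v)) =
        prod_list (map (inv_coef A) u) * prod_list (map (inv_coef A) v) *
        (lift_words twisted_eval (word ?u \<star> (?a f - f) \<star> word ?v) + lift_words twisted_eval (word ?u \<star> f \<star> word ?v))"
      by (simp only: lift_words_scale lift_words_add[OF free_mult_closed[OF free_mult_closed[OF word_closed skew_ideal_closed[OF k]] word_closed]
          free_mult_closed[OF free_mult_closed[OF word_closed fc] word_closed]])
    also have "\<dots> = c (length v) * orbit_fun (u @ v) A"
      using True by (simp add: lift_twisted_eval_skew_ideal[OF k] c orbit_fun_eq)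
    finally show ?thesis
      using lift_orbit_fun[OF True free_mult_closed[OF free_mult_closed[OF word_closed fc] word_closed]] by simp
  qed
  then show ?thesis by blast
qed

lemma orbit_fun_even_power:
  assumes A: "A \<in> carrier W"
  shows "orbit_fun (replicate m i @ w) A = twisted_eval (replicate m (inv_perm A i)) * orbit_fun w A"
proof -
  let ?z = "replicate m (inv_perm A i)"
  have "count_list (replicate k a) j = (if a = j then k else 0)" for k and a j :: 'n
    by (induction k) auto
  then have count: "even (count_list ?z j)" for j using m(2) by simp
  then have "balanced ?z" by (simp add: balanced_def)
  from twisted_eval_balanced[OF this, of "[]" "map (inv_perm A) w"]
  have "twisted_eval (?z @ map (inv_perm A) w) = twisted_eval ?z * twisted_eval (map (inv_perm A) w)"
    using count by (simp add: central_sign_def)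
  moreover have "prod_list (map (inv_coef A) (replicate m i)) = 1"
    using inv_form(3)[OF A] by (simp add: prod_list_replicate)
  ultimately show ?thesis using A by (simp add: orbit_fun_eq)
qed

text \<open>The absolute value of \<open>\<lambda> (x\<^sub>i\<^sup>m)\<close> is the \<open>m\<close>-th power of the weight of \<open>i\<close>, and the weights are
positive and distinct.\<close>

lemma inv_perm_eqI:
  assumes A: "A \<in> carrier W" and B: "B \<in> carrier W"
    and eq: "\<And>i. twisted_eval (replicate m (inv_perm A i)) = twisted_eval (replicate m (inv_perm B i))"
  shows "inv_perm A = inv_perm B"
proof
  fix i
  have "real (Suc (rank (inv_perm A i))) ^ m = real (Suc (rank (inv_perm B i))) ^ m"
    using arg_cong[OF eq[of i], of cmod] unfolding norm_twisted_eval by (simp add: prod_list_replicate)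
  then have "real (Suc (rank (inv_perm A i))) = real (Suc (rank (inv_perm B i)))"
    by (rule power_eq_imp_eq_base) (use m(1) in auto)
  then have "rank (inv_perm A i) = rank (inv_perm B i)" by simp
  then show "inv_perm A i = inv_perm B i" by (rule injD[OF inj_rank])
qed

lemma span_mult_closed:
  fixes y :: "'x \<Rightarrow> complex"
  assumes "\<And>h. h \<in> B \<Longrightarrow> (\<lambda>x. y x * h x) \<in> funs.span B" and h: "h \<in> funs.span B"
  shows "(\<lambda>x. y x * h x) \<in> funs.span B"
proof -
  let ?S = "{h. (\<lambda>x. y x * h x) \<in> funs.span B}"
  have add: "(\<lambda>x. y x * (f + g) x) = (\<lambda>x. y x * f x) + (\<lambda>x. y x * g x)" for f g :: "'x \<Rightarrow> complex"
    by (rule ext) (simp only: plus_fun_apply distrib_left)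
  have scale: "(\<lambda>x. y x * scale c f x) = scale c (\<lambda>x. y x * f x)" for f :: "'x \<Rightarrow> complex" and c
    by (rule ext) (simp only: scale_apply mult.left_commute)
  have zero: "(\<lambda>x. y x * (0 :: 'x \<Rightarrow> complex) x) = 0"
    by (rule ext) (simp only: zero_fun_apply mult_zero_right)
  have "funs.subspace ?S"
  proof (rule funs.subspaceI)
    show "0 \<in> ?S" unfolding mem_Collect_eq by (subst zero) (rule funs.span_zero)
    show "f + g \<in> ?S" if "f \<in> ?S" "g \<in> ?S" for f g
      unfolding mem_Collect_eq by (subst add) (use that in \<open>blast intro: funs.span_add\<close>)
    show "scale c f \<in> ?S" if "f \<in> ?S" for c f
      unfolding mem_Collect_eq by (subst scale) (use that in \<open>blast intro: funs.span_scale\<close>)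
  qed
  then have "funs.span B \<subseteq> ?S"
    by (intro funs.span_minimal) (use assms(1) in auto)
  then show ?thesis using h by blast
qed

text \<open>The span is stable under multiplication by the functions \<open>A \<mapsto> \<lambda> (x\<^sub>\<sigma>\<^sub>(\<^sub>i\<^sub>)\<^sup>m)\<close>, where \<open>\<sigma>\<close> is the
permutation of \<open>A\<^sup>-\<^sup>1\<close>. Interpolation therefore cuts \<open>orbit_fun w\<close> down to a single permutation,
where, up to a non-zero scalar, it is a product of matrix entries. Products of entries are stable under
multiplication by entries, so a second interpolation isolates one matrix.\<close>

lemma delta_in_span:
  assumes A0: "A0 \<in> carrier W"
  shows "delta A0 \<in> funs.span (range orbit_fun)"
proof -
  let ?U = "funs.span (range orbit_fun)"
  let ?same = "\<lambda>A. A \<in> carrier W \<and> inv_perm A = inv_perm A0"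
  define e where "e w = (\<lambda>A. if ?same A then prod_list (map (inv_coef A) w) else 0)" for w
  let ?y = "\<lambda>i A. twisted_eval (replicate m (inv_perm A i))"
  have y: "(\<lambda>A. ?y i A * h A) \<in> ?U" if "h \<in> ?U" for i h
  proof (rule span_mult_closed[OF _ that])
    fix h assume "h \<in> range orbit_fun"
    then obtain w where w: "h = orbit_fun w" by blast
    have "(\<lambda>A. ?y i A * h A) = orbit_fun (replicate m i @ w)"
    proof
      fix A
      show "?y i A * h A = orbit_fun (replicate m i @ w) A"
        unfolding w by (cases "A \<in> carrier W") (simp_all add: orbit_fun_even_power orbit_fun_outside)
    qed
    then show "(\<lambda>A. ?y i A * h A) \<in> ?U" by (simp only:) (rule funs.span_base, blast)
  qed
  have e_in: "e w \<in> ?U" for w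
  proof -
    have "(\<lambda>A. if \<forall>i. ?y i A = ?y i A0 then orbit_fun w A else 0) \<in> ?U"
      by (rule restrict_to_fibre[OF finite_W funs.subspace_span y])
        (auto intro: funs.span_base orbit_fun_outside)
    then have "scale (1 / twisted_eval (map (inv_perm A0) w)) (\<lambda>A. if \<forall>i. ?y i A = ?y i A0 then orbit_fun w A else 0) \<in> ?U"
      by (rule funs.span_scale)
    also have "scale (1 / twisted_eval (map (inv_perm A0) w)) (\<lambda>A. if \<forall>i. ?y i A = ?y i A0 then orbit_fun w A else 0) = e w"
    proof
      fix A
      show "scale (1 / twisted_eval (map (inv_perm A0) w)) (\<lambda>A. if \<forall>i. ?y i A = ?y i A0 then orbit_fun w A else 0) A = e w A"
      proof (cases "?same A")
        case True
        then show ?thesis using twisted_eval_nonzero[of "map (inv_perm A0) w"] by (simp add: e_def orbit_fun_eq)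
      next
        case False
        then have "A \<notin> carrier W \<or> \<not> (\<forall>i. ?y i A = ?y i A0)" using inv_perm_eqI[OF _ A0] by blast
        then show ?thesis using False by (auto simp: e_def orbit_fun_outside)
      qed
    qed
    finally show ?thesis .
  qed
  have c: "(\<lambda>A. inv_coef A i * h A) \<in> funs.span (range e)" if "h \<in> funs.span (range e)" for i h
  proof (rule span_mult_closed[OF _ that])
    fix h assume "h \<in> range e"
    then obtain w where w: "h = e w" by blast
    have "(\<lambda>A. inv_coef A i * h A) = e (i # w)" unfolding w by (auto simp: e_def fun_eq_iff)
    then show "(\<lambda>A. inv_coef A i * h A) \<in> funs.span (range e)" by (simp only:) (rule funs.span_base, blast)
  qed
  have "(\<lambda>A. if \<forall>i. inv_coef A i = inv_coef A0 i then e [] A else 0) \<in> funs.span (range e)"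
    by (rule restrict_to_fibre[OF finite_W funs.subspace_span c])
      (auto intro: funs.span_base simp: e_def)
  also have "(\<lambda>A. if \<forall>i. inv_coef A i = inv_coef A0 i then e [] A else 0) = delta A0"
  proof
    fix A
    have "A = A0" if "?same A" "\<forall>i. inv_coef A i = inv_coef A0 i"
    proof -
      have "inv A = inv A0"
        using that inv_form(1)[of A] inv_form(1)[OF A0] by (simp add: fun_eq_iff[symmetric] ext)
      then show ?thesis using that(1) A0 by (metis inv_inv)
    qed
    then show "(if \<forall>i. inv_coef A i = inv_coef A0 i then e [] A else 0) = delta A0 A"
      using A0 by (auto simp: e_def delta_def)
  qed
  also have "funs.span (range e) \<subseteq> ?U"
    by (rule funs.span_minimal) (use e_in funs.subspace_span in auto)
  finally show ?thesis .
qed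

text \<open>Equivariance: \<open>(B\<^sup>-\<^sup>1 A)\<^sup>-\<^sup>1 w = A\<^sup>-\<^sup>1 (B w)\<close>.\<close>

lemma orbit_fun_translate:
  assumes B: "B = mono_mat \<sigma> c" "B \<in> carrier W"
  shows "regular_action W B (orbit_fun w) = scale (prod_list (map c w)) (orbit_fun (map \<sigma> w))"
proof
  fix A
  show "regular_action W B (orbit_fun w) A = scale (prod_list (map c w)) (orbit_fun (map \<sigma> w)) A"
  proof (cases "A \<in> carrier W")
    case True
    have "inv (inv B \<otimes> A) = inv A \<otimes> B" using True B(2) by (simp add: inv_mult_group)
    also have "\<dots> = mono_mat (inv_perm A) (inv_coef A) ** mono_mat \<sigma> c"
      using inv_form(1)[OF True] B(1) by (simp add: W)
    finally have "free_action (inv (inv B \<otimes> A)) (word w) = free_action (inv A) (free_action B (word w))"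
      unfolding B(1) inv_form(1)[OF True] by (simp only: free_action_compose[OF word_closed])
    also have "\<dots> = scale (prod_list (map c w)) (free_action (inv A) (word (map \<sigma> w)))"
      unfolding B(1) by (simp only: free_action_word free_action_linear)
    finally show ?thesis
      using True B(2) by (simp add: regular_action_apply orbit_fun_def lift_words_scale)
  qed (use B(2) in \<open>simp add: regular_action_apply orbit_fun_outside\<close>)
qed

definition filtration :: "nat \<Rightarrow> (complex^'n^'n \<Rightarrow> complex) set"
  where "filtration d = funs.span (orbit_fun ` {w. length w < d})"

lemma filtration_supported:
  assumes "h \<in> filtration d" "A \<notin> carrier W"
  shows "h A = 0"
proof -
  have "filtration d \<subseteq> {h. h A = 0}"
    unfolding filtration_def
    by (rule funs.span_minimal) (use assms(2) in \<open>auto simp: orbit_fun_outside funs.subspace_def\<close>)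
  then show ?thesis using assms(1) by blast
qed

lemma filtration_stable:
  assumes B: "B \<in> carrier W" and h: "h \<in> filtration d"
  shows "regular_action W B h \<in> filtration d"
proof -
  obtain \<sigma> c where form: "B = mono_mat \<sigma> c" using W_form[OF B] by blast
  have "funs.subspace {h. regular_action W B h \<in> filtration d}"
    unfolding funs.subspace_def mem_Collect_eq filtration_def
  proof (intro conjI ballI allI)
    have "regular_action W B 0 = 0" using regular_action_linear(2)[OF B, of 0] by simp
    then show "regular_action W B 0 \<in> funs.span (orbit_fun ` {w. length w < d})"
      by (simp only: funs.span_zero)
  qed (simp_all only: mem_Collect_eq regular_action_linear[OF B] funs.span_add funs.span_scale)
  moreover have "orbit_fun ` {w. length w < d} \<subseteq> {h. regular_action W B h \<in> filtration d}"
  proof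
    fix h assume "h \<in> orbit_fun ` {w. length w < d}"
    then obtain w where w: "h = orbit_fun w" "length w < d" by blast
    then have "orbit_fun (map \<sigma> w) \<in> filtration d"
      unfolding filtration_def by (intro funs.span_base) auto
    then have "scale (prod_list (map c w)) (orbit_fun (map \<sigma> w)) \<in> filtration d"
      unfolding filtration_def by (rule funs.span_scale)
    then show "h \<in> {h. regular_action W B h \<in> filtration d}"
      unfolding w(1) mem_Collect_eq orbit_fun_translate[OF form B] .
  qed
  ultimately have "filtration d \<subseteq> {h. regular_action W B h \<in> filtration d}"
    unfolding filtration_def[of d] using funs.span_minimal by blast
  then show ?thesis using h by blast
qed

definition filtration_proj :: "nat \<Rightarrow> (complex^'n^'n \<Rightarrow> complex) \<Rightarrow> complex^'n^'n \<Rightarrow> complex"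
  where "filtration_proj d = (SOME P. Vector_Spaces.linear scale scale P \<and> range P \<subseteq> filtration d \<and>
    (\<forall>h\<in>filtration d. P h = h) \<and>
    (\<forall>B\<in>carrier W. \<forall>h. P (regular_action W B h) = regular_action W B (P h)))"

lemma filtration_proj:
  shows filtration_proj_linear: "Vector_Spaces.linear scale scale (filtration_proj d)"
    and filtration_proj_range: "filtration_proj d h \<in> filtration d"
    and filtration_proj_fixed: "h \<in> filtration d \<Longrightarrow> filtration_proj d h = h"
    and filtration_proj_equivariant: "B \<in> carrier W \<Longrightarrow> filtration_proj d (regular_action W B h) = regular_action W B (filtration_proj d h)"
proof -
  have "\<exists>P. Vector_Spaces.linear scale scale P \<and> range P \<subseteq> filtration d \<and>
      (\<forall>h\<in>filtration d. P h = h) \<and>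
      (\<forall>B\<in>carrier W. \<forall>h. P (regular_action W B h) = regular_action W B (P h))"
    by (rule equivariant_projection_exists[OF finite_W])
      (use filtration_supported filtration_stable in \<open>auto simp: filtration_def\<close>)
  from someI_ex[OF this, folded filtration_proj_def]
  show "Vector_Spaces.linear scale scale (filtration_proj d)" "filtration_proj d h \<in> filtration d"
    "h \<in> filtration d \<Longrightarrow> filtration_proj d h = h"
    "B \<in> carrier W \<Longrightarrow> filtration_proj d (regular_action W B h) = regular_action W B (filtration_proj d h)"
    by blast+
qed

text \<open>The leading part of \<open>orbit_fun w\<close> with respect to the filtration by the length of words.\<close>

definition graded_fun :: "'n list \<Rightarrow> complex^'n^'n \<Rightarrow> complex"
  where "graded_fun w = orbit_fun w - filtration_proj (length w) (orbit_fun w)"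

definition graded_map :: "('n list \<Rightarrow> complex) \<Rightarrow> complex^'n^'n \<Rightarrow> complex"
  where "graded_map f = (\<lambda>A. lift_words (\<lambda>w. graded_fun w A) f)"

lemma graded_fun_outside: "A \<notin> carrier W \<Longrightarrow> graded_fun w A = 0"
  using filtration_supported[OF filtration_proj_range] by (simp add: graded_fun_def orbit_fun_outside)

lemma graded_map_outside: "A \<notin> carrier W \<Longrightarrow> graded_map f A = 0"
  by (simp add: graded_map_def lift_words_def graded_fun_outside)

lemma graded_map_linear:
  "f \<in> F \<Longrightarrow> g \<in> F \<Longrightarrow> graded_map (f + g) = graded_map f + graded_map g"
  "graded_map (scale c f) = scale c (graded_map f)"
  "graded_map (word w) = graded_fun w"
  "graded_map 0 = 0"
  unfolding graded_map_def
  by (rule ext, subst plus_fun_apply, rule lift_words_add, assumption, assumption)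
    (rule ext, subst scale_apply, rule lift_words_scale,
      rule ext, rule lift_words_word,
      rule ext, subst zero_fun_apply, rule lift_words_zero)

lemma graded_map_equivariant:
  assumes B: "B \<in> carrier W" and f: "f \<in> F"
  shows "graded_map (free_action B f) = regular_action W B (graded_map f)"
proof -
  obtain \<sigma> c where form: "B = mono_mat \<sigma> c" using W_form[OF B] by blast
  have w: "graded_map (free_action B (word w)) = regular_action W B (graded_fun w)" for w
  proof -
    interpret L: Vector_Spaces.linear scale scale "filtration_proj (length w)" by (rule filtration_proj_linear)
    have diff: "regular_action W B (h - k) = regular_action W B h - regular_action W B k" for h k
      by (auto simp: fun_eq_iff regular_action_apply[OF B])
    have "regular_action W B (graded_fun w) =
        regular_action W B (orbit_fun w) - filtration_proj (length w) (regular_action W B (orbit_fun w))"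
      unfolding graded_fun_def diff by (simp only: filtration_proj_equivariant[OF B])
    also have "\<dots> = scale (prod_list (map c w)) (graded_fun (map \<sigma> w))"
      unfolding orbit_fun_translate[OF form B] graded_fun_def L.scale
      by (simp only: funs.scale_right_diff_distrib length_map)
    finally show ?thesis
      unfolding form by (simp only: free_action_word graded_map_linear)
  qed
  have zero: "regular_action W B 0 = 0" using regular_action_linear(2)[OF B, of 0] by simp
  show ?thesis
  proof (rule free_induct[where P = "\<lambda>f. graded_map (free_action B f) = regular_action W B (graded_map f)", OF f])
    fix a w f
    assume f: "f \<in> F"
      and IH: "graded_map (free_action B f) = regular_action W B (graded_map f)"
    have cl: "free_action B g \<in> F" if "g \<in> F" for g
      unfolding form by (rule free_action_closed[OF that])
    show "graded_map (free_action B (scale a (word w) + f)) = regular_action W B (graded_map (scale a (word w) + f))"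
      by (simp only: free_action_linear graded_map_linear(2,3) w IH regular_action_linear[OF B]
          graded_map_linear(1)[OF free_closed(3)[OF cl[OF word_closed] word_closed] cl[OF f]]
          graded_map_linear(1)[OF free_closed(3)[OF word_closed word_closed] f])
  qed (simp only: free_action_linear graded_map_linear zero)
qed

lemma graded_fun_kills_relations:
  assumes "i \<noteq> j"
  shows "lift_words (\<lambda>w. graded_fun w A) (word u \<star> (word [i, j] + word [j, i]) \<star> word v) = 0"
proof -
  let ?D = "length (u @ [i, j] @ v)"
  interpret L: Vector_Spaces.linear scale scale "filtration_proj ?D" by (rule filtration_proj_linear)
  have swap: "orbit_fun (u @ [i, j] @ v) = - orbit_fun (u @ [j, i] @ v)"
    by (rule ext, subst uminus_fun_apply, rule orbit_fun_swap[OF assms])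
  have len: "length (u @ [j, i] @ v) = ?D" by simp
  have "graded_fun (u @ [i, j] @ v) = - orbit_fun (u @ [j, i] @ v) - filtration_proj ?D (- orbit_fun (u @ [j, i] @ v))"
    by (simp only: graded_fun_def swap)
  also have "\<dots> = - graded_fun (u @ [j, i] @ v)"
    by (simp only: L.neg graded_fun_def len minus_diff_minus)
  finally have "graded_fun (u @ [i, j] @ v) = - graded_fun (u @ [j, i] @ v)" .
  from fun_cong[OF this, of A] show ?thesis
    unfolding free_mult_linear word_mult lift_words_add[OF word_closed word_closed] lift_words_word by simp
qed

text \<open>All words in \<open>u f v\<close> have the same length, so the same projection is applied to each. The image of
\<open>u f v\<close> under \<open>orbit_fun\<close> is a multiple of that of \<open>u v\<close>, which is shorter as \<open>f\<close> has positive degree;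
hence the projection fixes it.\<close>

lemma graded_fun_kills_invariants:
  assumes f: "f \<in> invariant_generators m p"
  shows "lift_words (\<lambda>w. graded_fun w A) (word u \<star> f \<star> word v) = 0"
proof -
  obtain d where fc: "f \<in> F" and d: "d > 0" "\<And>w. f w \<noteq> 0 \<Longrightarrow> length w = d"
    using f unfolding invariant_generators_def by blast
  obtain c where c: "\<And>A u v. lift_words (\<lambda>w. orbit_fun w A) (word u \<star> f \<star> word v) = c (length v) * orbit_fun (u @ v) A"
    using orbit_fun_invariant[OF f] by blast
  let ?D = "length u + d + length v"
  let ?s = "\<Sum>w | f w \<noteq> 0. scale (f w) (orbit_fun (u @ w @ v))"
  interpret L: Vector_Spaces.linear scale scale "filtration_proj ?D" by (rule filtration_proj_linear)
  have "?s = scale (c (length v)) (orbit_fun (u @ v))"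
    using c[of _ u v] unfolding lift_words_sandwich[OF fc] by (simp add: fun_eq_iff)
  moreover have "orbit_fun (u @ v) \<in> filtration ?D"
    unfolding filtration_def using d(1) by (intro funs.span_base) auto
  ultimately have "?s \<in> filtration ?D"
    unfolding filtration_def by (simp only: funs.span_scale)
  then have "filtration_proj ?D ?s = ?s" by (rule filtration_proj_fixed)
  moreover have "filtration_proj ?D ?s = (\<Sum>w | f w \<noteq> 0. scale (f w) (filtration_proj ?D (orbit_fun (u @ w @ v))))"
    by (simp only: L.sum L.scale)
  ultimately have eq: "(\<Sum>w | f w \<noteq> 0. scale (f w) (filtration_proj ?D (orbit_fun (u @ w @ v)))) = ?s" by simp
  have "(\<Sum>w | f w \<noteq> 0. f w * graded_fun (u @ w @ v) A) =
      (\<Sum>w | f w \<noteq> 0. f w * orbit_fun (u @ w @ v) A - f w * filtration_proj ?D (orbit_fun (u @ w @ v)) A)"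
  proof (rule sum.cong)
    fix w assume "w \<in> {w. f w \<noteq> 0}"
    then have len: "length (u @ w @ v) = ?D" using d(2) by simp
    show "f w * graded_fun (u @ w @ v) A = f w * orbit_fun (u @ w @ v) A - f w * filtration_proj ?D (orbit_fun (u @ w @ v)) A"
      by (simp only: graded_fun_def len minus_fun_apply right_diff_distrib)
  qed simp
  also have "\<dots> = 0"
    using fun_cong[OF eq, of A] by (simp add: sum_subtractf)
  finally show ?thesis unfolding lift_words_sandwich[OF fc] .
qed

lemma graded_fun_span: "orbit_fun w \<in> funs.span (range graded_fun)"
proof (induction "length w" arbitrary: w rule: less_induct)
  case less
  have "filtration_proj (length w) (orbit_fun w) \<in> filtration (length w)" by (rule filtration_proj_range)
  moreover have "filtration (length w) \<subseteq> funs.span (range graded_fun)"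
    unfolding filtration_def by (rule funs.span_minimal) (use less funs.subspace_span in auto)
  ultimately have "graded_fun w + filtration_proj (length w) (orbit_fun w) \<in> funs.span (range graded_fun)"
    by (intro funs.span_add) (auto intro: funs.span_base)
  then show ?case by (simp add: graded_fun_def)
qed

lemma subspace_graded_map_image: "funs.subspace (graded_map ` F)"
proof (rule funs.subspaceI)
  let ?T = "graded_map ` carrier (free_algebra :: (complex, 'n list \<Rightarrow> complex) module)"
  show "0 \<in> ?T" using graded_map_linear(4) funs.subspace_0[OF subspace_free] by (metis imageI)
  fix h assume "h \<in> ?T"
  then obtain f where f: "h = graded_map f" "f \<in> F" by blast
  show "scale c h \<in> ?T" for c
    unfolding f(1) graded_map_linear(2)[symmetric] by (rule imageI[OF free_closed(3)[OF f(2,2)]])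
  fix k assume "k \<in> ?T"
  then obtain g where g: "k = graded_map g" "g \<in> F" by blast
  show "h + k \<in> ?T"
    unfolding f(1) g(1) graded_map_linear(1)[OF f(2) g(2), symmetric]
    by (rule imageI[OF free_closed(1)[OF f(2) g(2)]])
qed

lemma delta_in_graded_map_image:
  assumes A: "A \<in> carrier W"
  shows "delta A \<in> graded_map ` F"
proof -
  let ?T = "graded_map ` carrier (free_algebra :: (complex, 'n list \<Rightarrow> complex) module)"
  have "graded_fun w \<in> ?T" for w
    unfolding graded_map_linear(3)[symmetric] by (rule imageI[OF word_closed])
  then have "funs.span (range graded_fun) \<subseteq> ?T"
    by (intro funs.span_minimal subspace_graded_map_image) blast
  moreover have "funs.span (range orbit_fun) \<subseteq> funs.span (range graded_fun)"
    using graded_fun_span by (intro funs.span_minimal funs.subspace_span) blast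
  ultimately show ?thesis using delta_in_span[OF A] by blast
qed

lemma graded_map_surj:
  assumes h: "\<And>A. A \<notin> carrier W \<Longrightarrow> h A = 0"
  shows "\<exists>f\<in>F. graded_map f = h"
proof -
  let ?T = "graded_map ` carrier (free_algebra :: (complex, 'n list \<Rightarrow> complex) module)"
  note sub = subspace_graded_map_image
  have "h = (\<Sum>A\<in>carrier W. scale (h A) (delta A))"
  proof
    fix B
    have "(\<Sum>A\<in>carrier W. scale (h A) (delta A)) B = (\<Sum>A\<in>carrier W. if B = A then h A else 0)"
      unfolding sum_fun_apply by (rule sum.cong) (auto simp: delta_def)
    also have "\<dots> = h B" using h[of B] finite_W by (simp add: sum.delta)
    finally show "h B = (\<Sum>A\<in>carrier W. scale (h A) (delta A)) B" ..
  qed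
  moreover have "(\<Sum>A\<in>carrier W. scale (h A) (delta A)) \<in> ?T"
    by (intro funs.subspace_sum[OF sub] funs.subspace_scale[OF sub] delta_in_graded_map_image)
  ultimately have "h \<in> ?T" by simp
  then show ?thesis by blast
qed

text \<open>The hypotheses say that \<open>N\<close> is the ideal generated by the skew relations and the invariants. One
inclusion is checked on generators, the other is a comparison of dimensions.\<close>

lemma graded_map_kernel:
  assumes N: "ideal N free_algebra" "skew_ideal \<subseteq> N" "invariant_generators m p \<subseteq> N"
    and min: "\<And>I. ideal I free_algebra \<Longrightarrow> skew_ideal \<subseteq> I \<Longrightarrow> invariant_generators m p \<subseteq> I \<Longrightarrow> N \<subseteq> I"
    and f: "f \<in> F"
  shows "graded_map f = 0 \<longleftrightarrow> f \<in> N"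
proof -
  have kills: "graded_map g = 0" if g: "g \<in> N" for g
  proof
    fix A
    let ?I = "{f :: 'n list \<Rightarrow> complex. f \<in> F \<and>
      (\<forall>u v. lift_words (\<lambda>w. graded_fun w A) (word u \<star> f \<star> word v) = 0)}"
    have id: "ideal ?I free_algebra" by (rule ideal_lift_words_kernel)
    have "N \<subseteq> ?I"
    proof (rule min[OF id])
      show "skew_ideal \<subseteq> ?I"
      proof (rule skew_ideal_minimal[OF id])
        fix i j :: 'n assume "i \<noteq> j"
        then show "word [i, j] + word [j, i] \<in> ?I"
          using graded_fun_kills_relations free_closed(1)[OF word_closed word_closed] by blast
      qed
      show "invariant_generators m p \<subseteq> ?I"
      proof
        fix k :: "'n list \<Rightarrow> complex" assume k: "k \<in> invariant_generators m p"
        then have "k \<in> F" by (simp add: invariant_generators_def)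
        then show "k \<in> ?I" using graded_fun_kills_invariants[OF k] by blast
      qed
    qed
    then have "g \<in> ?I" using g by blast
    then have "lift_words (\<lambda>w. graded_fun w A) (word [] \<star> g \<star> word []) = 0" and gc: "g \<in> F"
      by blast+
    moreover have "word [] \<star> g \<star> word [] = g"
      by (simp only: free_mult_one[OF gc])
    ultimately show "graded_map g A = 0 A" unfolding graded_map_def by (simp only: zero_fun_apply)
  qed
  obtain G where G: "finite G" "G \<subseteq> range word" "card G \<le> fact CARD('n) * ((m div p) * m ^ (CARD('n) - 1))"
    "F \<subseteq> funs.span (G \<union> N)"
    using coinvariant_span_bound[OF m p N] by blast
  show ?thesis
  proof
    assume T: "graded_map f = 0"
    show "f \<in> N"
    proof (rule kernel_eq_by_dimension[OF subspace_free graded_map_linear(1,2) ideal_free_subspace[OF N(1)]])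
      show "N \<subseteq> F" using ideal.Icarr[OF N(1)] by blast
      show "G \<subseteq> F" using G(2) word_closed by blast
      show "card G \<le> card (carrier W)"
        using G(3) card_mystic_group[OF m p] unfolding W by (rule order_trans)
      show "delta ` carrier W \<subseteq> funs.span (graded_map ` F)"
        using delta_in_graded_map_image by (intro image_subsetI funs.span_base)
    qed (use G(1,4) f T kills finite_W in auto)
  qed (rule kills)
qed

section \<open>The coinvariant algebra as a quotient of the free algebra\<close>

interpretation skew: complex_algebra "skew_algebra :: (complex, ('n list \<Rightarrow> complex) set) module"
  unfolding skew_algebra_def by (rule free.complex_algebra_quotient[OF ideal_skew_ideal])

abbreviation skew_coset :: "('n list \<Rightarrow> complex) \<Rightarrow> ('n list \<Rightarrow> complex) set"
  where "skew_coset f \<equiv> skew_ideal +>\<^bsub>free_algebra\<^esub> f"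

lemma skew_carrier: "carrier skew_algebra = skew_coset ` F"
  unfolding skew_algebra_def by (rule free.quotient_algebra_carrier[OF ideal_skew_ideal])

lemma skew_ops:
  assumes "f \<in> F" "g \<in> F"
  shows "skew_coset f \<oplus>\<^bsub>skew_algebra\<^esub> skew_coset g = skew_coset (f + g)"
    and "skew_coset f \<otimes>\<^bsub>skew_algebra\<^esub> skew_coset g = skew_coset (f \<star> g)"
    and "c \<odot>\<^bsub>skew_algebra\<^esub> skew_coset f = skew_coset (scale c f)"
  unfolding skew_algebra_def
  using free.quotient_algebra_add[OF ideal_skew_ideal assms]
    free.quotient_algebra_mult[OF ideal_skew_ideal assms]
    free.quotient_algebra_smult[OF ideal_skew_ideal assms(1)]
  by (simp_all only: free_algebra_simps)

lemma skew_coset_closed: "f \<in> F \<Longrightarrow> skew_coset f \<in> carrier skew_algebra"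
  unfolding skew_carrier by (rule imageI)

lemma skew_coset_eq_iff:
  assumes "f \<in> F" "g \<in> F"
  shows "skew_coset f = skew_coset g \<longleftrightarrow> f - g \<in> skew_ideal"
  using free.coset_eq_iff[OF ideal_skew_ideal assms] by (simp only: free_minus[OF assms])

lemma zero_closed: "0 \<in> F"
  by (rule funs.subspace_0[OF subspace_free])

lemma skew_zero: "\<zero>\<^bsub>skew_algebra\<^esub> = skew_coset 0"
proof -
  have "skew_coset 0 = 0 \<odot>\<^bsub>skew_algebra\<^esub> skew_coset 0"
    using skew_ops(3)[OF zero_closed zero_closed, of 0] by (simp only: funs.scale_zero_left)
  also have "\<dots> = \<zero>\<^bsub>skew_algebra\<^esub>"
    using skew.smult_l_null[OF skew_coset_closed[OF zero_closed]] by simp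
  finally show ?thesis ..
qed

lemma skew_minus:
  assumes "f \<in> F" "g \<in> F"
  shows "skew_coset f \<ominus>\<^bsub>skew_algebra\<^esub> skew_coset g = skew_coset (f - g)"
proof -
  have "f + scale (- 1) g = f - g" by (simp add: fun_eq_iff)
  then show ?thesis
    unfolding a_minus_def skew.minus_eq_smult[OF skew_coset_closed[OF assms(2)]]
    by (simp only: skew_ops(3)[OF assms(2) assms(2)] skew_ops(1)[OF assms(1) free_closed(3)[OF assms(2) assms(2)]])
qed

lemma action_W_closed: "B \<in> carrier W \<Longrightarrow> f \<in> F \<Longrightarrow> free_action B f \<in> F"
  using W_form[of B] free_action_closed by blast

lemma action_W_skew_ideal: "B \<in> carrier W \<Longrightarrow> f \<in> skew_ideal \<Longrightarrow> free_action B f \<in> skew_ideal"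
  using W_form[of B] skew_ideal_action bij_is_inj by blast

lemma action_W_mult:
  "B \<in> carrier W \<Longrightarrow> f \<in> F \<Longrightarrow> g \<in> F \<Longrightarrow> free_action B (f \<star> g) = free_action B f \<star> free_action B g"
  using W_form[of B] free_action_mult by blast

lemma skew_action_coset:
  assumes B: "B \<in> carrier W" and f: "f \<in> F"
  shows "skew_action B (skew_coset f) = skew_coset (free_action B f)"
  unfolding skew_action_def
proof (rule free.quotient_map_coset[OF ideal_skew_ideal f])
  fix f g :: "'n list \<Rightarrow> complex" assume "f \<in> F" "g \<in> F"
  show "free_action B (f \<oplus>\<^bsub>free_algebra\<^esub> g) = free_action B f \<oplus>\<^bsub>free_algebra\<^esub> free_action B g"
    by (simp only: free_algebra_simps free_action_linear)
qed (use action_W_closed[OF B] action_W_skew_ideal[OF B] in blast)+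

lemma invariant_ideal_eq:
  "invariant_ideal W = Idl\<^bsub>skew_algebra\<^esub> (skew_coset ` invariant_generators m p)"
proof -
  have "{s. (\<exists>d>0. s \<in> skew_homogeneous d) \<and> (\<forall>A\<in>carrier W. skew_action A s = s)} =
      skew_coset ` invariant_generators m p" (is "?L = ?R")
  proof
    show "?L \<subseteq> ?R"
    proof
      fix s assume s: "s \<in> ?L"
      then obtain d f where f: "d > 0" "s = skew_coset f" "f \<in> F" "\<And>w. f w \<noteq> 0 \<Longrightarrow> length w = d"
        unfolding skew_homogeneous_def by blast
      have "free_action A f - f \<in> skew_ideal" if A: "A \<in> carrier W" for A
      proof -
        have "skew_action A (skew_coset f) = skew_coset f" using s A f(2) by blast
        then show ?thesis
          unfolding skew_action_coset[OF A f(3)] skew_coset_eq_iff[OF action_W_closed[OF A f(3)] f(3)] .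
      qed
      then have "f \<in> invariant_generators m p"
        using f unfolding invariant_generators_def W by blast
      then show "s \<in> ?R" using f(2) by blast
    qed
    show "?R \<subseteq> ?L"
    proof
      fix s assume "s \<in> ?R"
      then obtain f where f: "s = skew_coset f" "f \<in> invariant_generators m p" by blast
      then have fc: "f \<in> F" and hom: "\<exists>d>0. \<forall>w. f w \<noteq> 0 \<longrightarrow> length w = d"
        and inv: "\<And>A. A \<in> carrier W \<Longrightarrow> free_action A f - f \<in> skew_ideal"
        unfolding invariant_generators_def W by blast+
      have "skew_action A s = s" if A: "A \<in> carrier W" for A
        unfolding f(1) skew_action_coset[OF A fc]
        using inv[OF A] skew_coset_eq_iff[OF action_W_closed[OF A fc] fc] by blast
      moreover have "\<exists>d>0. s \<in> skew_homogeneous d"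
        using hom fc f(1) unfolding skew_homogeneous_def by blast
      ultimately show "s \<in> ?L" by blast
    qed
  qed
  then show ?thesis unfolding invariant_ideal_def by (simp only:)
qed

lemma generators_closed: "skew_coset ` invariant_generators m p \<subseteq> carrier skew_algebra"
  unfolding skew_carrier invariant_generators_def by blast

lemma ideal_invariant_ideal: "ideal (invariant_ideal W) skew_algebra"
  unfolding invariant_ideal_eq by (rule skew.genideal_ideal[OF generators_closed])

text \<open>The coinvariant algebra is an iterated quotient; this ideal presents it as a single quotient of the
free algebra.\<close>

definition coinvariant_kernel :: "('n list \<Rightarrow> complex) set"
  where "coinvariant_kernel = {f \<in> F. skew_coset f \<in> invariant_ideal W}"

lemma ideal_coinvariant_kernel: "ideal coinvariant_kernel free_algebra"
proof -
  interpret I: ideal "invariant_ideal W" skew_algebra by (rule ideal_invariant_ideal)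
  show ?thesis
  proof (rule ideal_freeI)
    show "funs.subspace coinvariant_kernel"
    proof (rule funs.subspaceI)
      show "0 \<in> coinvariant_kernel"
        unfolding coinvariant_kernel_def using zero_closed I.zero_closed[unfolded skew_zero] by blast
      show "f + g \<in> coinvariant_kernel" if "f \<in> coinvariant_kernel" "g \<in> coinvariant_kernel" for f g
        using that free_closed(1)[of f g] I.a_closed[of "skew_coset f" "skew_coset g"]
        unfolding coinvariant_kernel_def mem_Collect_eq by (metis skew_ops(1))
      show "scale c f \<in> coinvariant_kernel" if "f \<in> coinvariant_kernel" for c f
        using that free_closed(3)[of f f c] skew.ideal_smult_closed[OF ideal_invariant_ideal, of "skew_coset f" c]
        unfolding coinvariant_kernel_def mem_Collect_eq by (metis skew_ops(3))
    qed
  next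
    fix f and u :: "'n list" assume "f \<in> coinvariant_kernel"
    then have f: "f \<in> F" "skew_coset f \<in> invariant_ideal W" by (auto simp: coinvariant_kernel_def)
    have u: "word u \<in> F" by (rule word_closed)
    show "word u \<star> f \<in> coinvariant_kernel"
      using I.I_l_closed[OF f(2) skew_coset_closed[OF u]] free_mult_closed[OF u f(1)]
      unfolding coinvariant_kernel_def skew_ops(2)[OF u f(1)] by blast
    show "f \<star> word u \<in> coinvariant_kernel"
      using I.I_r_closed[OF f(2) skew_coset_closed[OF u]] free_mult_closed[OF f(1) u]
      unfolding coinvariant_kernel_def skew_ops(2)[OF f(1) u] by blast
  qed (simp only: coinvariant_kernel_def mem_Collect_eq subset_iff, blast)
qed

lemma skew_ideal_subset_kernel: "skew_ideal \<subseteq> coinvariant_kernel"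
proof
  fix f :: "'n list \<Rightarrow> complex" assume f: "f \<in> skew_ideal"
  then have fc: "f \<in> F" by (rule skew_ideal_closed)
  have "f - 0 \<in> skew_ideal" using f by (simp only: diff_zero)
  then have "skew_coset f = skew_coset 0" unfolding skew_coset_eq_iff[OF fc zero_closed] .
  then show "f \<in> coinvariant_kernel"
    using ideal_coinvariant_kernel fc skew_zero
      additive_subgroup.zero_closed[OF ideal.axioms(1)[OF ideal_invariant_ideal]]
    unfolding coinvariant_kernel_def by (metis (no_types, lifting) mem_Collect_eq)
qed

lemma generators_subset_kernel: "invariant_generators m p \<subseteq> coinvariant_kernel"
  using skew.genideal_self[OF generators_closed]
  unfolding coinvariant_kernel_def invariant_ideal_eq invariant_generators_def by blast

lemma coinvariant_kernel_minimal:
  assumes J: "ideal J free_algebra" "skew_ideal \<subseteq> J" "invariant_generators m p \<subseteq> J"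
  shows "coinvariant_kernel \<subseteq> J"
proof -
  have sub: "funs.subspace J" by (rule ideal_free_subspace[OF J(1)])
  have JF: "J \<subseteq> F" using ideal.Icarr[OF J(1)] by blast
  have "ideal (skew_coset ` J) skew_algebra"
  proof (rule skew.subspace_idealI)
    show "skew_coset ` J \<subseteq> carrier skew_algebra" unfolding skew_carrier using JF by blast
    show "\<zero>\<^bsub>skew_algebra\<^esub> \<in> skew_coset ` J" unfolding skew_zero by (rule imageI[OF funs.subspace_0[OF sub]])
  next
    fix x y assume "x \<in> skew_coset ` J" "y \<in> skew_coset ` J"
    then obtain f g where fg: "x = skew_coset f" "f \<in> J" "y = skew_coset g" "g \<in> J" by blast
    show "x \<oplus>\<^bsub>skew_algebra\<^esub> y \<in> skew_coset ` J"
      unfolding fg(1,3) skew_ops(1)[OF subsetD[OF JF fg(2)] subsetD[OF JF fg(4)]]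
      by (rule imageI[OF funs.subspace_add[OF sub fg(2,4)]])
  next
    fix c x assume "x \<in> skew_coset ` J"
    then obtain f where f: "x = skew_coset f" "f \<in> J" by blast
    have fF: "f \<in> F" by (rule subsetD[OF JF f(2)])
    show "c \<odot>\<^bsub>skew_algebra\<^esub> x \<in> skew_coset ` J"
      unfolding f(1) skew_ops(3)[OF fF fF] by (rule imageI[OF funs.subspace_scale[OF sub f(2)]])
  next
    fix x a assume "x \<in> skew_coset ` J" "a \<in> carrier (skew_algebra :: (complex, ('n list \<Rightarrow> complex) set) module)"
    then obtain f g where fg: "x = skew_coset f" "f \<in> J" "a = skew_coset g" "g \<in> F"
      unfolding skew_carrier by blast
    have fF: "f \<in> F" by (rule subsetD[OF JF fg(2)])
    show "a \<otimes>\<^bsub>skew_algebra\<^esub> x \<in> skew_coset ` J"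
      unfolding fg(1,3) skew_ops(2)[OF fg(4) fF] by (rule imageI[OF ideal.I_l_closed[OF J(1) fg(2,4)]])
    show "x \<otimes>\<^bsub>skew_algebra\<^esub> a \<in> skew_coset ` J"
      unfolding fg(1,3) skew_ops(2)[OF fF fg(4)] by (rule imageI[OF ideal.I_r_closed[OF J(1) fg(2,4)]])
  qed
  then have sub_img: "invariant_ideal W \<subseteq> skew_coset ` J"
    unfolding invariant_ideal_eq by (rule skew.genideal_minimal[OF _ image_mono[OF J(3)]])
  show ?thesis
  proof
    fix f assume "f \<in> coinvariant_kernel"
    then have f: "f \<in> F" "skew_coset f \<in> invariant_ideal W" by (auto simp: coinvariant_kernel_def)
    then obtain g where g: "g \<in> J" "skew_coset f = skew_coset g" using sub_img by blast
    then have "f - g \<in> J" using skew_coset_eq_iff[OF f(1) subsetD[OF JF g(1)]] J(2) by blast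
    then have "(f - g) + g \<in> J" by (rule funs.subspace_add[OF sub _ g(1)])
    then show "f \<in> J" by (simp only: diff_add_cancel)
  qed
qed

text \<open>The preimage of the kernel under the action of \<open>B\<close> is an ideal that contains the generators.\<close>

lemma coinvariant_kernel_stable:
  assumes B: "B \<in> carrier W" and f: "f \<in> coinvariant_kernel"
  shows "free_action B f \<in> coinvariant_kernel"
proof -
  let ?N = coinvariant_kernel
  let ?J = "{f \<in> F. free_action B f \<in> ?N}"
  have sub: "funs.subspace ?N" by (rule ideal_free_subspace[OF ideal_coinvariant_kernel])
  have "ideal ?J free_algebra"
  proof (rule ideal_freeI)
    show "funs.subspace ?J"
    proof (rule funs.subspaceI)
      show "0 \<in> ?J"
        unfolding mem_Collect_eq free_action_linear using zero_closed funs.subspace_0[OF sub] by (rule conjI)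
      show "f + g \<in> ?J" if "f \<in> ?J" "g \<in> ?J" for f g
        unfolding mem_Collect_eq free_action_linear
        using that free_closed(1)[of f g] funs.subspace_add[OF sub, of "free_action B f" "free_action B g"] by blast
      show "scale c f \<in> ?J" if "f \<in> ?J" for c f
        unfolding mem_Collect_eq free_action_linear
        using that free_closed(3)[of f f c] funs.subspace_scale[OF sub, of "free_action B f"] by blast
    qed
  next
    fix f u assume "f \<in> ?J"
    then have f: "f \<in> F" "free_action B f \<in> ?N" by blast+
    have u: "word u \<in> F" "free_action B (word u) \<in> F"
      using word_closed action_W_closed[OF B] by blast+
    show "word u \<star> f \<in> ?J"
      unfolding mem_Collect_eq action_W_mult[OF B u(1) f(1)]
      using free_mult_closed[OF u(1) f(1)] ideal.I_l_closed[OF ideal_coinvariant_kernel f(2) u(2)] by (rule conjI)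
    show "f \<star> word u \<in> ?J"
      unfolding mem_Collect_eq action_W_mult[OF B f(1) u(1)]
      using free_mult_closed[OF f(1) u(1)] ideal.I_r_closed[OF ideal_coinvariant_kernel f(2) u(2)] by (rule conjI)
  qed (rule Collect_restrict)
  moreover have "skew_ideal \<subseteq> ?J"
    using skew_ideal_closed action_W_skew_ideal[OF B] skew_ideal_subset_kernel by blast
  moreover have "invariant_generators m p \<subseteq> ?J"
  proof
    fix g :: "'n list \<Rightarrow> complex" assume g: "g \<in> invariant_generators m p"
    then have gF: "g \<in> F" and "free_action B g - g \<in> skew_ideal"
      using B unfolding invariant_generators_def W by blast+
    then have "(free_action B g - g) + g \<in> ?N"
      using g skew_ideal_subset_kernel generators_subset_kernel by (intro funs.subspace_add[OF sub]) blast+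
    then have "free_action B g \<in> ?N" by (simp only: diff_add_cancel)
    then show "g \<in> ?J" using gF by blast
  qed
  ultimately have "?N \<subseteq> ?J" by (rule coinvariant_kernel_minimal)
  then show ?thesis using f by blast
qed

definition coinvariant_class :: "('n list \<Rightarrow> complex) \<Rightarrow> ('n list \<Rightarrow> complex) set set"
  where "coinvariant_class f = invariant_ideal W +>\<^bsub>skew_algebra\<^esub> skew_coset f"

interpretation coinv: complex_algebra "coinvariant_algebra W"
  unfolding coinvariant_algebra_def by (rule skew.complex_algebra_quotient[OF ideal_invariant_ideal])

lemma coinvariant_carrier: "carrier (coinvariant_algebra W) = coinvariant_class ` F"
  unfolding coinvariant_algebra_def skew.quotient_algebra_carrier[OF ideal_invariant_ideal]
    skew_carrier image_image coinvariant_class_def ..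

lemma coinvariant_ops:
  assumes "f \<in> F" "g \<in> F"
  shows "coinvariant_class f \<oplus>\<^bsub>coinvariant_algebra W\<^esub> coinvariant_class g = coinvariant_class (f + g)"
    and "c \<odot>\<^bsub>coinvariant_algebra W\<^esub> coinvariant_class f = coinvariant_class (scale c f)"
  unfolding coinvariant_algebra_def coinvariant_class_def
  by (simp_all only: skew.quotient_algebra_add[OF ideal_invariant_ideal skew_coset_closed[OF assms(1)] skew_coset_closed[OF assms(2)]]
      skew.quotient_algebra_smult[OF ideal_invariant_ideal skew_coset_closed[OF assms(1)]] skew_ops[OF assms])

lemma coinvariant_class_eq_iff:
  assumes "f \<in> F" "g \<in> F"
  shows "coinvariant_class f = coinvariant_class g \<longleftrightarrow> f - g \<in> coinvariant_kernel"
  unfolding coinvariant_class_def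
    skew.coset_eq_iff[OF ideal_invariant_ideal skew_coset_closed[OF assms(1)] skew_coset_closed[OF assms(2)]]
    skew_minus[OF assms] coinvariant_kernel_def
  using free_closed(2)[OF assms] by blast

lemma coinvariant_action_class:
  assumes B: "B \<in> carrier W" and f: "f \<in> F"
  shows "coinvariant_action W B (coinvariant_class f) = coinvariant_class (free_action B f)"
proof -
  have "quotient_map skew_algebra (invariant_ideal W) (skew_action B)
      (invariant_ideal W +>\<^bsub>skew_algebra\<^esub> skew_coset f) =
      invariant_ideal W +>\<^bsub>skew_algebra\<^esub> skew_action B (skew_coset f)"
  proof (rule skew.quotient_map_coset[OF ideal_invariant_ideal skew_coset_closed[OF f]])
    fix s assume "s \<in> carrier (skew_algebra :: (complex, ('n list \<Rightarrow> complex) set) module)"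
    then obtain g where g: "s = skew_coset g" "g \<in> F" unfolding skew_carrier by blast
    show "skew_action B s \<in> carrier skew_algebra"
      unfolding g(1) skew_action_coset[OF B g(2)] by (rule skew_coset_closed[OF action_W_closed[OF B g(2)]])
  next
    fix s t assume "s \<in> carrier (skew_algebra :: (complex, ('n list \<Rightarrow> complex) set) module)"
      "t \<in> carrier (skew_algebra :: (complex, ('n list \<Rightarrow> complex) set) module)"
    then obtain g h where g: "s = skew_coset g" "g \<in> F" and h: "t = skew_coset h" "h \<in> F"
      unfolding skew_carrier by blast
    show "skew_action B (s \<oplus>\<^bsub>skew_algebra\<^esub> t) = skew_action B s \<oplus>\<^bsub>skew_algebra\<^esub> skew_action B t"
      unfolding g(1) h(1)
      by (simp only: skew_ops(1)[OF g(2) h(2)] skew_action_coset[OF B] g(2) h(2) free_closed(1)[OF g(2) h(2)]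
          skew_ops(1)[OF action_W_closed[OF B g(2)] action_W_closed[OF B h(2)]] free_action_linear)
  next
    fix s assume s: "s \<in> invariant_ideal W"
    then have "s \<in> carrier skew_algebra" using ideal.Icarr[OF ideal_invariant_ideal] by blast
    then obtain g where g: "s = skew_coset g" "g \<in> F" unfolding skew_carrier by blast
    then have "g \<in> coinvariant_kernel" using s unfolding coinvariant_kernel_def by blast
    then have "free_action B g \<in> coinvariant_kernel" by (rule coinvariant_kernel_stable[OF B])
    then show "skew_action B s \<in> invariant_ideal W"
      unfolding g(1) skew_action_coset[OF B g(2)] coinvariant_kernel_def by blast
  qed
  then show ?thesis
    unfolding coinvariant_action_def coinvariant_class_def skew_action_coset[OF B f] .
qed

section \<open>The regular representation\<close>

lemma representation_coinvariant: "representation W (coinvariant_algebra W) (coinvariant_action W)"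
  unfolding representation_def
proof (intro conjI ballI)
  let ?M = "coinvariant_algebra W"
  show "group W" by (rule group_axioms)
  show "Module.module complex_ring ?M" by (rule coinv.module_axioms)
  fix v assume "v \<in> carrier ?M"
  then obtain f where f: "v = coinvariant_class f" "f \<in> F" unfolding coinvariant_carrier by blast
  show "coinvariant_action W \<one> v = v"
    unfolding f(1) coinvariant_action_class[OF one_closed f(2)]
    using free_action_one[OF f(2)] by (simp only: W mystic_group_one)
next
  let ?M = "coinvariant_algebra W"
  fix g assume g: "g \<in> carrier W"
  show "coinvariant_action W g \<in> linear_maps ?M ?M"
    unfolding linear_maps_def
  proof (intro CollectI conjI ballI allI funcsetI)
    fix v assume "v \<in> carrier ?M"
    then obtain f where f: "v = coinvariant_class f" "f \<in> F" unfolding coinvariant_carrier by blast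
    show "coinvariant_action W g v \<in> carrier ?M"
      unfolding f(1) coinvariant_action_class[OF g f(2)] coinvariant_carrier
      by (rule imageI[OF action_W_closed[OF g f(2)]])
    show "coinvariant_action W g (c \<odot>\<^bsub>?M\<^esub> v) = c \<odot>\<^bsub>?M\<^esub> coinvariant_action W g v" for c
      unfolding f(1)
      by (simp only: coinvariant_ops(2)[OF f(2) f(2)] coinvariant_action_class[OF g] f(2) free_closed(3)[OF f(2) f(2)]
          coinvariant_ops(2)[OF action_W_closed[OF g f(2)] f(2)] free_action_linear)
  next
    fix v w assume "v \<in> carrier ?M" "w \<in> carrier ?M"
    then obtain f h where f: "v = coinvariant_class f" "f \<in> F" and h: "w = coinvariant_class h" "h \<in> F"
      unfolding coinvariant_carrier by blast
    show "coinvariant_action W g (v \<oplus>\<^bsub>?M\<^esub> w) = coinvariant_action W g v \<oplus>\<^bsub>?M\<^esub> coinvariant_action W g w"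
      unfolding f(1) h(1)
      by (simp only: coinvariant_ops(1)[OF f(2) h(2)] coinvariant_action_class[OF g] f(2) h(2) free_closed(1)[OF f(2) h(2)]
          coinvariant_ops(1)[OF action_W_closed[OF g f(2)] action_W_closed[OF g h(2)]] free_action_linear)
  qed
next
  fix g h v assume g: "g \<in> carrier W" and h: "h \<in> carrier W" and "v \<in> carrier (coinvariant_algebra W)"
  then obtain f where f: "v = coinvariant_class f" "f \<in> F" unfolding coinvariant_carrier by blast
  obtain \<sigma> c where gf: "g = mono_mat \<sigma> c" using W_form[OF g] by blast
  obtain \<tau> d where hf: "h = mono_mat \<tau> d" using W_form[OF h] by blast
  have "free_action (g ** h) f = free_action g (free_action h f)"
    unfolding gf hf by (rule free_action_compose[OF f(2)])
  then show "coinvariant_action W (g \<otimes> h) v = coinvariant_action W g (coinvariant_action W h v)"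
    unfolding f(1) coinvariant_action_class[OF m_closed[OF g h] f(2)] coinvariant_action_class[OF h f(2)]
      coinvariant_action_class[OF g action_W_closed[OF h f(2)]]
    by (simp only: W mystic_group_mult)
qed

lemma graded_map_eq_iff:
  assumes f: "f \<in> F" and g: "g \<in> F"
  shows "graded_map f = graded_map g \<longleftrightarrow> coinvariant_class f = coinvariant_class g"
proof -
  have "f - g = f + scale (- 1) g" by (simp add: fun_eq_iff)
  then have "graded_map (f - g) = graded_map f + scale (- 1) (graded_map g)"
    by (simp only: graded_map_linear(1)[OF f free_closed(3)[OF g g]] graded_map_linear(2))
  then have "graded_map (f - g) = graded_map f - graded_map g"
    by (simp add: fun_eq_iff)
  then have "graded_map f = graded_map g \<longleftrightarrow> graded_map (f - g) = 0"
    by (simp only: right_minus_eq)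
  also have "\<dots> \<longleftrightarrow> f - g \<in> coinvariant_kernel"
    by (rule graded_map_kernel[OF ideal_coinvariant_kernel skew_ideal_subset_kernel generators_subset_kernel
          coinvariant_kernel_minimal free_closed(2)[OF f g]])
  finally show ?thesis unfolding coinvariant_class_eq_iff[OF f g] .
qed

text \<open>The coinvariant algebra and the functions on the group are images of the free algebra under
equivariant maps with the same kernel, so lifting through one map and applying the other is an
isomorphism.\<close>

lemma affords_regular: "affords_regular_representation W (coinvariant_algebra W) (coinvariant_action W)"
proof -
  let ?M = "coinvariant_algebra W" and ?A = "group_algebra W"
  define lift where "lift h = (SOME f. f \<in> F \<and> graded_map f = h)" for h
  define \<phi> where "\<phi> h = coinvariant_class (lift h)" for h
  have carrier_iff: "h \<in> carrier ?A \<longleftrightarrow> (\<forall>A. A \<notin> carrier W \<longrightarrow> h A = 0)" for h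
  proof
    assume h: "\<forall>A. A \<notin> carrier W \<longrightarrow> h A = 0"
    then have "{A. h A \<noteq> 0} \<subseteq> carrier W" by blast
    then show "h \<in> carrier ?A" using finite_subset[OF _ finite_W] by (simp add: group_algebra_def)
  qed (auto simp: group_algebra_def)
  have lift: "lift h \<in> F" "graded_map (lift h) = h" if h: "h \<in> carrier ?A" for h
  proof -
    have "\<exists>f\<in>F. graded_map f = h" using h unfolding carrier_iff by (intro graded_map_surj) blast
    then have "\<exists>f. f \<in> F \<and> graded_map f = h" by blast
    from someI_ex[OF this] show "lift h \<in> F" "graded_map (lift h) = h"
      unfolding lift_def by (rule conjunct1, rule conjunct2)
  qed
  have graded_carrier: "graded_map f \<in> carrier ?A" for f
    unfolding carrier_iff by (simp add: graded_map_outside)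
  have \<phi>: "\<phi> (graded_map f) = coinvariant_class f" if f: "f \<in> F" for f
    unfolding \<phi>_def
    using graded_map_eq_iff[OF lift(1)[OF graded_carrier] f] lift(2)[OF graded_carrier] by blast
  have obt: "\<exists>f\<in>F. h = graded_map f" if "h \<in> carrier ?A" for h
    using lift[OF that] by metis
  have "\<phi> \<in> linear_maps ?A ?M"
    unfolding linear_maps_def
  proof (intro CollectI conjI ballI allI funcsetI)
    fix h assume "h \<in> carrier ?A"
    then obtain f where f: "f \<in> F" "h = graded_map f" using obt by blast
    show "\<phi> h \<in> carrier ?M"
      unfolding f(2) \<phi>[OF f(1)] coinvariant_carrier by (rule imageI[OF f(1)])
    have "c \<odot>\<^bsub>?A\<^esub> h = graded_map (scale c f)" for c
      unfolding f(2) graded_map_linear(2) by (simp add: group_algebra_def scale_def)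
    then show "\<phi> (c \<odot>\<^bsub>?A\<^esub> h) = c \<odot>\<^bsub>?M\<^esub> \<phi> h" for c
      unfolding f(2) by (simp only: \<phi>[OF f(1)] \<phi>[OF free_closed(3)[OF f(1) f(1)]] coinvariant_ops(2)[OF f(1) f(1)])
  next
    fix h k assume "h \<in> carrier ?A" "k \<in> carrier ?A"
    then obtain f g where f: "f \<in> F" "h = graded_map f" and g: "g \<in> F" "k = graded_map g" using obt by blast
    have "h \<oplus>\<^bsub>?A\<^esub> k = graded_map (f + g)"
      unfolding f(2) g(2) graded_map_linear(1)[OF f(1) g(1)] by (simp add: group_algebra_def plus_fun_def)
    then show "\<phi> (h \<oplus>\<^bsub>?A\<^esub> k) = \<phi> h \<oplus>\<^bsub>?M\<^esub> \<phi> k"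
      unfolding f(2) g(2)
      by (simp only: \<phi>[OF f(1)] \<phi>[OF g(1)] \<phi>[OF free_closed(1)[OF f(1) g(1)]] coinvariant_ops(1)[OF f(1) g(1)])
  qed
  moreover have "bij_betw \<phi> (carrier ?A) (carrier ?M)"
    unfolding bij_betw_def
  proof
    show "inj_on \<phi> (carrier ?A)"
    proof (rule inj_onI)
      fix h k assume "h \<in> carrier ?A" "k \<in> carrier ?A" and eq: "\<phi> h = \<phi> k"
      then obtain f g where f: "f \<in> F" "h = graded_map f" and g: "g \<in> F" "k = graded_map g" using obt by blast
      show "h = k"
        using eq unfolding f(2) g(2) \<phi>[OF f(1)] \<phi>[OF g(1)] graded_map_eq_iff[OF f(1) g(1)] .
    qed
    show "\<phi> ` carrier ?A = carrier ?M"
    proof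
      show "\<phi> ` carrier ?A \<subseteq> carrier ?M"
        using \<open>\<phi> \<in> linear_maps ?A ?M\<close> unfolding linear_maps_def by blast
      show "carrier ?M \<subseteq> \<phi> ` carrier ?A"
      proof
        fix v assume "v \<in> carrier ?M"
        then obtain f where f: "v = coinvariant_class f" "f \<in> F" unfolding coinvariant_carrier by blast
        show "v \<in> \<phi> ` carrier ?A"
          unfolding f(1) \<phi>[OF f(2), symmetric] by (rule imageI[OF graded_carrier])
      qed
    qed
  qed
  moreover have "\<phi> (regular_action W g h) = coinvariant_action W g (\<phi> h)"
    if g: "g \<in> carrier W" and h: "h \<in> carrier ?A" for g h
  proof -
    obtain f where f: "f \<in> F" "h = graded_map f" using obt[OF h] by blast
    show ?thesis
      unfolding f(2) graded_map_equivariant[OF g f(1), symmetric] \<phi>[OF f(1)] \<phi>[OF action_W_closed[OF g f(1)]]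
        coinvariant_action_class[OF g f(1)] ..
  qed
  ultimately show ?thesis
    unfolding affords_regular_representation_def representation_isomorphic_def
    using representation_coinvariant by blast
qed

end

theorem theorem5p4:
  fixes m p :: nat and W :: "(complex^'n::finite^'n) monoid"
  assumes "m > 0" and "p > 0" and "p dvd m" and "even m"
    and "W = mystic_group m p"
  shows "affords_regular_representation W (coinvariant_algebra W) (coinvariant_action W)"
proof -
  interpret mystic m p W
    by (rule mystic.intro) (use assms in auto)
  show ?thesis by (rule affords_regular)
qed

end
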